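(* Fix $\hat\alpha\in(0,(b-a)^{-1/2})$ and set $\hat\beta=\hat\alpha(1-(b-a)\hat\alpha^2)$. For small $\varepsilon>0$ let $c=1+\frac12\varepsilon^2$, $\alpha=\varepsilon\hat\alpha$, and for $\Lambda\in\mathbb C$ with $\operatorname{Re}\Lambda\ge-\hat\beta/2$ set $\lambda=\frac12\varepsilon^3\Lambda$ and $\hat W_\varepsilon(\Lambda)=I_\varepsilon^{-1}\mathcal W(\lambda)I_\varepsilon$, a bounded operator on $L^2_{\hat\alpha}$. Then $\sup_{\operatorname{Re}\Lambda\ge-\hat\beta/2}\|\hat W_\varepsilon(\Lambda)-\mathcal W_0(\Lambda)\|_{L^2_{\hat\alpha}\to L^2_{\hat\alpha}}\to0$ as $\varepsilon\to0$.
   Context: Fix $0<a<b$, $B=I-b\partial^2$ ($\partial=\partial_x$). For $c>1$: $q_c(x)=\frac{c^2-1}{c}\operatorname{sech}^2(\tfrac12\alpha_cx)$, $r_c=-cq_c$, $\alpha_c=\sqrt{(c^2-1)/(bc^2-a)}$. $L^2_\alpha=\{g:e^{\alpha x}g\in L^2(\mathbb R)\}$. Fourier multipliers act on $L^2_\alpha$ via symbols evaluated at $k+i\alpha$ (with $\hat g(k)=\int ge^{-ikx}dx$, $\partial$ has symbol $i\xi$). $S$ is the multiplier with symbol $\hat S(\xi)=\sqrt{(1+a\xi^2)/(1+b\xi^2)}$ (principal branch) and $Q_\pm=c\partial\pm S\partial$ (symbols $i\xi c\pm i\xi\hat S(\xi)$). Define $R_r=\frac12B^{-1}(r_c\partial+2r_c')S^{-1}$,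 $R_q=\frac12B^{-1}(q_c'+2q_c\partial)$ (here $r_c\partial$ means $g\mapsto r_c\partial g$, $2r_c'$ means multiplication by $2r_c'$), and $\mathcal W(\lambda)=I+(R_q+R_r)(\lambda-Q_+)^{-1}+(R_q-R_r)(\lambda-Q_-)^{-1}$ on $L^2_\alpha$. Let $\theta_0(x)=\operatorname{sech}^2(\tfrac12\hat\alpha_0x)$ with $\hat\alpha_0=(b-a)^{-1/2}$, and $\mathcal W_0(\Lambda)=I+(3\partial\theta_0)(\Lambda-\partial+(b-a)\partial^3)^{-1}$ on $L^2_{\hat\alpha}$, where $(3\partial\theta_0)g=3\partial(\theta_0g)$. The scaling operator is $(I_\varepsilon g)(x)=\sqrt\varepsilon\,g(\varepsilon x)$, an isometry $L^2_{\hat\alpha}\to L^2_{\varepsilon\hat\alpha}$. *)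

theory Defs
  imports "HOL-Analysis.Analysis"
begin

definition L2 :: "(real \<Rightarrow> complex) \<Rightarrow> bool" where
  "L2 f \<longleftrightarrow> f \<in> borel_measurable lborel \<and> integrable lborel (\<lambda>x. (cmod (f x))\<^sup>2)"

definition L2norm :: "(real \<Rightarrow> complex) \<Rightarrow> real" where
  "L2norm f = sqrt (LINT x|lborel. (cmod (f x))\<^sup>2)"

definition L2w :: "real \<Rightarrow> (real \<Rightarrow> complex) \<Rightarrow> bool" where
  "L2w al g \<longleftrightarrow> L2 (\<lambda>x. complex_of_real (exp (al * x)) * g x)"

definition L2wnorm :: "real \<Rightarrow> (real \<Rightarrow> complex) \<Rightarrow> real" where
  "L2wnorm al g = L2norm (\<lambda>x. complex_of_real (exp (al * x)) * g x)"

definition fourier :: "(real \<Rightarrow> complex) \<Rightarrow> real \<Rightarrow> complex" where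
  "fourier g k = (LINT x|lborel. g x * exp (- (\<i> * complex_of_real k * complex_of_real x)))"

definition inv_fourier :: "(real \<Rightarrow> complex) \<Rightarrow> real \<Rightarrow> complex" where
  "inv_fourier G x = complex_of_real (1 / (2 * pi)) *
     (LINT k|lborel. G k * exp (\<i> * complex_of_real k * complex_of_real x))"

text \<open>Test functions: integrable, square integrable, and with Fourier transform
  decaying faster than any polynomial (in L1 and L2 sense). This class contains the
  Schwartz class and is dense in L2.\<close>
definition test_fun :: "(real \<Rightarrow> complex) \<Rightarrow> bool" where
  "test_fun \<phi> \<longleftrightarrow> L2 \<phi> \<and> integrable lborel \<phi> \<and>
     (\<forall>n::nat. integrable lborel (\<lambda>k. (1 + \<bar>k\<bar>) ^ n * cmod (fourier \<phi> k)) \<and>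
               integrable lborel (\<lambda>k. (1 + \<bar>k\<bar>) ^ n * (cmod (fourier \<phi> k))\<^sup>2))"

text \<open>Fourier multiplier with symbol m on L2, defined by duality against test functions:
  T_m g is the L2 function h with  <h, phi> = <g, T_(conj m) phi>  for all test functions phi.\<close>
definition mult_L2 :: "(real \<Rightarrow> complex) \<Rightarrow> (real \<Rightarrow> complex) \<Rightarrow> (real \<Rightarrow> complex)" where
  "mult_L2 m g = (SOME h. L2 h \<and> (\<forall>\<phi>. test_fun \<phi> \<longrightarrow>
      (LINT x|lborel. h x * cnj (\<phi> x)) =
      (LINT x|lborel. g x * cnj (inv_fourier (\<lambda>k. cnj (m k) * fourier \<phi> k) x))))"

text \<open>Fourier multiplier with (complex-variable) symbol M acting on L2w al:
  the symbol is evaluated at k + i al, i.e. conjugate by the weight e^(al x).\<close>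
definition multw :: "real \<Rightarrow> (complex \<Rightarrow> complex) \<Rightarrow> (real \<Rightarrow> complex) \<Rightarrow> (real \<Rightarrow> complex)" where
  "multw al M g = (\<lambda>x. complex_of_real (exp (- al * x)) *
      mult_L2 (\<lambda>k. M (complex_of_real k + \<i> * complex_of_real al))
              (\<lambda>y. complex_of_real (exp (al * y)) * g y) x)"

definition mulop :: "(real \<Rightarrow> real) \<Rightarrow> (real \<Rightarrow> complex) \<Rightarrow> (real \<Rightarrow> complex)" where
  "mulop f g = (\<lambda>x. complex_of_real (f x) * g x)"

definition dsym :: "complex \<Rightarrow> complex" where
  "dsym z = \<i> * z"

definition Binv_sym :: "real \<Rightarrow> complex \<Rightarrow> complex" where  \<comment> \<open>B = I - b d^2\<close>
  "Binv_sym b z = 1 / (1 + complex_of_real b * z\<^sup>2)"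

definition S_sym :: "real \<Rightarrow> real \<Rightarrow> complex \<Rightarrow> complex" where
  "S_sym a b z = csqrt ((1 + complex_of_real a * z\<^sup>2) / (1 + complex_of_real b * z\<^sup>2))"

definition Sinv_sym :: "real \<Rightarrow> real \<Rightarrow> complex \<Rightarrow> complex" where
  "Sinv_sym a b z = 1 / S_sym a b z"

definition Qp_sym :: "real \<Rightarrow> real \<Rightarrow> real \<Rightarrow> complex \<Rightarrow> complex" where
  "Qp_sym a b c z = \<i> * z * complex_of_real c + \<i> * z * S_sym a b z"

definition Qm_sym :: "real \<Rightarrow> real \<Rightarrow> real \<Rightarrow> complex \<Rightarrow> complex" where
  "Qm_sym a b c z = \<i> * z * complex_of_real c - \<i> * z * S_sym a b z"

definition sech :: "real \<Rightarrow> real" where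
  "sech x = 1 / cosh x"

definition alpha_c :: "real \<Rightarrow> real \<Rightarrow> real \<Rightarrow> real" where
  "alpha_c a b c = sqrt ((c\<^sup>2 - 1) / (b * c\<^sup>2 - a))"

definition q_c :: "real \<Rightarrow> real \<Rightarrow> real \<Rightarrow> real \<Rightarrow> real" where
  "q_c a b c x = (c\<^sup>2 - 1) / c * (sech (alpha_c a b c * x / 2))\<^sup>2"

definition r_c :: "real \<Rightarrow> real \<Rightarrow> real \<Rightarrow> real \<Rightarrow> real" where
  "r_c a b c x = - c * q_c a b c x"

definition R_r :: "real \<Rightarrow> real \<Rightarrow> real \<Rightarrow> real \<Rightarrow> (real \<Rightarrow> complex) \<Rightarrow> (real \<Rightarrow> complex)" where
  "R_r a b c al h = (let s = multw al (Sinv_sym a b) h in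
     (\<lambda>x. (1/2) * multw al (Binv_sym b)
        (\<lambda>y. mulop (r_c a b c) (multw al dsym s) y
           + 2 * mulop (deriv (r_c a b c)) s y) x))"

definition R_q :: "real \<Rightarrow> real \<Rightarrow> real \<Rightarrow> real \<Rightarrow> (real \<Rightarrow> complex) \<Rightarrow> (real \<Rightarrow> complex)" where
  "R_q a b c al h =
     (\<lambda>x. (1/2) * multw al (Binv_sym b)
        (\<lambda>y. mulop (deriv (q_c a b c)) h y + 2 * mulop (q_c a b c) (multw al dsym h) y) x)"

definition W_op :: "real \<Rightarrow> real \<Rightarrow> real \<Rightarrow> real \<Rightarrow> complex \<Rightarrow> (real \<Rightarrow> complex) \<Rightarrow> (real \<Rightarrow> complex)" where
  "W_op a b c al lam g =
     (let hp = multw al (\<lambda>z. 1 / (lam - Qp_sym a b c z)) g;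
          hm = multw al (\<lambda>z. 1 / (lam - Qm_sym a b c z)) g
      in (\<lambda>x. g x + (R_q a b c al hp x + R_r a b c al hp x)
                  + (R_q a b c al hm x - R_r a b c al hm x)))"

definition theta0 :: "real \<Rightarrow> real \<Rightarrow> real \<Rightarrow> real" where
  "theta0 a b x = (sech ((1 / sqrt (b - a)) * x / 2))\<^sup>2"

definition W0_op :: "real \<Rightarrow> real \<Rightarrow> real \<Rightarrow> complex \<Rightarrow> (real \<Rightarrow> complex) \<Rightarrow> (real \<Rightarrow> complex)" where
  "W0_op a b al Lam g =
     (let h = multw al (\<lambda>z. 1 / (Lam - dsym z + complex_of_real (b - a) * (dsym z) ^ 3)) g
      in (\<lambda>x. g x + 3 * multw al dsym (mulop (theta0 a b) h) x))"

definition I_eps :: "real \<Rightarrow> (real \<Rightarrow> complex) \<Rightarrow> (real \<Rightarrow> complex)" where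
  "I_eps eps g = (\<lambda>x. complex_of_real (sqrt eps) * g (eps * x))"

definition I_eps_inv :: "real \<Rightarrow> (real \<Rightarrow> complex) \<Rightarrow> (real \<Rightarrow> complex)" where
  "I_eps_inv eps g = (\<lambda>x. complex_of_real (1 / sqrt eps) * g (x / eps))"

definition What :: "real \<Rightarrow> real \<Rightarrow> real \<Rightarrow> real \<Rightarrow> complex \<Rightarrow> (real \<Rightarrow> complex) \<Rightarrow> (real \<Rightarrow> complex)" where
  "What a b ahat eps Lam g =
     I_eps_inv eps (W_op a b (1 + eps\<^sup>2 / 2) (eps * ahat)
        (complex_of_real (eps ^ 3 / 2) * Lam) (I_eps eps g))"

definition opnorm_le :: "real \<Rightarrow> ((real \<Rightarrow> complex) \<Rightarrow> (real \<Rightarrow> complex)) \<Rightarrow> real \<Rightarrow> bool" where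
  "opnorm_le al T C \<longleftrightarrow> (\<forall>g. L2w al g \<longrightarrow> L2w al (T g) \<and> L2wnorm al (T g) \<le> C * L2wnorm al g)"

end

theory Submission
  imports Defs "HOL-Probability.Probability"
begin

text \<open>
  Conjugation with \<open>I\<^sub>\<epsilon>\<close> and the weight turns every operator into a Fourier multiplier in
  \<open>\<zeta> = k + i \<alpha>\<close> (\<open>\<alpha>\<close> the weight of the limit problem), evaluated at \<open>\<epsilon> \<zeta>\<close>, or multiplication by
  a rescaled \<open>sech\<^sup>2\<close> profile. In these variables \<open>\<lambda> - Q\<^sub>+\<close> has real part at least of order \<open>\<epsilon>\<close>, so the \<open>+\<close> part is \<open>O(\<epsilon>)\<close>, while
  \<open>(2/\<epsilon>\<^sup>3)(\<lambda> - Q\<^sub>-)\<close> tends to \<open>\<Lambda> - i\<zeta> + (b - a)(i\<zeta>)\<^sup>3\<close>.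
  The error in this expansion is \<open>O(\<epsilon>\<^sup>2 |\<zeta>|\<^sup>5)\<close>, which is only useful at low frequency. Uniformity in
  \<open>\<Lambda>\<close> and \<open>k\<close> comes from a lower bound for the real part:
  \<open>Re (2/\<epsilon>\<^sup>3)(\<lambda> - Q\<^sub>-) \<ge> C (1 + k\<^sup>2) / (1 + \<epsilon>\<^sup>2 k\<^sup>2)\<close>. Where \<open>|\<epsilon> k| > 1\<close> it makes both resolvents
  \<open>O(\<epsilon>\<^sup>2)\<close>, which beats the factor \<open>1/\<epsilon>\<close> in the bound for \<open>\<partial> B\<^sup>-\<^sup>1\<close>.
\<close>

section \<open>Square-integrable functions\<close>

text \<open>\<open>multw\<close> is a \<open>SOME\<close> choice pinned down only by duality against
  test functions, so nothing can be computed with it until a Plancherel theory on L2 identifies it,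
  up to null sets, with multiplication of transforms. Gaussians carry that theory: they are test
  functions, their transforms are explicit, and pairing with them determines an L2 function almost
  everywhere. The obstacle to a pure symbol calculus is the wave profile, which commutes with no
  multiplier. On the Fourier side it enters only as an operator bounded by its supremum, together
  with a product rule that moves derivatives across it. The factor 3 of the limit arises as follows.
  With S^-1 and c replaced by 1 and r by -q, the operator R_q - R_r becomes (1/2) B^-1 (3 q' + 3 q
  \<partial>) = (3/2) B^-1 \<partial> q. Here q is eps^2 \<theta>0 to leading order, \<partial>
  contributes eps and the resolvent 2/eps^3. Since S^-1 stands to the right of the profile, it can
  be merged with the resolvent symbol m, and what must be small is 2 m + c S^-1 m - 3 m0. These
  symbol errors come out as O(sqrt eps).\<close>

lemma borel_measurable_cnj [measurable (raw)]:
  "f \<in> borel_measurable M \<Longrightarrow> (\<lambda>x. cnj (f x)) \<in> borel_measurable M"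
  by (rule borel_measurable_continuous_on[of cnj]) (auto intro: continuous_intros)

lemma L2_measurable [measurable_dest]: "L2 f \<Longrightarrow> f \<in> borel_measurable borel"
  by (simp add: L2_def)

lemma L2norm_nonneg [simp]: "0 \<le> L2norm f"
  by (simp add: L2norm_def)

lemma L2norm_sq: "(L2norm f)\<^sup>2 = (LINT x|lborel. (cmod (f x))\<^sup>2)"
  by (simp add: L2norm_def)

lemma L2_iff_nn:
  "L2 f \<longleftrightarrow> f \<in> borel_measurable borel \<and> (\<integral>\<^sup>+x. ennreal ((cmod (f x))\<^sup>2) \<partial>lborel) < \<infinity>"
  by (auto simp: L2_def integrable_iff_bounded)

lemma nn_integral_L2norm:
  "L2 f \<Longrightarrow> (\<integral>\<^sup>+x. ennreal ((cmod (f x))\<^sup>2) \<partial>lborel) = ennreal ((L2norm f)\<^sup>2)"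
  unfolding L2norm_sq by (rule nn_integral_eq_integral) (auto simp: L2_def)

lemma L2I_nn_le:
  assumes "f \<in> borel_measurable borel" "0 \<le> C"
    and "(\<integral>\<^sup>+x. ennreal ((cmod (f x))\<^sup>2) \<partial>lborel) \<le> ennreal (C\<^sup>2)"
  shows "L2 f" "L2norm f \<le> C"
proof -
  show f: "L2 f"
    using assms by (auto simp: L2_iff_nn intro: le_less_trans)
  show "L2norm f \<le> C"
    using assms nn_integral_L2norm[OF f] by (metis L2norm_nonneg ennreal_le_iff power2_le_imp_le zero_le_power2)
qed

lemma L2_mono:
  assumes "L2 f" "g \<in> borel_measurable borel" "0 \<le> C" "\<And>x. cmod (g x) \<le> C * cmod (f x)"
  shows "L2 g" "L2norm g \<le> C * L2norm f"
proof -
  have "(\<integral>\<^sup>+x. ennreal ((cmod (g x))\<^sup>2) \<partial>lborel) \<le> (\<integral>\<^sup>+x. ennreal (C\<^sup>2) * ennreal ((cmod (f x))\<^sup>2) \<partial>lborel)"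
  proof (rule nn_integral_mono)
    fix x
    have "(cmod (g x))\<^sup>2 \<le> (C * cmod (f x))\<^sup>2"
      by (intro power_mono assms) auto
    then show "ennreal ((cmod (g x))\<^sup>2) \<le> ennreal (C\<^sup>2) * ennreal ((cmod (f x))\<^sup>2)"
      by (simp add: power_mult_distrib ennreal_mult[symmetric] ennreal_leI)
  qed
  also have "\<dots> = ennreal (C\<^sup>2) * ennreal ((L2norm f)\<^sup>2)"
    using assms(1) by (subst nn_integral_cmult) (auto simp: nn_integral_L2norm L2_measurable)
  also have "\<dots> = ennreal ((C * L2norm f)\<^sup>2)"
    by (simp add: power_mult_distrib ennreal_mult[symmetric])
  finally have *: "(\<integral>\<^sup>+x. ennreal ((cmod (g x))\<^sup>2) \<partial>lborel) \<le> ennreal ((C * L2norm f)\<^sup>2)" .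
  show "L2 g" "L2norm g \<le> C * L2norm f"
    using L2I_nn_le[OF assms(2) _ *] assms(3) by auto
qed

lemma L2_bounded_mult:
  assumes "L2 f" "m \<in> borel_measurable borel" "\<And>x. cmod (m x) \<le> C"
  shows "L2 (\<lambda>x. m x * f x)" "L2norm (\<lambda>x. m x * f x) \<le> C * L2norm f"
proof -
  have C: "0 \<le> C" using assms(3)[of 0] norm_ge_zero order_trans by blast
  show "L2 (\<lambda>x. m x * f x)" "L2norm (\<lambda>x. m x * f x) \<le> C * L2norm f"
    using assms(2,3) L2_measurable[OF assms(1)]
    by (auto intro!: L2_mono[OF assms(1) _ C] mult_right_mono simp: norm_mult)
qed

lemma L2_cmult: "L2 f \<Longrightarrow> L2 (\<lambda>x. c * f x)"
  by (rule L2_bounded_mult(1)[where C="cmod c"]) auto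

lemma L2norm_cmult: "L2norm (\<lambda>x. c * f x) = cmod c * L2norm f"
  by (simp add: L2norm_def norm_mult power_mult_distrib real_sqrt_mult)

lemma L2_add:
  assumes f: "L2 f" and g: "L2 g"
  shows "L2 (\<lambda>x. f x + g x)"
proof -
  note [measurable] = L2_measurable[OF f] L2_measurable[OF g]
  have "integrable lborel (\<lambda>x. (cmod (f x + g x))\<^sup>2)"
  proof (rule Bochner_Integration.integrable_bound)
    show "integrable lborel (\<lambda>x. 2 * (cmod (f x))\<^sup>2 + 2 * (cmod (g x))\<^sup>2)"
      using assms by (auto simp: L2_def)
    have "(cmod (u + v))\<^sup>2 \<le> 2 * (cmod u)\<^sup>2 + 2 * (cmod v)\<^sup>2" for u v
    proof -
      have "(cmod (u + v))\<^sup>2 \<le> (cmod u + cmod v)\<^sup>2"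
        by (intro power_mono norm_triangle_ineq) auto
      also have "\<dots> \<le> 2 * (cmod u)\<^sup>2 + 2 * (cmod v)\<^sup>2"
        using zero_le_power2[of "cmod u - cmod v"] by (simp add: power2_eq_square algebra_simps)
      finally show ?thesis .
    qed
    then show "AE x in lborel. norm ((cmod (f x + g x))\<^sup>2) \<le> norm (2 * (cmod (f x))\<^sup>2 + 2 * (cmod (g x))\<^sup>2)"
      by auto
  qed auto
  then show ?thesis by (simp add: L2_def)
qed

lemma L2_minus: "L2 f \<Longrightarrow> L2 (\<lambda>x. - f x)"
  using L2_cmult[of f "-1"] by simp

lemma L2_diff: "L2 f \<Longrightarrow> L2 g \<Longrightarrow> L2 (\<lambda>x. f x - g x)"
  using L2_add[of f "\<lambda>x. - g x"] L2_minus[of g] by simp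

lemma L2_cong_AE:
  assumes "L2 f" "AE x in lborel. f x = g x" "g \<in> borel_measurable borel"
  shows "L2 g" "L2norm g = L2norm f"
proof -
  note [measurable] = L2_measurable[OF assms(1)] assms(3)
  have "AE x in lborel. (cmod (g x))\<^sup>2 = (cmod (f x))\<^sup>2" using assms(2) by auto
  then show "L2 g" "L2norm g = L2norm f"
    using assms(1) unfolding L2_def L2norm_def
    by (auto intro!: integral_cong_AE arg_cong[where f=sqrt] intro: integrable_cong_AE_imp)
qed

section \<open>The inner product of L2\<close>

definition ip :: "(real \<Rightarrow> complex) \<Rightarrow> (real \<Rightarrow> complex) \<Rightarrow> complex" where
  "ip f g = (LINT x|lborel. f x * cnj (g x))"

lemma integrable_ip:
  assumes f: "L2 f" and g: "L2 g"
  shows "integrable lborel (\<lambda>x. f x * cnj (g x))"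
proof (rule Bochner_Integration.integrable_bound)
  show "integrable lborel (\<lambda>x. (cmod (f x))\<^sup>2 + (cmod (g x))\<^sup>2)"
    using assms by (auto simp: L2_def)
  note [measurable] = L2_measurable[OF f] L2_measurable[OF g]
  show "(\<lambda>x. f x * cnj (g x)) \<in> borel_measurable lborel" by measurable
  have "u * v \<le> u\<^sup>2 + v\<^sup>2" if "0 \<le> u" "0 \<le> v" for u v :: real
    using zero_le_power2[of "u - v"] mult_nonneg_nonneg[OF that] by (simp add: power2_eq_square algebra_simps)
  then show "AE x in lborel. norm (f x * cnj (g x)) \<le> norm ((cmod (f x))\<^sup>2 + (cmod (g x))\<^sup>2)"
    by (auto simp: norm_mult)
qed

lemma ip_add_left: "\<lbrakk>L2 f; L2 g; L2 h\<rbrakk> \<Longrightarrow> ip (\<lambda>x. f x + g x) h = ip f h + ip g h"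
  unfolding ip_def by (subst Bochner_Integration.integral_add[symmetric])
    (auto intro: integrable_ip simp: algebra_simps)

lemma ip_cmult_left: "ip (\<lambda>x. c * f x) h = c * ip f h"
  unfolding ip_def by (simp add: mult.assoc)

lemma ip_diff_left: "\<lbrakk>L2 f; L2 g; L2 h\<rbrakk> \<Longrightarrow> ip (\<lambda>x. f x - g x) h = ip f h - ip g h"
  unfolding ip_def by (subst Bochner_Integration.integral_diff[symmetric])
    (auto intro: integrable_ip simp: algebra_simps)

lemma ip_cnj: "cnj (ip f g) = ip g f"
proof -
  have "cnj (ip f g) = (LINT x|lborel. cnj (f x * cnj (g x)))"
    unfolding ip_def by (rule Bochner_Integration.integral_cnj[symmetric])
  then show ?thesis by (simp add: ip_def mult.commute)
qed

lemma ip_self: "ip f f = of_real ((L2norm f)\<^sup>2)"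
  unfolding ip_def L2norm_sq by (simp add: complex_mult_cnj cmod_def flip: integral_complex_of_real)

lemma ip_add_right: "\<lbrakk>L2 f; L2 g; L2 h\<rbrakk> \<Longrightarrow> ip f (\<lambda>x. g x + h x) = ip f g + ip f h"
  by (metis ip_add_left ip_cnj complex_cnj_add)

lemma ip_cmult_right: "ip f (\<lambda>x. c * g x) = cnj c * ip f g"
  by (metis ip_cmult_left ip_cnj complex_cnj_mult)

lemma Cauchy_Schwarz_L2:
  assumes f: "L2 f" and g: "L2 g"
  shows "cmod (ip f g) \<le> L2norm f * L2norm g"
proof -
  note [measurable] = L2_measurable[OF f] L2_measurable[OF g]
  have 1: "integrable lborel (\<lambda>x. cmod (f x) * cmod (g x))"
    using integrable_norm[OF integrable_ip[OF f g]] by (simp add: norm_mult)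
  have "(ennreal (LINT x|lborel. cmod (f x) * cmod (g x)))\<^sup>2
        = (\<integral>\<^sup>+x. ennreal (cmod (f x)) * ennreal (cmod (g x)) \<partial>lborel)\<^sup>2"
    using nn_integral_eq_integral[OF 1] by (simp add: ennreal_mult)
  also have "\<dots> \<le> (\<integral>\<^sup>+x. (ennreal (cmod (f x)))\<^sup>2 \<partial>lborel) * (\<integral>\<^sup>+x. (ennreal (cmod (g x)))\<^sup>2 \<partial>lborel)"
    by (rule Cauchy_Schwarz_nn_integral) auto
  also have "\<dots> = ennreal ((L2norm f * L2norm g)\<^sup>2)"
    using nn_integral_L2norm[OF f] nn_integral_L2norm[OF g]
    by (simp add: ennreal_power power_mult_distrib ennreal_mult)
  finally have "(LINT x|lborel. cmod (f x) * cmod (g x))\<^sup>2 \<le> (L2norm f * L2norm g)\<^sup>2"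
    by (simp add: ennreal_power integral_nonneg_AE)
  then have "(LINT x|lborel. cmod (f x) * cmod (g x)) \<le> L2norm f * L2norm g"
    by (rule power2_le_imp_le) auto
  moreover have "cmod (ip f g) \<le> (LINT x|lborel. cmod (f x) * cmod (g x))"
    unfolding ip_def using integral_norm_bound[of lborel "\<lambda>x. f x * cnj (g x)"] by (simp add: norm_mult)
  ultimately show ?thesis by linarith
qed

lemma L2norm_add_sq:
  assumes "L2 f" "L2 g"
  shows "(L2norm (\<lambda>x. f x + g x))\<^sup>2 = (L2norm f)\<^sup>2 + (L2norm g)\<^sup>2 + 2 * Re (ip f g)"
proof -
  have "complex_of_real ((L2norm (\<lambda>x. f x + g x))\<^sup>2) = ip f f + ip f g + (ip g f + ip g g)"
    unfolding ip_self[symmetric] using assms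
    by (simp add: ip_add_left ip_add_right L2_add)
  also have "\<dots> = of_real ((L2norm f)\<^sup>2) + of_real ((L2norm g)\<^sup>2) + (ip f g + cnj (ip f g))"
    unfolding ip_cnj ip_self by simp
  finally show ?thesis by (simp add: complex_eq_iff)
qed

lemma L2norm_add_le:
  assumes f: "L2 f" and g: "L2 g"
  shows "L2norm (\<lambda>x. f x + g x) \<le> L2norm f + L2norm g"
proof -
  have "(L2norm (\<lambda>x. f x + g x))\<^sup>2 \<le> (L2norm f)\<^sup>2 + (L2norm g)\<^sup>2 + 2 * (L2norm f * L2norm g)"
    using Cauchy_Schwarz_L2[OF f g] complex_Re_le_cmod[of "ip f g"] unfolding L2norm_add_sq[OF f g] by linarith
  also have "\<dots> = (L2norm f + L2norm g)\<^sup>2" by (simp add: power2_eq_square algebra_simps)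
  finally show ?thesis by (rule power2_le_imp_le) simp
qed

lemma L2norm_diff_le:
  "L2 f \<Longrightarrow> L2 g \<Longrightarrow> L2norm (\<lambda>x. f x - g x) \<le> L2norm f + L2norm g"
  using L2norm_add_le[of f "\<lambda>x. - g x"] L2_minus[of g] L2norm_cmult[of "-1" g] by simp

text \<open>Along a subsequence with increments \<open>d\<^sub>k\<close> of norm at most \<open>2\<^sup>-\<^sup>k\<close> the function \<open>\<Sum>k. 2\<^sup>k d\<^sub>k\<^sup>2\<close> is
  integrable, hence finite almost everywhere, which makes \<open>\<Sum>k. d\<^sub>k\<close> converge there.\<close>
lemma L2_complete:
  assumes L: "\<And>n. L2 (f n)"
    and C: "\<And>e. e > 0 \<Longrightarrow> \<exists>N. \<forall>m\<ge>N. \<forall>n\<ge>N. L2norm (\<lambda>x. f m x - f n x) \<le> e"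
  shows "\<exists>g. L2 g \<and> (\<lambda>n. L2norm (\<lambda>x. f n x - g x)) \<longlonglongrightarrow> 0"
proof -
  note [measurable] = L2_measurable[OF L]
  have "\<forall>k. \<exists>N. \<forall>m\<ge>N. \<forall>n\<ge>N. L2norm (\<lambda>x. f m x - f n x) \<le> (1/2)^k"
    using C by simp
  then obtain N where N: "\<And>k m n. m \<ge> N k \<Longrightarrow> n \<ge> N k \<Longrightarrow> L2norm (\<lambda>x. f m x - f n x) \<le> (1/2)^k"
    by metis
  \<comment> \<open>The partial sum dominates \<open>N k\<close> at index \<open>k\<close> and still
    at index \<open>k + 1\<close>, so both terms of the increment \<open>d k\<close> lie beyond the
    threshold; the summand \<open>k\<close> sends the indices to infinity.\<close>
  define r where "r k = (\<Sum>i\<le>k. N i) + k" for k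
  have rN: "r k \<ge> N k" and rk: "r k \<ge> k" for k
    using member_le_sum[of k "{..k}" N] by (simp_all add: r_def)
  have rN': "r (Suc k) \<ge> N k" for k
    using rN[of k] by (simp add: r_def)
  define d where "d k x = cmod (f (r (Suc k)) x - f (r k) x)" for k x
  have d[measurable]: "d k \<in> borel_measurable borel" for k unfolding d_def by measurable
  have "(\<integral>\<^sup>+x. (\<Sum>k. ennreal (2^k * (d k x)\<^sup>2)) \<partial>lborel) = (\<Sum>k. \<integral>\<^sup>+x. ennreal (2^k * (d k x)\<^sup>2) \<partial>lborel)"
    by (rule nn_integral_suminf) measurable
  also have "\<dots> \<le> (\<Sum>k. ennreal ((1/2)^k))"
  proof (rule suminf_le)
    fix k
    have "(\<integral>\<^sup>+x. ennreal (2^k * (d k x)\<^sup>2) \<partial>lborel) = ennreal (2^k) * ennreal ((L2norm (\<lambda>x. f (r (Suc k)) x - f (r k) x))\<^sup>2)"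
      unfolding nn_integral_L2norm[OF L2_diff[OF L L], symmetric] d_def
      by (subst nn_integral_cmult[symmetric]) (auto simp: ennreal_mult)
    also have "\<dots> \<le> ennreal (2^k) * ennreal (((1/2)^k)\<^sup>2)"
      using N[OF rN' rN] by (intro mult_left_mono ennreal_leI power_mono) auto
    also have "\<dots> = ennreal ((1/2)^k)"
    proof -
      have "2^k * ((1/2)^k)\<^sup>2 = ((1/2)^k :: real)"
        by (simp add: power2_eq_square power_divide)
      then show ?thesis by (simp only: ennreal_mult[symmetric] zero_le_power2 zero_le_power zero_le_numeral)
    qed
    finally show "(\<integral>\<^sup>+x. ennreal (2^k * (d k x)\<^sup>2) \<partial>lborel) \<le> ennreal ((1/2)^k)" .
  qed auto
  also have "\<dots> < \<infinity>"
    by (subst suminf_ennreal2) (auto simp: summable_geometric)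
  finally have "AE x in lborel. (\<Sum>k. ennreal (2^k * (d k x)\<^sup>2)) \<noteq> \<infinity>"
    by (intro nn_integral_noteq_infinite) auto
  then have conv: "AE x in lborel. convergent (\<lambda>k. f (r k) x)"
  proof eventually_elim
    case (elim x)
    have s: "summable (\<lambda>k. 2^k * (d k x)\<^sup>2)"
      using elim by (intro summable_suminf_not_top) auto
    have "summable (\<lambda>k. d k x)"
    proof (rule summable_comparison_test')
      show "summable (\<lambda>k. 2^k * (d k x)\<^sup>2 + (1/2)^k)"
        using s by (intro summable_add) (auto simp: summable_geometric)
      fix k :: nat
      define q :: real where "q = (1/2)^k"
      have q: "q > 0" "2^k = 1/q" by (auto simp: q_def field_simps power_divide)
      have "0 \<le> (d k x - q)\<^sup>2 + (d k x)\<^sup>2 + q\<^sup>2" by auto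
      then have "d k x * q \<le> (d k x)\<^sup>2 + q * q"
        by (simp add: power2_eq_square algebra_simps)
      then have "d k x \<le> (d k x)\<^sup>2 / q + q" using q by (simp add: field_simps)
      then show "norm (d k x) \<le> 2^k * (d k x)\<^sup>2 + (1/2)^k"
        using q unfolding q_def[symmetric] by (simp add: d_def)
    qed
    then have "summable (\<lambda>k. f (r (Suc k)) x - f (r k) x)"
      unfolding d_def by (rule summable_norm_cancel)
    then have "convergent (\<lambda>n. \<Sum>k<n. f (r (Suc k)) x - f (r k) x)"
      by (simp add: summable_iff_convergent)
    then have "convergent (\<lambda>n. f (r n) x - f (r 0) x)"
      by (simp add: sum_lessThan_telescope[of "\<lambda>n. f (r n) x"] del: sum_subtractf)
    then show ?case by (simp add: convergent_diff_const_right_iff)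
  qed
  define g where "g x = lim (\<lambda>k. f (r k) x)" for x
  have g[measurable]: "g \<in> borel_measurable borel"
    unfolding g_def by measurable
  have lim: "AE x in lborel. (\<lambda>k. f (r k) x) \<longlonglongrightarrow> g x"
    using conv unfolding g_def by eventually_elim (simp add: convergent_LIMSEQ_iff)
  \<comment> \<open>Fatou's lemma along the subsequence carries the Cauchy estimate over to the
    limit. It also shows that \<open>f m - g\<close> is square integrable, which is how
    \<open>g\<close> itself gets into L2.\<close>
  have bnd: "L2 (\<lambda>x. f m x - g x) \<and> L2norm (\<lambda>x. f m x - g x) \<le> e"
    if "e > 0" and K: "\<forall>m\<ge>K. \<forall>n\<ge>K. L2norm (\<lambda>x. f m x - f n x) \<le> e" and "m \<ge> K" for e K m
  proof -
    have "(\<integral>\<^sup>+x. ennreal ((cmod (f m x - g x))\<^sup>2) \<partial>lborel)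
        = (\<integral>\<^sup>+x. liminf (\<lambda>k. ennreal ((cmod (f m x - f (r k) x))\<^sup>2)) \<partial>lborel)"
    proof (rule nn_integral_cong_AE)
      show "AE x in lborel. ennreal ((cmod (f m x - g x))\<^sup>2) = liminf (\<lambda>k. ennreal ((cmod (f m x - f (r k) x))\<^sup>2))"
        using lim
      proof eventually_elim
        case (elim x)
        have "(\<lambda>k. ennreal ((cmod (f m x - f (r k) x))\<^sup>2)) \<longlonglongrightarrow> ennreal ((cmod (f m x - g x))\<^sup>2)"
          by (intro tendsto_intros elim)
        from lim_imp_Liminf[OF _ this] show ?case by simp
      qed
    qed
    also have "\<dots> \<le> liminf (\<lambda>k. (\<integral>\<^sup>+x. ennreal ((cmod (f m x - f (r k) x))\<^sup>2) \<partial>lborel))"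
      by (rule nn_integral_liminf) measurable
    also have "\<dots> \<le> liminf (\<lambda>k. ennreal (e\<^sup>2))"
    proof (rule Liminf_mono)
      show "\<forall>\<^sub>F k in sequentially. (\<integral>\<^sup>+x. ennreal ((cmod (f m x - f (r k) x))\<^sup>2) \<partial>lborel) \<le> ennreal (e\<^sup>2)"
        using eventually_ge_at_top[of K]
      proof eventually_elim
        case (elim k)
        then show ?case
          unfolding nn_integral_L2norm[OF L2_diff[OF L L]]
          using rk[of k] K[rule_format, of m "r k"] \<open>m \<ge> K\<close> by (intro ennreal_leI power_mono) auto
      qed
    qed
    also have "\<dots> = ennreal (e\<^sup>2)" by (simp add: Liminf_const)
    finally have *: "(\<integral>\<^sup>+x. ennreal ((cmod (f m x - g x))\<^sup>2) \<partial>lborel) \<le> ennreal (e\<^sup>2)" .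
    have "(\<lambda>x. f m x - g x) \<in> borel_measurable borel" by measurable
    from L2I_nn_le[OF this _ *] \<open>e > 0\<close> show ?thesis by simp
  qed
  obtain K1 where K1: "\<forall>m\<ge>K1. \<forall>n\<ge>K1. L2norm (\<lambda>x. f m x - f n x) \<le> 1" using C[of 1] by auto
  have "L2 (\<lambda>x. f K1 x - (f K1 x - g x))"
    by (rule L2_diff[OF L bnd[OF _ K1 order_refl, THEN conjunct1]]) simp
  then have "L2 g" by simp
  moreover have "(\<lambda>n. L2norm (\<lambda>x. f n x - g x)) \<longlonglongrightarrow> 0"
  proof (rule LIMSEQ_I)
    fix e :: real assume "e > 0"
    then have "e / 2 > 0" by simp
    from C[OF this] obtain K where K: "\<forall>m\<ge>K. \<forall>n\<ge>K. L2norm (\<lambda>x. f m x - f n x) \<le> e/2" by blast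
    have "norm (L2norm (\<lambda>x. f n x - g x) - 0) < e" if "n \<ge> K" for n
      using bnd[OF \<open>e / 2 > 0\<close> K that] \<open>e > 0\<close> by simp
    then have "\<forall>n\<ge>K. norm (L2norm (\<lambda>x. f n x - g x) - 0) < e" by blast
    then show "\<exists>K. \<forall>n\<ge>K. norm (L2norm (\<lambda>x. f n x - g x) - 0) < e" by blast
  qed
  ultimately show ?thesis by blast
qed

section \<open>The Fourier transform on integrable functions and Bessel's inequality\<close>

lemma inv_fourier_eq: "inv_fourier K x = fourier K (- x) / (2 * pi)"
  by (simp add: inv_fourier_def fourier_def mult.assoc mult.left_commute mult.commute)

lemma fourier_measurable [measurable]:
  assumes [measurable]: "f \<in> borel_measurable borel"
  shows "fourier f \<in> borel_measurable borel"
  unfolding fourier_def by measurable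

lemma integrable_fourier_kernel:
  assumes "integrable lborel f"
  shows "integrable lborel (\<lambda>x. f x * exp (- (\<i> * complex_of_real k * complex_of_real x)))"
proof (rule Bochner_Integration.integrable_bound[OF assms])
  note [measurable] = borel_measurable_integrable[OF assms]
  show "(\<lambda>x. f x * exp (- (\<i> * complex_of_real k * complex_of_real x))) \<in> borel_measurable lborel"
    by measurable
qed (auto simp: norm_mult)

lemma norm_fourier_le:
  assumes "integrable lborel f"
  shows "cmod (fourier f k) \<le> (LINT x|lborel. cmod (f x))"
proof -
  have "cmod (fourier f k) \<le> (LINT x|lborel. cmod (f x * exp (- (\<i> * complex_of_real k * complex_of_real x))))"
    unfolding fourier_def by (rule integral_norm_bound)
  then show ?thesis by (simp add: norm_mult)
qed

lemma inv_fourier_measurable [measurable]: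
  assumes [measurable]: "f \<in> borel_measurable borel"
  shows "inv_fourier f \<in> borel_measurable borel"
  unfolding inv_fourier_eq[abs_def] by measurable

lemma fourier_diff:
  "integrable lborel f \<Longrightarrow> integrable lborel g \<Longrightarrow> fourier (\<lambda>x. f x - g x) k = fourier f k - fourier g k"
  unfolding fourier_def
  by (subst Bochner_Integration.integral_diff[symmetric])
    (auto intro: integrable_fourier_kernel simp: left_diff_distrib)

lemma fourier_cnj: "fourier (\<lambda>x. cnj (f x)) k = cnj (fourier f (- k))"
  unfolding fourier_def by (simp add: Bochner_Integration.integral_cnj[symmetric] exp_cnj del: Bochner_Integration.integral_cnj)

text \<open>Fubini for the absolutely integrable kernel \<open>f x * cnj (K k)\<close> times a
  phase. It is the source of the Parseval identities below, where \<open>K\<close> is mostly a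
  Gaussian packet or a damped transform.\<close>

lemma fourier_mult_formula:
  assumes f: "integrable lborel f" and K: "integrable lborel K"
  shows "ip (fourier f) K = 2 * pi * ip f (inv_fourier K)"
proof -
  note [measurable] = borel_measurable_integrable[OF f] borel_measurable_integrable[OF K]
  let ?H = "\<lambda>x k. f x * cnj (K k) * exp (- (\<i> * complex_of_real k * complex_of_real x))"
  have int: "integrable (lborel \<Otimes>\<^sub>M lborel) (\<lambda>(x, k). ?H x k)"
  proof (rule lborel_pair.Fubini_integrable)
    show "(\<lambda>(x, k). ?H x k) \<in> borel_measurable (lborel \<Otimes>\<^sub>M lborel)"
      by measurable
    show "integrable lborel (\<lambda>x. LINT y|lborel. norm (case (x, y) of (x, k) \<Rightarrow> ?H x k))"
      using f K by (simp add: norm_mult)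
    show "AE x in lborel. integrable lborel (\<lambda>y. case (x, y) of (x, k) \<Rightarrow> ?H x k)"
    proof (rule AE_I2)
      fix x :: real
      have "integrable lborel (\<lambda>k. f x * (cnj (K k) * exp (- (\<i> * complex_of_real x * complex_of_real k))))"
        using K by (intro integrable_mult_right integrable_fourier_kernel) auto
      then show "integrable lborel (\<lambda>y. case (x, y) of (x, k) \<Rightarrow> ?H x k)"
        by (simp add: mult_ac)
    qed
  qed
  have "ip (fourier f) K = (LINT k|lborel. LINT x|lborel. ?H x k)"
    unfolding ip_def fourier_def by (simp add: mult.assoc mult.left_commute mult.commute
        flip: integral_mult_left_zero integral_mult_right_zero)
  also have "\<dots> = (LINT x|lborel. LINT k|lborel. ?H x k)"
    by (rule lborel_pair.Fubini_integral[OF int])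
  also have "\<dots> = (LINT x|lborel. f x * (2 * pi * cnj (inv_fourier K x)))"
  proof (rule Bochner_Integration.integral_cong[OF refl])
    fix x :: real
    have "2 * pi * cnj (inv_fourier K x) = (LINT k|lborel. cnj (K k) * exp (- (\<i> * complex_of_real k * complex_of_real x)))"
      by (simp add: inv_fourier_def exp_cnj del: Bochner_Integration.integral_cnj
        flip: Bochner_Integration.integral_cnj)
    then show "(LINT k|lborel. ?H x k) = f x * (2 * pi * cnj (inv_fourier K x))"
      by (simp add: mult.assoc flip: integral_mult_right_zero)
  qed
  also have "\<dots> = 2 * pi * ip f (inv_fourier K)"
    unfolding ip_def by (simp add: mult.assoc mult.left_commute flip: integral_mult_right_zero)
  finally show ?thesis .
qed

section \<open>Gaussian wave packets and their transforms\<close>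

lemma integral_iexp_gauss:
  "(LINT x|lborel. iexp (t * x) * complex_of_real (exp (- x\<^sup>2 / 2))) = complex_of_real (sqrt (2 * pi) * exp (- t\<^sup>2 / 2))"
proof -
  have "complex_of_real (exp (- (t\<^sup>2) / 2)) = (LINT x|lborel. std_normal_density x *\<^sub>R iexp (t * x))"
    unfolding char_std_normal_distribution[THEN fun_cong, symmetric] char_def
    by (rule integral_density) auto
  also have "\<dots> = (LINT x|lborel. complex_of_real (1 / sqrt (2 * pi)) * (iexp (t * x) * complex_of_real (exp (- x\<^sup>2 / 2))))"
    by (intro Bochner_Integration.integral_cong) (auto simp: std_normal_density_def scaleR_conv_of_real)
  also have "\<dots> = complex_of_real (1 / sqrt (2 * pi)) * (LINT x|lborel. iexp (t * x) * complex_of_real (exp (- x\<^sup>2 / 2)))"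
    by simp
  finally show ?thesis by (simp add: field_simps)
qed

definition gam :: "real \<Rightarrow> real \<Rightarrow> real \<Rightarrow> complex" where
  "gam s y x = iexp (s * x) * complex_of_real (exp (- (x - y)\<^sup>2 / 2))"

text \<open>The transform of \<open>gam s y\<close>: again a packet, with frequency
  \<open>- y\<close> and centre \<open>s\<close>, so the family is closed under the transform up to
  constants of modulus sqrt (2 pi).\<close>

definition gamh :: "real \<Rightarrow> real \<Rightarrow> real \<Rightarrow> complex" where
  "gamh s y k = complex_of_real (sqrt (2 * pi)) * iexp (s * y) * gam (- y) s k"

lemma gam_measurable [measurable]: "gam s y \<in> borel_measurable borel"
  unfolding gam_def by measurable

lemma gamh_measurable [measurable]: "gamh s y \<in> borel_measurable borel"
  unfolding gamh_def by measurable

lemma norm_gam: "cmod (gam s y x) = exp (- (x - y)\<^sup>2 / 2)"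
  by (simp add: gam_def norm_mult)

lemma norm_gam_density: "cmod (gam s y x) = sqrt (2 * pi) * normal_density y 1 x"
  by (simp add: norm_gam normal_density_def)

lemma integrable_gam: "integrable lborel (gam s y)"
proof (rule Bochner_Integration.integrable_bound)
  show "integrable lborel (\<lambda>x. sqrt (2 * pi) * normal_density y 1 x)" by auto
qed (auto simp: norm_gam_density)

lemma L2_gam: "L2 (gam s y)"
  unfolding L2_def
proof
  show "integrable lborel (\<lambda>x. (cmod (gam s y x))\<^sup>2)"
    by (rule Bochner_Integration.integrable_bound[OF integrable_gam[of s y]])
      (auto simp: norm_gam power_le_one power2_eq_square mult_left_le)
qed auto

lemma integrable_gamh: "integrable lborel (gamh s y)"
  unfolding gamh_def by (intro integrable_mult_right integrable_gam)

lemma L2_gamh: "L2 (gamh s y)"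
  unfolding gamh_def by (intro L2_cmult L2_gam)

lemma fourier_gam: "fourier (gam s y) = gamh s y"
proof
  fix k
  have "fourier (gam s y) k = (LINT x|lborel. iexp ((s - k) * x) * complex_of_real (exp (- (x - y)\<^sup>2 / 2)))"
    unfolding fourier_def gam_def
    by (intro Bochner_Integration.integral_cong)
      (auto simp: algebra_simps simp flip: exp_add exp_minus)
  also have "\<dots> = (LINT x|lborel. iexp ((s - k) * (y + 1 * x)) * complex_of_real (exp (- ((y + 1 * x) - y)\<^sup>2 / 2)))"
    by (subst lborel_integral_real_affine[of 1 _ y]) auto
  also have "\<dots> = (LINT x|lborel. iexp ((s - k) * y) * (iexp ((s - k) * x) * complex_of_real (exp (- x\<^sup>2 / 2))))"
    by (intro Bochner_Integration.integral_cong)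
      (auto simp: ring_distribs simp flip: exp_add)
  also have "\<dots> = iexp ((s - k) * y) * complex_of_real (sqrt (2 * pi) * exp (- (s - k)\<^sup>2 / 2))"
    using integral_iexp_gauss[of "s - k"] by simp
  also have "\<dots> = gamh s y k"
    by (simp add: gamh_def gam_def algebra_simps power2_commute flip: exp_add)
  finally show "fourier (gam s y) k = gamh s y k" .
qed

lemma inv_fourier_gamh: "inv_fourier (gamh s y) = gam s y"
proof
  fix x
  have pi2: "complex_of_real (sqrt (2 * pi)) * complex_of_real (sqrt (2 * pi)) = 2 * pi"
    by (simp flip: of_real_mult)
  have "inv_fourier (gamh s y) x = (complex_of_real (sqrt (2 * pi)) * iexp (s * y)) * fourier (gam (- y) s) (- x) / (2 * pi)"
    unfolding inv_fourier_eq fourier_def gamh_def by (simp add: mult.assoc)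
  also have "\<dots> = (complex_of_real (sqrt (2 * pi)) * complex_of_real (sqrt (2 * pi))) * (iexp (s * y) * iexp (- y * s)) * gam (- s) (- y) (- x) / (2 * pi)"
    unfolding fourier_gam by (simp add: gamh_def)
  also have "\<dots> = gam (- s) (- y) (- x)"
    unfolding pi2 by (simp flip: exp_add)
  also have "\<dots> = gam s y x"
    by (simp add: gam_def power2_commute)
  finally show "inv_fourier (gamh s y) x = gam s y x" .
qed

lemma fourier_gauss_scaled:
  assumes "d > 0"
  shows "(LINT k|lborel. iexp (t * k) * complex_of_real (exp (- (d * k)\<^sup>2 / 2)))
    = complex_of_real (2 * pi * normal_density 0 d t)"
proof -
  have "(LINT k|lborel. iexp (t * k) * complex_of_real (exp (- (d * k)\<^sup>2 / 2)))
    = \<bar>1/d\<bar> *\<^sub>R (LINT k|lborel. iexp (t * (0 + (1/d) * k)) * complex_of_real (exp (- (d * (0 + (1/d) * k))\<^sup>2 / 2)))"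
    using assms by (intro lborel_integral_real_affine) auto
  also have "\<dots> = \<bar>1/d\<bar> *\<^sub>R (LINT k|lborel. iexp ((t / d) * k) * complex_of_real (exp (- k\<^sup>2 / 2)))"
    using assms by (intro arg_cong[where f="\<lambda>x. _ *\<^sub>R x"] Bochner_Integration.integral_cong) auto
  also have "\<dots> = complex_of_real (1 / d * (sqrt (2 * pi) * exp (- (t / d)\<^sup>2 / 2)))"
    unfolding integral_iexp_gauss using assms by (simp add: scaleR_conv_of_real)
  also have "1 / d * (sqrt (2 * pi) * exp (- (t / d)\<^sup>2 / 2)) = 2 * pi * normal_density 0 d t"
  proof -
    have "2 * pi = sqrt (2 * pi) * sqrt (2 * pi)" by simp
    then show ?thesis using assms
      by (simp add: normal_density_def real_sqrt_mult power_divide field_simps)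
  qed
  finally show ?thesis .
qed

lemma nn_integral_normal_density:
  assumes "d > 0"
  shows "(\<integral>\<^sup>+x. ennreal (normal_density m d x) \<partial>lborel) = 1"
  using assms by (subst nn_integral_eq_integral) auto

text \<open>With a Gaussian weight the left-hand side is a double integral of \<open>f(x) cnj f(y)\<close> against a normal
  density in \<open>x - y\<close>, and \<open>2 |f(x) f(y)| \<le> |f(x)|\<^sup>2 + |f(y)|\<^sup>2\<close> suffices; equality in the limit would need
  more, but is recovered later from the two Bessel inequalities.\<close>
lemma Bessel_regularized:
  assumes f1: "integrable lborel f" and f2: "L2 f" and d: "d > 0"
  shows "(\<integral>\<^sup>+k. ennreal ((cmod (fourier f k))\<^sup>2 * exp (- (d * k)\<^sup>2 / 2)) \<partial>lborel) \<le> ennreal (2 * pi * (L2norm f)\<^sup>2)"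
proof -
  note [measurable] = borel_measurable_integrable[OF f1]
  define w where "w k = exp (- (d * k)\<^sup>2 / 2)" for k :: real
  have [measurable]: "w \<in> borel_measurable borel" unfolding w_def by measurable
  have wint: "integrable lborel w"
  proof (rule Bochner_Integration.integrable_bound)
    show "integrable lborel (\<lambda>k. sqrt (2 * pi * (1/d)\<^sup>2) * normal_density 0 (1/d) k)" using d by auto
    show "AE k in lborel. norm (w k) \<le> norm (sqrt (2 * pi * (1/d)\<^sup>2) * normal_density 0 (1/d) k)"
      using d by (simp add: w_def normal_density_def field_simps power_mult_distrib)
  qed auto
  have wpos: "w k > 0" for k by (simp add: w_def)
  define B where "B = (LINT x|lborel. cmod (f x))"
  have B: "cmod (fourier f k) \<le> B" for k unfolding B_def by (rule norm_fourier_le[OF f1])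
  have B0: "0 \<le> B" using B[of 0] norm_ge_zero order_trans by blast
  define F where "F k = fourier f k * complex_of_real (w k)" for k
  have [measurable]: "F \<in> borel_measurable borel" unfolding F_def by measurable
  have Fint: "integrable lborel F"
  proof (rule Bochner_Integration.integrable_bound)
    show "integrable lborel (\<lambda>k. B * w k)" using wint by auto
    show "AE k in lborel. norm (F k) \<le> norm (B * w k)"
      using B wpos B0 by (auto simp: F_def norm_mult abs_mult less_imp_le intro!: mult_right_mono)
  qed measurable
  have sqint: "integrable lborel (\<lambda>k. (cmod (fourier f k))\<^sup>2 * w k)"
  proof (rule Bochner_Integration.integrable_bound)
    show "integrable lborel (\<lambda>k. B\<^sup>2 * w k)" using wint by auto
    show "AE k in lborel. norm ((cmod (fourier f k))\<^sup>2 * w k) \<le> norm (B\<^sup>2 * w k)"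
      using B wpos B0 by (auto simp: less_imp_le intro!: mult_right_mono power_mono)
  qed measurable
  have ipF: "ip (fourier f) F = complex_of_real (LINT k|lborel. (cmod (fourier f k))\<^sup>2 * w k)"
    unfolding ip_def integral_complex_of_real[symmetric]
    by (intro Bochner_Integration.integral_cong)
       (auto simp: F_def complex_norm_square simp del: of_real_power)
  \<comment> \<open>Undoing the transform of the damped \<open>F\<close> gives \<open>f\<close>
    convolved with 2 pi times a normal density of deviation \<open>d\<close>. That kernel has mass 2
    pi in either variable, whence the constant of the lemma.\<close>
  define g where "g x = 2 * pi * inv_fourier F x" for x
  have [measurable]: "g \<in> borel_measurable borel" unfolding g_def by measurable
  have g: "g x = (LINT y|lborel. f y * complex_of_real (2 * pi * normal_density 0 d (x - y)))" for x
  proof -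
    define K where "K k = complex_of_real (w k) * iexp (- x * k)" for k
    have Kint: "integrable lborel K"
    proof (rule Bochner_Integration.integrable_bound)
      show "integrable lborel w" by (rule wint)
      show "K \<in> borel_measurable lborel" unfolding K_def by measurable
    qed (auto simp: K_def norm_mult)
    have "g x = ip (fourier f) K"
      by (simp add: g_def inv_fourier_def ip_def F_def K_def exp_cnj mult_ac)
    also have "\<dots> = 2 * pi * ip f (inv_fourier K)"
      by (rule fourier_mult_formula[OF f1 Kint])
    also have "\<dots> = (LINT y|lborel. f y * (2 * pi * cnj (inv_fourier K y)))"
      unfolding ip_def by (simp add: mult.assoc mult.left_commute flip: integral_mult_right_zero)
    also have "\<dots> = (LINT y|lborel. f y * complex_of_real (2 * pi * normal_density 0 d (x - y)))"
    proof (intro Bochner_Integration.integral_cong refl arg_cong2[where f="(*)"])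
      fix y :: real
      have "2 * pi * inv_fourier K y = (LINT k|lborel. iexp ((y - x) * k) * complex_of_real (exp (- (d * k)\<^sup>2 / 2)))"
        unfolding inv_fourier_def K_def w_def
        by (simp, intro Bochner_Integration.integral_cong refl)
          (simp add: algebra_simps mult_exp_exp)
      also have "\<dots> = complex_of_real (2 * pi * normal_density 0 d (y - x))"
        by (rule fourier_gauss_scaled[OF d])
      also have "normal_density 0 d (y - x) = normal_density 0 d (x - y)"
        by (simp add: normal_density_def power2_commute)
      finally have "2 * pi * inv_fourier K y = complex_of_real (2 * pi * normal_density 0 d (x - y))" .
      from arg_cong[OF this, of cnj]
      show "2 * pi * cnj (inv_fourier K y) = complex_of_real (2 * pi * normal_density 0 d (x - y))"
        by simp
    qed
    finally show ?thesis .
  qed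
  have key: "ip (fourier f) F = ip f g"
    unfolding fourier_mult_formula[OF f1 Fint]
    unfolding ip_def g_def by (simp add: mult.assoc mult.left_commute flip: integral_mult_right_zero)
  let ?N = "\<lambda>x y. normal_density 0 d (x - y)"
  have Npos: "0 \<le> ?N x y" for x y by simp
  have Nx: "(\<integral>\<^sup>+y. ennreal (?N x y) \<partial>lborel) = 1" for x
  proof -
    have "?N x y = normal_density x d y" for y by (simp add: normal_density_def power2_commute)
    then show ?thesis using nn_integral_normal_density[OF d] by simp
  qed
  have Ny: "(\<integral>\<^sup>+x. ennreal (?N x y) \<partial>lborel) = 1" for y
  proof -
    have "?N x y = normal_density y d x" for x by (simp add: normal_density_def)
    then show ?thesis using nn_integral_normal_density[OF d] by simp
  qed
  have [measurable]: "(\<lambda>x. normal_density 0 d x) \<in> borel_measurable borel" by simp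
  have gb: "ennreal (cmod (g x)) \<le> (\<integral>\<^sup>+y. ennreal (2 * pi) * (ennreal (cmod (f y)) * ennreal (?N x y)) \<partial>lborel)" for x
  proof -
    have "integrable lborel (\<lambda>y. f y * complex_of_real (2 * pi * ?N x y))"
    proof (rule Bochner_Integration.integrable_bound)
      show "integrable lborel (\<lambda>y. f y * complex_of_real (2 * pi * (1 / sqrt (2 * pi * d\<^sup>2))))" using f1 by auto
      show "AE y in lborel. norm (f y * complex_of_real (2 * pi * ?N x y)) \<le> norm (f y * complex_of_real (2 * pi * (1 / sqrt (2 * pi * d\<^sup>2))))"
      proof (rule AE_I2)
        fix y
        have nd: "?N x y \<le> 1 / sqrt (2 * pi * d\<^sup>2)"
          by (simp add: normal_density_def divide_right_mono)
        show "norm (f y * complex_of_real (2 * pi * ?N x y)) \<le> norm (f y * complex_of_real (2 * pi * (1 / sqrt (2 * pi * d\<^sup>2))))"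
          unfolding norm_mult[of "f y"] norm_of_real abs_mult
          using nd by (intro mult_left_mono) auto
      qed
    qed measurable
    from integral_norm_bound_ennreal[OF this]
    show ?thesis unfolding g by (simp add: norm_mult ennreal_mult[symmetric] mult_ac)
  qed
  have "ennreal (cmod (ip f g)) \<le> (\<integral>\<^sup>+x. ennreal (cmod (f x)) * ennreal (cmod (g x)) \<partial>lborel)"
  proof (cases "integrable lborel (\<lambda>x. f x * cnj (g x))")
    case True
    from integral_norm_bound_ennreal[OF this] show ?thesis
      by (simp add: ip_def norm_mult ennreal_mult)
  next
    case False
    then show ?thesis by (simp add: ip_def not_integrable_integral_eq)
  qed
  also have "\<dots> \<le> (\<integral>\<^sup>+x. ennreal (cmod (f x)) * (\<integral>\<^sup>+y. ennreal (2 * pi) * (ennreal (cmod (f y)) * ennreal (?N x y)) \<partial>lborel) \<partial>lborel)"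
    by (intro nn_integral_mono mult_left_mono gb) auto
  also have "\<dots> = (\<integral>\<^sup>+x. (\<integral>\<^sup>+y. ennreal (cmod (f x)) * (ennreal (2 * pi) * (ennreal (cmod (f y)) * ennreal (?N x y))) \<partial>lborel) \<partial>lborel)"
    by (intro nn_integral_cong nn_integral_cmult[symmetric]) measurable
  also have "\<dots> \<le> (\<integral>\<^sup>+x. (\<integral>\<^sup>+y. ennreal pi * (ennreal ((cmod (f x))\<^sup>2) * ennreal (?N x y)) + ennreal pi * (ennreal ((cmod (f y))\<^sup>2) * ennreal (?N x y)) \<partial>lborel) \<partial>lborel)"
  proof (intro nn_integral_mono)
    fix x y
    have "cmod (f x) * (2 * pi * (cmod (f y) * ?N x y)) \<le> pi * ((cmod (f x))\<^sup>2 * ?N x y) + pi * ((cmod (f y))\<^sup>2 * ?N x y)"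
    proof -
      have "0 \<le> pi * ?N x y * (cmod (f x) - cmod (f y))\<^sup>2" by simp
      then show ?thesis by (simp add: power2_eq_square algebra_simps)
    qed
    then have "ennreal (cmod (f x) * (2 * pi * (cmod (f y) * ?N x y))) \<le> ennreal (pi * ((cmod (f x))\<^sup>2 * ?N x y) + pi * ((cmod (f y))\<^sup>2 * ?N x y))"
      by (rule ennreal_leI)
    then show "ennreal (cmod (f x)) * (ennreal (2 * pi) * (ennreal (cmod (f y)) * ennreal (?N x y)))
       \<le> ennreal pi * (ennreal ((cmod (f x))\<^sup>2) * ennreal (?N x y)) + ennreal pi * (ennreal ((cmod (f y))\<^sup>2) * ennreal (?N x y))"
      by (simp only: ennreal_mult[symmetric] ennreal_plus[symmetric] mult_nonneg_nonneg norm_ge_zero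
          Npos pi_ge_zero zero_le_power2 zero_le_numeral)
  qed
  also have "\<dots> = (\<integral>\<^sup>+x. (\<integral>\<^sup>+y. ennreal pi * (ennreal ((cmod (f x))\<^sup>2) * ennreal (?N x y)) \<partial>lborel) \<partial>lborel)
      + (\<integral>\<^sup>+x. (\<integral>\<^sup>+y. ennreal pi * (ennreal ((cmod (f y))\<^sup>2) * ennreal (?N x y)) \<partial>lborel) \<partial>lborel)"
  proof (subst nn_integral_add[symmetric])
  qed (measurable, intro nn_integral_cong nn_integral_add, measurable)
  also have "(\<integral>\<^sup>+x. (\<integral>\<^sup>+y. ennreal pi * (ennreal ((cmod (f x))\<^sup>2) * ennreal (?N x y)) \<partial>lborel) \<partial>lborel)
      = ennreal pi * ennreal ((L2norm f)\<^sup>2)"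
    using nn_integral_L2norm[OF f2] by (simp add: nn_integral_cmult Nx)
  also have "(\<integral>\<^sup>+x. (\<integral>\<^sup>+y. ennreal pi * (ennreal ((cmod (f y))\<^sup>2) * ennreal (?N x y)) \<partial>lborel) \<partial>lborel)
      = (\<integral>\<^sup>+y. (\<integral>\<^sup>+x. ennreal pi * (ennreal ((cmod (f y))\<^sup>2) * ennreal (?N x y)) \<partial>lborel) \<partial>lborel)"
    by (rule lborel_pair.Fubini') measurable
  also have "\<dots> = ennreal pi * ennreal ((L2norm f)\<^sup>2)"
    using nn_integral_L2norm[OF f2] by (simp add: nn_integral_cmult Ny)
  also have "ennreal pi * ennreal ((L2norm f)\<^sup>2) + ennreal pi * ennreal ((L2norm f)\<^sup>2) = ennreal (2 * pi * (L2norm f)\<^sup>2)"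
    by (simp add: ennreal_mult[symmetric] ennreal_plus[symmetric] del: ennreal_plus)
  finally have "ennreal (cmod (ip (fourier f) F)) \<le> ennreal (2 * pi * (L2norm f)\<^sup>2)" unfolding key .
  moreover have "cmod (ip (fourier f) F) = (LINT k|lborel. (cmod (fourier f k))\<^sup>2 * w k)"
    unfolding ipF norm_of_real using wpos by (simp add: integral_nonneg_AE less_imp_le)
  moreover have "(\<integral>\<^sup>+k. ennreal ((cmod (fourier f k))\<^sup>2 * w k) \<partial>lborel) = ennreal (LINT k|lborel. (cmod (fourier f k))\<^sup>2 * w k)"
    using sqint wpos by (intro nn_integral_eq_integral) (auto simp: less_imp_le)
  ultimately show ?thesis unfolding w_def by simp
qed

text \<open>The bound of \<open>Bessel_regularized\<close> does not depend on \<open>d\<close>, so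
  Fatou's lemma removes the damping as \<open>d = 1/(n + 1)\<close> tends to 0.\<close>

lemma Bessel_fourier:
  assumes f1: "integrable lborel f" and f2: "L2 f"
  shows "L2 (fourier f)" "L2norm (fourier f) \<le> sqrt (2 * pi) * L2norm f"
proof -
  note [measurable] = borel_measurable_integrable[OF f1]
  let ?w = "\<lambda>n k. exp (- (1 / real (Suc n) * k)\<^sup>2 / 2)"
  have "(\<integral>\<^sup>+k. ennreal ((cmod (fourier f k))\<^sup>2) \<partial>lborel)
      = (\<integral>\<^sup>+k. liminf (\<lambda>n. ennreal ((cmod (fourier f k))\<^sup>2 * ?w n k)) \<partial>lborel)"
  proof (rule nn_integral_cong)
    fix k :: real
    have "(\<lambda>n. 1 / real (Suc n)) \<longlonglongrightarrow> 0"
      using LIMSEQ_inverse_real_of_nat by (simp add: inverse_eq_divide)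
    then have "(\<lambda>n. (cmod (fourier f k))\<^sup>2 * ?w n k) \<longlonglongrightarrow> (cmod (fourier f k))\<^sup>2 * exp (- (0 * k)\<^sup>2 / 2)"
      by (intro tendsto_intros) auto
    then have "(\<lambda>n. ennreal ((cmod (fourier f k))\<^sup>2 * ?w n k)) \<longlonglongrightarrow> ennreal ((cmod (fourier f k))\<^sup>2)"
      by (intro tendsto_ennrealI) simp
    from lim_imp_Liminf[OF _ this]
    show "ennreal ((cmod (fourier f k))\<^sup>2) = liminf (\<lambda>n. ennreal ((cmod (fourier f k))\<^sup>2 * ?w n k))"
      by simp
  qed
  also have "\<dots> \<le> liminf (\<lambda>n. (\<integral>\<^sup>+k. ennreal ((cmod (fourier f k))\<^sup>2 * ?w n k) \<partial>lborel))"
    by (rule nn_integral_liminf) measurable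
  also have "\<dots> \<le> liminf (\<lambda>n. ennreal (2 * pi * (L2norm f)\<^sup>2))"
    by (intro Liminf_mono always_eventually allI Bessel_regularized[OF f1 f2]) simp
  also have "\<dots> = ennreal ((sqrt (2 * pi) * L2norm f)\<^sup>2)"
    by (simp add: Liminf_const power_mult_distrib)
  finally have *: "(\<integral>\<^sup>+k. ennreal ((cmod (fourier f k))\<^sup>2) \<partial>lborel) \<le> ennreal ((sqrt (2 * pi) * L2norm f)\<^sup>2)" .
  have m: "fourier f \<in> borel_measurable borel" by measurable
  show "L2 (fourier f)" "L2norm (fourier f) \<le> sqrt (2 * pi) * L2norm f"
    using L2I_nn_le[OF m _ *] by auto
qed

section \<open>The Plancherel transform\<close>

text \<open>The positive and negative parts of \<open>h\<close>, normalised, are probability densities with the same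
  characteristic function.\<close>
lemma iexp_integral_zero_imp_AE_real:
  fixes h :: "real \<Rightarrow> real"
  assumes h: "integrable lborel h" and z: "\<And>t. (LINT x|lborel. iexp (t * x) * complex_of_real (h x)) = 0"
  shows "AE x in lborel. h x = 0"
proof -
  note [measurable] = borel_measurable_integrable[OF h]
  define p where "p x = max 0 (h x)" for x
  define n where "n x = max 0 (- h x)" for x
  have pn: "h x = p x - n x" "0 \<le> p x" "0 \<le> n x" for x by (auto simp: p_def n_def)
  have [measurable]: "p \<in> borel_measurable borel" "n \<in> borel_measurable borel"
    unfolding p_def n_def by measurable
  have int: "integrable lborel p" "integrable lborel n"
    by (rule Bochner_Integration.integrable_bound[OF h]; auto simp: p_def n_def)+
  have inti: "integrable lborel (\<lambda>x. iexp (t * x) * complex_of_real (q x))"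
    if q: "integrable lborel q" for q :: "real \<Rightarrow> real" and t
  proof (rule Bochner_Integration.integrable_bound[OF q])
    note [measurable] = borel_measurable_integrable[OF q]
    show "(\<lambda>x. iexp (t * x) * complex_of_real (q x)) \<in> borel_measurable lborel" by measurable
  qed (auto simp: norm_mult)
  have eq: "(LINT x|lborel. iexp (t * x) * complex_of_real (p x)) = (LINT x|lborel. iexp (t * x) * complex_of_real (n x))" for t
  proof -
    have "(LINT x|lborel. iexp (t * x) * complex_of_real (h x)) =
      (LINT x|lborel. iexp (t * x) * complex_of_real (p x)) - (LINT x|lborel. iexp (t * x) * complex_of_real (n x))"
      unfolding pn(1) using inti[OF int(1), of t] inti[OF int(2), of t]
      by (subst Bochner_Integration.integral_diff[symmetric]) (auto simp: right_diff_distrib)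
    then show ?thesis using z[of t] by simp
  qed
  define c where "c = (LINT x|lborel. p x)"
  have cn: "c = (LINT x|lborel. n x)"
    using eq[of 0] by (simp add: c_def)
  have c0: "0 \<le> c" unfolding c_def using pn by (intro integral_nonneg_AE) auto
  show ?thesis
  proof (cases "c = 0")
    case True
    have "AE x in lborel. p x = 0" "AE x in lborel. n x = 0"
      using True cn int pn unfolding c_def
      by (auto simp flip: integral_nonneg_eq_0_iff_AE)
    then show ?thesis by eventually_elim (simp add: pn(1))
  next
    case False
    then have c: "c > 0" using c0 by simp
    define M where "M q = density lborel (\<lambda>x. ennreal (q x / c))" for q :: "real \<Rightarrow> real"
    have rd: "real_distribution (M q)"
      if "integrable lborel q" "\<And>x. 0 \<le> q x" "(LINT x|lborel. q x) = c" for q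
    proof -
      have [measurable]: "q \<in> borel_measurable borel" using that(1) by auto
      have "emeasure (M q) (space (M q)) = (\<integral>\<^sup>+x. ennreal (q x / c) \<partial>lborel)"
        unfolding M_def by (subst emeasure_density) (auto simp: space_density)
      also have "\<dots> = ennreal (LINT x|lborel. q x / c)"
        using that c by (intro nn_integral_eq_integral) auto
      also have "\<dots> = 1" using that c by simp
      finally have "prob_space (M q)" by (rule prob_spaceI)
      then show ?thesis
        unfolding real_distribution_def real_distribution_axioms_def by (auto simp: M_def)
    qed
    have ch: "char (M q) t = (LINT x|lborel. iexp (t * x) * complex_of_real (q x)) / c"
      if "integrable lborel q" "\<And>x. 0 \<le> q x" for q t
    proof -
      have [measurable]: "q \<in> borel_measurable borel" using that(1) by auto
      have "char (M q) t = (LINT x|lborel. (q x / c) *\<^sub>R iexp (t * x))"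
        unfolding char_def M_def using that c by (intro integral_density) auto
      then show ?thesis by (simp add: scaleR_conv_of_real mult.commute)
    qed
    have "char (M p) = char (M n)"
      by (intro ext) (simp only: ch[OF int(1) pn(2)] ch[OF int(2) pn(3)] eq)
    then have "M p = M n"
      using rd[OF int(1) pn(2)] rd[OF int(2) pn(3)] c_def cn by (intro Levy_uniqueness) auto
    then have "AE x in lborel. ennreal (p x / c) = ennreal (n x / c)"
      unfolding M_def by (intro sigma_finite_measure.density_unique[OF lborel.sigma_finite_measure_axioms]) auto
    then show ?thesis
    proof eventually_elim
      case (elim x)
      then have "p x / c = n x / c" using c pn(2,3) by (subst (asm) ennreal_inj) auto
      then show ?case using c by (simp add: pn(1))
    qed
  qed
qed

text \<open>The transform of \<open>cnj f\<close> at \<open>k\<close> is the conjugate of that of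
  \<open>f\<close> at \<open>- k\<close> and vanishes as well; hence so do the transforms of the
  real and imaginary parts, to which the real case applies.\<close>

lemma fourier_zero_imp_AE:
  assumes f: "integrable lborel f" and z: "\<And>k. fourier f k = 0"
  shows "AE x in lborel. f x = 0"
proof -
  have i1: "(LINT x|lborel. iexp (t * x) * f x) = 0" for t
    using z[of "- t"] by (simp add: fourier_def mult_ac)
  have i2: "(LINT x|lborel. iexp (t * x) * cnj (f x)) = 0" for t
    using z[of t] fourier_cnj[of f "- t"] by (simp add: fourier_def mult_ac)
  have f': "integrable lborel (\<lambda>x. cnj (f x))" using f by simp
  have I1: "integrable lborel (\<lambda>x. iexp (t * x) * f x)" for t
    using integrable_fourier_kernel[OF f, of "- t"] by (simp add: mult_ac)
  have I2: "integrable lborel (\<lambda>x. iexp (t * x) * cnj (f x))" for t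
    using integrable_fourier_kernel[OF f', of "- t"] by (simp add: mult_ac)
  have "(LINT x|lborel. iexp (t * x) * complex_of_real (Re (f x))) = 0" for t
  proof -
    have "(LINT x|lborel. iexp (t * x) * complex_of_real (Re (f x)))
       = (LINT x|lborel. (1/2) * (iexp (t * x) * f x + iexp (t * x) * cnj (f x)))"
      by (intro Bochner_Integration.integral_cong refl)
        (simp add: complex_add_cnj flip: distrib_left)
    also have "\<dots> = (1/2) * ((LINT x|lborel. iexp (t * x) * f x) + (LINT x|lborel. iexp (t * x) * cnj (f x)))"
      by (simp only: integral_mult_right_zero Bochner_Integration.integral_add[OF I1 I2])
    finally show ?thesis by (simp only: i1 i2) simp
  qed
  then have "AE x in lborel. Re (f x) = 0"
    using f by (intro iexp_integral_zero_imp_AE_real) auto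
  moreover have "(LINT x|lborel. iexp (t * x) * complex_of_real (Im (f x))) = 0" for t
  proof -
    have "(LINT x|lborel. iexp (t * x) * complex_of_real (Im (f x)))
       = (LINT x|lborel. (- \<i>/2) * (iexp (t * x) * f x - iexp (t * x) * cnj (f x)))"
      by (intro Bochner_Integration.integral_cong refl)
        (simp add: complex_eq_iff field_simps)
    also have "\<dots> = (- \<i>/2) * ((LINT x|lborel. iexp (t * x) * f x) - (LINT x|lborel. iexp (t * x) * cnj (f x)))"
      by (simp only: integral_mult_right_zero Bochner_Integration.integral_diff[OF I1 I2])
    finally show ?thesis by (simp only: i1 i2) simp
  qed
  then have "AE x in lborel. Im (f x) = 0"
    using f by (intro iexp_integral_zero_imp_AE_real) auto
  ultimately show ?thesis by eventually_elim (simp add: complex_eq_iff)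
qed

text \<open>Multiplication by one fixed Gaussian makes \<open>d\<close> integrable, and the pairings
  with \<open>gam s 0\<close> are then exactly the values of the transform of that product.
  Uniqueness in L2 is thereby reduced to uniqueness in L1, and the Gaussian has no zeros.\<close>

lemma gam_separates:
  assumes d: "L2 d" and z: "\<And>s. ip d (gam s 0) = 0"
  shows "AE x in lborel. d x = 0"
proof -
  have "AE x in lborel. d x * cnj (gam 0 0 x) = 0"
  proof (rule fourier_zero_imp_AE)
    show "integrable lborel (\<lambda>x. d x * cnj (gam 0 0 x))" by (rule integrable_ip[OF d L2_gam])
    show "fourier (\<lambda>x. d x * cnj (gam 0 0 x)) k = 0" for k
      using z[of k] by (simp add: fourier_def ip_def gam_def exp_cnj mult_ac)
  qed
  then show ?thesis by eventually_elim (simp add: gam_def)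
qed

text \<open>The Fourier-Plancherel transform as a relation, characterised by duality against Gaussian
  wave packets, whose transforms are explicit.\<close>
definition FT :: "(real \<Rightarrow> complex) \<Rightarrow> (real \<Rightarrow> complex) \<Rightarrow> bool" where
  "FT g G \<longleftrightarrow> L2 g \<and> L2 G \<and> (\<forall>s y. ip G (gamh s y) = 2 * pi * ip g (gam s y))"

lemma FT_L2: "FT g G \<Longrightarrow> L2 g" "FT g G \<Longrightarrow> L2 G"
  by (auto simp: FT_def)

lemma FT_ip: "FT g G \<Longrightarrow> ip G (gamh s y) = 2 * pi * ip g (gam s y)"
  by (auto simp: FT_def)

lemma FT_add: "FT g G \<Longrightarrow> FT h H \<Longrightarrow> FT (\<lambda>x. g x + h x) (\<lambda>k. G k + H k)"
  by (auto simp: FT_def L2_add ip_add_left L2_gam L2_gamh distrib_left)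

lemma FT_cmult: "FT g G \<Longrightarrow> FT (\<lambda>x. c * g x) (\<lambda>k. c * G k)"
  by (auto simp: FT_def L2_cmult ip_cmult_left mult_ac)

lemma FT_diff: "FT g G \<Longrightarrow> FT h H \<Longrightarrow> FT (\<lambda>x. g x - h x) (\<lambda>k. G k - H k)"
  by (auto simp: FT_def L2_diff ip_diff_left L2_gam L2_gamh right_diff_distrib)

lemma ip_cong_AE_left:
  assumes "L2 f" "AE x in lborel. f x = g x" "g \<in> borel_measurable borel" "L2 h"
  shows "ip f h = ip g h"
proof -
  note [measurable] = L2_measurable[OF assms(1)] assms(3) L2_measurable[OF assms(4)]
  show ?thesis unfolding ip_def using assms(2) by (intro integral_cong_AE) auto
qed

lemma FT_cong_AE:
  assumes "FT g G" "AE x in lborel. g x = g' x" "AE k in lborel. G k = G' k"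
    "g' \<in> borel_measurable borel" "G' \<in> borel_measurable borel"
  shows "FT g' G'"
  using assms ip_cong_AE_left[of g g'] ip_cong_AE_left[of G G'] L2_cong_AE(1)
  unfolding FT_def by (metis L2_gam L2_gamh)

lemma FT_unique_right:
  assumes "FT g G" "FT g G'" shows "AE k in lborel. G k = G' k"
proof -
  have "AE k in lborel. G k - G' k = 0"
  proof (rule gam_separates)
    show "L2 (\<lambda>k. G k - G' k)" using assms by (auto intro: L2_diff FT_L2)
    fix s
    \<comment> \<open>Up to a constant \<open>gamh 0 (- s)\<close> is \<open>gam s 0\<close>, so the
      frequencies needed on the transform side are reached by shifting the centre on the other
      side.\<close>
    have "ip (\<lambda>k. G k - G' k) (gamh 0 (- s)) = 0"
      using assms by (simp add: FT_def ip_diff_left L2_gamh)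
    then show "ip (\<lambda>k. G k - G' k) (gam s 0) = 0"
      unfolding gamh_def by (simp add: ip_cmult_right)
  qed
  then show ?thesis by simp
qed

lemma FT_unique_left:
  assumes "FT g G" "FT g' G" shows "AE x in lborel. g x = g' x"
proof -
  have "AE x in lborel. g x - g' x = 0"
  proof (rule gam_separates)
    show "L2 (\<lambda>k. g k - g' k)" using assms by (auto intro: L2_diff FT_L2)
    fix s
    have "ip g (gam s 0) = ip g' (gam s 0)"
      using FT_ip[OF assms(1), of s 0] FT_ip[OF assms(2), of s 0] by simp
    then show "ip (\<lambda>k. g k - g' k) (gam s 0) = 0"
      using assms by (simp add: ip_diff_left FT_L2 L2_gam)
  qed
  then show ?thesis by simp
qed

lemma FT_fourier:
  assumes "integrable lborel f" "L2 f"
  shows "FT f (fourier f)"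
  unfolding FT_def using assms Bessel_fourier(1)
  by (auto simp: fourier_mult_formula integrable_gamh inv_fourier_gamh)

lemma L2_reflect: "L2 f \<Longrightarrow> L2 (\<lambda>x. f (- x))"
  unfolding L2_def using lborel_integrable_real_affine[of "\<lambda>x. (cmod (f x))\<^sup>2" "-1" 0] by auto

lemma L2norm_reflect: "L2norm (\<lambda>x. f (- x)) = L2norm f"
  unfolding L2norm_def using lborel_integral_real_affine[of "-1" "\<lambda>x. (cmod (f x))\<^sup>2" 0] by simp

lemma Bessel_inv_fourier:
  assumes "integrable lborel K" "L2 K"
  shows "L2 (inv_fourier K)" "L2norm (inv_fourier K) \<le> L2norm K / sqrt (2 * pi)"
proof -
  have eq: "inv_fourier K = (\<lambda>x. (1 / (2 * pi)) * fourier K (- x))"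
    by (simp add: inv_fourier_eq fun_eq_iff)
  show "L2 (inv_fourier K)" unfolding eq
    by (intro L2_cmult L2_reflect Bessel_fourier assms)
  have "L2norm (inv_fourier K) = L2norm (fourier K) / (2 * pi)"
    unfolding eq L2norm_cmult L2norm_reflect by (simp add: norm_divide norm_mult)
  also have "\<dots> \<le> sqrt (2 * pi) * L2norm K / (2 * pi)"
    by (intro divide_right_mono Bessel_fourier assms) simp
  also have "\<dots> = sqrt (2 * pi) * L2norm K / (sqrt (2 * pi) * sqrt (2 * pi))" by simp
  also have "\<dots> = L2norm K / sqrt (2 * pi)" by (simp only: mult_divide_mult_cancel_left_if) simp
  finally show "L2norm (inv_fourier K) \<le> L2norm K / sqrt (2 * pi)" .
qed

lemma FT_inv_fourier:
  assumes "integrable lborel K" "L2 K"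
  shows "FT (inv_fourier K) K"
proof -
  have "ip K (gamh s y) = 2 * pi * ip (inv_fourier K) (gam s y)" for s y
  proof -
    have "ip (gamh s y) K = 2 * pi * ip (gam s y) (inv_fourier K)"
      using fourier_mult_formula[OF integrable_gam assms(1)] by (simp add: fourier_gam)
    from arg_cong[OF this, of cnj] show ?thesis by (simp add: ip_cnj)
  qed
  then show ?thesis unfolding FT_def using assms Bessel_inv_fourier by auto
qed

lemma ip_tendsto:
  assumes "\<And>n. L2 (g n)" "L2 h" "L2 k" and lim: "(\<lambda>n. L2norm (\<lambda>x. g n x - h x)) \<longlonglongrightarrow> 0"
  shows "(\<lambda>n. ip (g n) k) \<longlonglongrightarrow> ip h k"
proof -
  have "(\<lambda>n. ip (g n) k - ip h k) \<longlonglongrightarrow> 0"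
  proof (rule Lim_null_comparison)
    show "\<forall>\<^sub>F n in sequentially. norm (ip (g n) k - ip h k) \<le> L2norm (\<lambda>x. g n x - h x) * L2norm k"
      using assms by (intro always_eventually allI)
        (simp add: ip_diff_left[symmetric] Cauchy_Schwarz_L2 L2_diff)
    show "(\<lambda>n. L2norm (\<lambda>x. g n x - h x) * L2norm k) \<longlonglongrightarrow> 0"
      using tendsto_mult_right[OF lim, of "L2norm k"] by simp
  qed
  then show ?thesis by (rule LIM_zero_cancel)
qed

lemma FT_limit:
  assumes "\<And>n. FT (g n) (G n)" "L2 h" "L2 H"
    "(\<lambda>n. L2norm (\<lambda>x. g n x - h x)) \<longlonglongrightarrow> 0" "(\<lambda>n. L2norm (\<lambda>x. G n x - H x)) \<longlonglongrightarrow> 0"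
  shows "FT h H"
proof -
  have "ip H (gamh s y) = 2 * pi * ip h (gam s y)" for s y
  proof (rule LIMSEQ_unique)
    show "(\<lambda>n. ip (G n) (gamh s y)) \<longlonglongrightarrow> ip H (gamh s y)"
      by (rule ip_tendsto[OF FT_L2(2)[OF assms(1)] assms(3) L2_gamh assms(5)])
    have "(\<lambda>n. 2 * pi * ip (g n) (gam s y)) \<longlonglongrightarrow> 2 * pi * ip h (gam s y)"
      by (rule tendsto_mult_left[OF ip_tendsto[OF FT_L2(1)[OF assms(1)] assms(2) L2_gam assms(4)]])
    then show "(\<lambda>n. ip (G n) (gamh s y)) \<longlonglongrightarrow> 2 * pi * ip h (gam s y)"
      by (simp add: FT_ip[OF assms(1)])
  qed
  then show ?thesis using assms by (simp add: FT_def)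
qed

section \<open>Extension of the transforms from integrable functions to L2\<close>

definition trunc :: "nat \<Rightarrow> (real \<Rightarrow> complex) \<Rightarrow> real \<Rightarrow> complex" where
  "trunc n g x = indicator {- real n..real n} x * g x"

lemma L2_trunc:
  assumes g: "L2 g" shows "L2 (trunc n g)"
  unfolding trunc_def using L2_measurable[OF g]
  by (intro L2_bounded_mult[OF g, where C=1]) (auto simp: indicator_def)

lemma integrable_trunc:
  assumes g: "L2 g" shows "integrable lborel (trunc n g)"
proof -
  have "L2 (indicator {- real n..real n})"
  proof -
    have "(\<lambda>x. (cmod (indicator {- real n..real n} x))\<^sup>2) = (indicator {- real n..real n} :: real \<Rightarrow> real)"
      by (auto simp: indicator_def fun_eq_iff)
    moreover have "integrable lborel (indicator {- real n..real n} :: real \<Rightarrow> real)"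
      by (rule integrable_real_indicator) auto
    ultimately show ?thesis unfolding L2_def by auto
  qed
  moreover have "cnj (indicator A x) = indicator A x" for A and x :: real
    by (simp add: indicator_def)
  ultimately show ?thesis
    using integrable_ip[OF g, of "indicator {- real n..real n}"]
    unfolding trunc_def by (simp add: mult.commute)
qed

lemma trunc_tendsto:
  assumes g: "L2 g" shows "(\<lambda>n. L2norm (\<lambda>x. trunc n g x - g x)) \<longlonglongrightarrow> 0"
proof -
  note [measurable] = L2_measurable[OF g]
  have "(\<lambda>n. LINT x|lborel. (cmod (trunc n g x - g x))\<^sup>2) \<longlonglongrightarrow> (LINT (x::real)|lborel. (0::real))"
  proof (rule Bochner_Integration.integral_dominated_convergence[where w="\<lambda>x. (cmod (g x))\<^sup>2"])
    show "integrable lborel (\<lambda>x. (cmod (g x))\<^sup>2)" using g by (simp add: L2_def)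
    show "(\<lambda>x. (cmod (trunc n g x - g x))\<^sup>2) \<in> borel_measurable lborel" for n
      unfolding trunc_def by measurable
    show "AE x in lborel. norm ((cmod (trunc n g x - g x))\<^sup>2) \<le> (cmod (g x))\<^sup>2" for n
      by (auto simp: trunc_def indicator_def)
    show "AE x in lborel. (\<lambda>n. (cmod (trunc n g x - g x))\<^sup>2) \<longlonglongrightarrow> 0"
    proof (rule AE_I2)
      fix x :: real
      have "\<forall>\<^sub>F n in sequentially. (cmod (trunc n g x - g x))\<^sup>2 = 0"
        using eventually_ge_at_top[of "nat \<lceil>\<bar>x\<bar>\<rceil>"]
        by eventually_elim (auto simp: trunc_def indicator_def; linarith)
      then show "(\<lambda>n. (cmod (trunc n g x - g x))\<^sup>2) \<longlonglongrightarrow> 0"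
        by (rule tendsto_eventually)
    qed
  qed auto
  then show ?thesis
    unfolding L2norm_def using tendsto_real_sqrt by fastforce
qed

lemma L2norm_tendsto:
  assumes "\<And>n. L2 (g n)" "L2 h" and lim: "(\<lambda>n. L2norm (\<lambda>x. g n x - h x)) \<longlonglongrightarrow> 0"
  shows "(\<lambda>n. L2norm (g n)) \<longlonglongrightarrow> L2norm h"
proof -
  have "(\<lambda>n. L2norm (g n) - L2norm h) \<longlonglongrightarrow> 0"
  proof (rule Lim_null_comparison[OF _ lim], intro always_eventually allI)
    fix n
    show "norm (L2norm (g n) - L2norm h) \<le> L2norm (\<lambda>x. g n x - h x)"
      using L2norm_add_le[OF L2_diff[OF assms(1,2), of n] assms(2)]
        L2norm_diff_le[OF assms(1) L2_diff[OF assms(1,2)], of n n]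
      by simp
  qed
  then show ?thesis by (rule LIM_zero_cancel)
qed

text \<open>Extension by density from the integrable cut-offs. \<open>T\<close> is not assumed to be
  linear, so the Lipschitz bound \<open>D\<close>, which gives the Cauchy property, and the norm
  bound \<open>B\<close>, which passes to the limit, are stated separately.\<close>

lemma L2_extend:
  assumes g: "L2 g" and C: "C > 0"
    and L: "\<And>n. L2 (T (trunc n g))" and D: "\<And>m n. L2norm (\<lambda>k. T (trunc m g) k - T (trunc n g) k) \<le> C * L2norm (\<lambda>x. trunc m g x - trunc n g x)"
    and B: "\<And>n. L2norm (T (trunc n g)) \<le> C * L2norm (trunc n g)"
  shows "\<exists>G. L2 G \<and> (\<lambda>n. L2norm (\<lambda>x. T (trunc n g) x - G x)) \<longlonglongrightarrow> 0 \<and> L2norm G \<le> C * L2norm g"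
proof -
  have "\<exists>G. L2 G \<and> (\<lambda>n. L2norm (\<lambda>x. T (trunc n g) x - G x)) \<longlonglongrightarrow> 0"
  proof (rule L2_complete[OF L])
    fix e :: real assume "e > 0"
    then have "e / (2 * C) > 0" using C by simp
    from LIMSEQ_D[OF trunc_tendsto[OF g] this]
    obtain N where N: "\<And>n. n \<ge> N \<Longrightarrow> L2norm (\<lambda>x. trunc n g x - g x) < e / (2 * C)" by auto
    have "L2norm (\<lambda>k. T (trunc m g) k - T (trunc n g) k) \<le> e" if "m \<ge> N" "n \<ge> N" for m n
    proof -
      have "L2norm (\<lambda>x. (trunc m g x - g x) - (trunc n g x - g x)) \<le> L2norm (\<lambda>x. trunc m g x - g x) + L2norm (\<lambda>x. trunc n g x - g x)"
        by (intro L2norm_diff_le L2_diff L2_trunc g)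
      also have "\<dots> \<le> e / (2 * C) + e / (2 * C)" using N[OF that(1)] N[OF that(2)] by linarith
      also have "\<dots> = e / C" using C by (simp add: field_simps)
      finally have "C * L2norm (\<lambda>x. trunc m g x - trunc n g x) \<le> e" using C by (simp add: field_simps)
      with D[of m n] show ?thesis by linarith
    qed
    then show "\<exists>N. \<forall>m\<ge>N. \<forall>n\<ge>N. L2norm (\<lambda>x. T (trunc m g) x - T (trunc n g) x) \<le> e" by blast
  qed
  then obtain G where G: "L2 G" "(\<lambda>n. L2norm (\<lambda>x. T (trunc n g) x - G x)) \<longlonglongrightarrow> 0" by blast
  have "L2norm G \<le> C * L2norm g"
  proof (rule LIMSEQ_le)
    show "(\<lambda>n. L2norm (T (trunc n g))) \<longlonglongrightarrow> L2norm G" by (rule L2norm_tendsto[OF L G])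
    show "(\<lambda>n. C * L2norm (trunc n g)) \<longlonglongrightarrow> C * L2norm g"
      by (intro tendsto_mult_left L2norm_tendsto L2_trunc g trunc_tendsto)
    show "\<exists>N. \<forall>n\<ge>N. L2norm (T (trunc n g)) \<le> C * L2norm (trunc n g)" using B by blast
  qed
  with G show ?thesis by blast
qed

lemma FT_exists_right:
  assumes g: "L2 g"
  shows "\<exists>G. FT g G \<and> L2norm G \<le> sqrt (2 * pi) * L2norm g"
proof -
  have D: "L2norm (\<lambda>k. fourier (trunc m g) k - fourier (trunc n g) k) \<le> sqrt (2 * pi) * L2norm (\<lambda>x. trunc m g x - trunc n g x)" for m n
    unfolding fourier_diff[OF integrable_trunc[OF g] integrable_trunc[OF g], symmetric]
    by (intro Bessel_fourier Bochner_Integration.integrable_diff L2_diff integrable_trunc L2_trunc g)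
  obtain G where "L2 G" "(\<lambda>n. L2norm (\<lambda>x. fourier (trunc n g) x - G x)) \<longlonglongrightarrow> 0" "L2norm G \<le> sqrt (2 * pi) * L2norm g"
    using L2_extend[where T=fourier, OF g _ Bessel_fourier(1)[OF integrable_trunc[OF g] L2_trunc[OF g]] D
        Bessel_fourier(2)[OF integrable_trunc[OF g] L2_trunc[OF g]]] by auto
  then show ?thesis
    using FT_limit[OF FT_fourier[OF integrable_trunc[OF g] L2_trunc[OF g]] g _ trunc_tendsto[OF g]] by blast
qed

lemma inv_fourier_diff:
  "integrable lborel f \<Longrightarrow> integrable lborel g \<Longrightarrow> inv_fourier (\<lambda>x. f x - g x) k = inv_fourier f k - inv_fourier g k"
  unfolding inv_fourier_eq by (simp add: fourier_diff diff_divide_distrib)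

lemma FT_exists_left:
  assumes g: "L2 G"
  shows "\<exists>g. FT g G \<and> L2norm g \<le> 1 / sqrt (2 * pi) * L2norm G"
proof -
  note B = Bessel_inv_fourier(2)[unfolded divide_inverse mult.commute[of _ "inverse _"], folded inverse_eq_divide]
  have D: "L2norm (\<lambda>k. inv_fourier (trunc m G) k - inv_fourier (trunc n G) k) \<le> inverse (sqrt (2 * pi)) * L2norm (\<lambda>x. trunc m G x - trunc n G x)" for m n
    unfolding inv_fourier_diff[OF integrable_trunc[OF g] integrable_trunc[OF g], symmetric]
    by (intro B Bochner_Integration.integrable_diff L2_diff integrable_trunc L2_trunc g)
  obtain h where "L2 h" "(\<lambda>n. L2norm (\<lambda>x. inv_fourier (trunc n G) x - h x)) \<longlonglongrightarrow> 0" "L2norm h \<le> inverse (sqrt (2 * pi)) * L2norm G"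
    using L2_extend[where T=inv_fourier, OF g _ Bessel_inv_fourier(1)[OF integrable_trunc[OF g] L2_trunc[OF g]] D
        B[OF integrable_trunc[OF g] L2_trunc[OF g]]] by auto
  then show ?thesis
    using FT_limit[OF FT_inv_fourier[OF integrable_trunc[OF g] L2_trunc[OF g]] _ g _ trunc_tendsto[OF g]]
    unfolding inverse_eq_divide by blast
qed

text \<open>Each of the two existence lemmas supplies a partner obeying one Bessel bound, and
  uniqueness identifies it with the given one. The two constants are reciprocal, so the inequalities
  close up to an equality.\<close>

theorem Plancherel:
  assumes "FT g G" shows "L2norm G = sqrt (2 * pi) * L2norm g"
proof (rule antisym)
  obtain G' where G': "FT g G'" "L2norm G' \<le> sqrt (2 * pi) * L2norm g"
    using FT_exists_right[OF FT_L2(1)[OF assms]] by blast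
  have "L2norm G = L2norm G'"
    using L2_cong_AE(2)[OF FT_L2(2)[OF G'(1)] FT_unique_right[OF G'(1) assms]] FT_L2[OF assms] by auto
  then show "L2norm G \<le> sqrt (2 * pi) * L2norm g" using G' by simp
  obtain g' where g': "FT g' G" "L2norm g' \<le> 1 / sqrt (2 * pi) * L2norm G"
    using FT_exists_left[OF FT_L2(2)[OF assms]] by blast
  have "L2norm g = L2norm g'"
    using L2_cong_AE(2)[OF FT_L2(1)[OF g'(1)] FT_unique_left[OF g'(1) assms]] FT_L2[OF assms] by auto
  then show "sqrt (2 * pi) * L2norm g \<le> L2norm G"
    using g'(2) by (simp add: field_simps)
qed

text \<open>Polarisation of \<open>Plancherel\<close> gives the real part; replacing
  \<open>h\<close> by \<open>\<i> h\<close> gives the imaginary part.\<close>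

theorem Parseval:
  assumes g: "FT g G" and h: "FT h H" shows "ip G H = 2 * pi * ip g h"
proof -
  have Re: "Re (ip G H) = 2 * pi * Re (ip g h)" if h: "FT h H" for h H
  proof -
    have "(L2norm (\<lambda>x. G x + H x))\<^sup>2 = 2 * pi * (L2norm (\<lambda>x. g x + h x))\<^sup>2"
      using Plancherel[OF FT_add[OF g h]] by (simp add: power_mult_distrib)
    moreover have "(L2norm G)\<^sup>2 = 2 * pi * (L2norm g)\<^sup>2" "(L2norm H)\<^sup>2 = 2 * pi * (L2norm h)\<^sup>2"
      using Plancherel[OF g] Plancherel[OF h] by (simp_all add: power_mult_distrib)
    ultimately show ?thesis
      using L2norm_add_sq[of G H] L2norm_add_sq[of g h] FT_L2[OF g] FT_L2[OF h]
      by (simp add: algebra_simps)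
  qed
  have "Re (ip G (\<lambda>k. \<i> * H k)) = 2 * pi * Re (ip g (\<lambda>x. \<i> * h x))"
    by (rule Re[OF FT_cmult[OF h]])
  then have "Im (ip G H) = 2 * pi * Im (ip g h)" by (simp add: ip_cmult_right)
  with Re[OF h] show ?thesis by (simp add: complex_eq_iff)
qed

section \<open>Fourier multipliers and multiplication operators\<close>

lemma norm_gamh: "cmod (gamh s y k) = 2 * pi * normal_density s 1 k"
proof -
  have "sqrt (2 * pi) * sqrt (2 * pi) = 2 * pi" by simp
  then show ?thesis
    by (simp add: gamh_def norm_mult norm_gam_density del: real_sqrt_mult_self flip: mult.assoc)
qed

lemma add_power_le: "0 \<le> u \<Longrightarrow> 0 \<le> v \<Longrightarrow> (u + v) ^ n \<le> 2 ^ n * (u ^ n + v ^ n)" for u v :: real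
proof -
  assume uv: "0 \<le> u" "0 \<le> v"
  have "(u + v) ^ n \<le> (2 * max u v) ^ n"
    using uv by (intro power_mono) auto
  also have "\<dots> = 2 ^ n * (max u v) ^ n" by (simp add: power_mult_distrib)
  also have "\<dots> \<le> 2 ^ n * (u ^ n + v ^ n)"
    using uv by (intro mult_left_mono) (auto simp: max_def)
  finally show ?thesis .
qed

text \<open>A normal density has finite moments of every order. Membership of the packets makes the
  duality that defines \<open>mult_L2\<close> strong enough to determine its value almost
  everywhere.\<close>

lemma test_fun_gam: "test_fun (gam s y)"
  unfolding test_fun_def
proof (intro conjI allI)
  show "L2 (gam s y)" "integrable lborel (gam s y)" by (rule L2_gam, rule integrable_gam)
  fix n :: nat
  let ?B = "\<lambda>k. 2 * pi * (2 ^ n * ((1 + \<bar>s\<bar>) ^ n * normal_density s 1 k + normal_density s 1 k * \<bar>k - s\<bar> ^ n))"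
  have B: "integrable lborel ?B"
    by (intro integrable_mult_right Bochner_Integration.integrable_add integrable_normal_moment_abs) auto
  have le: "(1 + \<bar>k\<bar>) ^ n * cmod (gamh s y k) \<le> ?B k" for k
  proof -
    have "(1 + \<bar>k\<bar>) ^ n \<le> ((1 + \<bar>s\<bar>) + \<bar>k - s\<bar>) ^ n" by (intro power_mono) auto
    also have "\<dots> \<le> 2 ^ n * ((1 + \<bar>s\<bar>) ^ n + \<bar>k - s\<bar> ^ n)" by (intro add_power_le) auto
    finally have "(1 + \<bar>k\<bar>) ^ n * (2 * pi * normal_density s 1 k) \<le> 2 ^ n * ((1 + \<bar>s\<bar>) ^ n + \<bar>k - s\<bar> ^ n) * (2 * pi * normal_density s 1 k)"
      by (intro mult_right_mono) auto
    then show ?thesis unfolding norm_gamh by (simp add: algebra_simps)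
  qed
  show "integrable lborel (\<lambda>k. (1 + \<bar>k\<bar>) ^ n * cmod (fourier (gam s y) k))"
    unfolding fourier_gam
    by (rule Bochner_Integration.integrable_bound[OF B]) (use le in \<open>auto intro: order_trans[OF _ abs_ge_self]\<close>)
  show "integrable lborel (\<lambda>k. (1 + \<bar>k\<bar>) ^ n * (cmod (fourier (gam s y) k))\<^sup>2)"
    unfolding fourier_gam
  proof (rule Bochner_Integration.integrable_bound[OF integrable_mult_right[OF B, of "sqrt (2 * pi)"]])
    show "AE k in lborel. norm ((1 + \<bar>k\<bar>) ^ n * (cmod (gamh s y k))\<^sup>2) \<le> norm (sqrt (2 * pi) * ?B k)"
    proof (rule AE_I2)
      fix k
      have g: "cmod (gamh s y k) \<le> sqrt (2 * pi)"
        by (simp add: gamh_def norm_mult norm_gam)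
      have "(1 + \<bar>k\<bar>) ^ n * (cmod (gamh s y k))\<^sup>2 = cmod (gamh s y k) * ((1 + \<bar>k\<bar>) ^ n * cmod (gamh s y k))"
        by (simp add: power2_eq_square)
      also have "\<dots> \<le> sqrt (2 * pi) * ?B k"
        by (intro mult_mono g le) auto
      finally show "norm ((1 + \<bar>k\<bar>) ^ n * (cmod (gamh s y k))\<^sup>2) \<le> norm (sqrt (2 * pi) * ?B k)"
        by (simp add: order_trans[OF _ abs_ge_self])
    qed
  qed auto
qed

text \<open>Polynomial growth of \<open>m\<close> is compensated by the rapid decay of the transform
  of a test function, so the right-hand side of the defining duality is the inverse transform of a
  function in both L1 and L2. Parseval then shows that the function with transform
  \<open>m k * G k\<close> is an admissible value. The choice made by \<open>SOME\<close> may be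
  another one, but both agree against Gaussians.\<close>

theorem FT_mult_L2:
  assumes g: "FT g G" and m[measurable]: "m \<in> borel_measurable borel"
    and bnd: "\<And>k. cmod (m k) \<le> C * (1 + \<bar>k\<bar>) ^ n" and L: "L2 (\<lambda>k. m k * G k)"
  shows "FT (mult_L2 m g) (\<lambda>k. m k * G k)"
proof -
  obtain h where h: "FT h (\<lambda>k. m k * G k)" using FT_exists_left[OF L] by blast
  have C: "0 \<le> C" using order_trans[OF norm_ge_zero bnd[of 0]] by simp
  have eq: "ip h \<phi> = ip g (inv_fourier (\<lambda>k. cnj (m k) * fourier \<phi> k))" if \<phi>: "test_fun \<phi>" for \<phi>
  proof -
    have \<phi>': "FT \<phi> (fourier \<phi>)" using \<phi> by (intro FT_fourier) (auto simp: test_fun_def)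
    note [measurable] = L2_measurable[OF FT_L2(1)[OF \<phi>']]
    define K where "K k = cnj (m k) * fourier \<phi> k" for k
    have [measurable]: "K \<in> borel_measurable borel" unfolding K_def by measurable
    have Kb: "cmod (K k) \<le> C * ((1 + \<bar>k\<bar>) ^ n * cmod (fourier \<phi> k))" for k
      using mult_right_mono[OF bnd[of k], of "cmod (fourier \<phi> k)"] by (simp add: K_def norm_mult mult.assoc)
    have Ki: "integrable lborel K"
    proof (rule Bochner_Integration.integrable_bound)
      show "integrable lborel (\<lambda>k. C * ((1 + \<bar>k\<bar>) ^ n * cmod (fourier \<phi> k)))"
        using \<phi> by (intro integrable_mult_right) (auto simp: test_fun_def)
      show "AE k in lborel. norm (K k) \<le> norm (C * ((1 + \<bar>k\<bar>) ^ n * cmod (fourier \<phi> k)))"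
        using Kb by (auto intro: order_trans[OF _ abs_ge_self])
    qed measurable
    have K2: "L2 K" unfolding L2_def
    proof
      show "integrable lborel (\<lambda>k. (cmod (K k))\<^sup>2)"
      proof (rule Bochner_Integration.integrable_bound)
        show "integrable lborel (\<lambda>k. C\<^sup>2 * ((1 + \<bar>k\<bar>) ^ (2 * n) * (cmod (fourier \<phi> k))\<^sup>2))"
          using \<phi> by (intro integrable_mult_right) (auto simp: test_fun_def)
        have "(cmod (K k))\<^sup>2 \<le> C\<^sup>2 * ((1 + \<bar>k\<bar>) ^ (2 * n) * (cmod (fourier \<phi> k))\<^sup>2)" for k
          using power_mono[OF Kb[of k], of 2] by (simp add: power_mult_distrib power_mult power2_eq_square mult_ac)
        then show "AE k in lborel. norm ((cmod (K k))\<^sup>2) \<le> norm (C\<^sup>2 * ((1 + \<bar>k\<bar>) ^ (2 * n) * (cmod (fourier \<phi> k))\<^sup>2))"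
          by (auto intro: order_trans[OF _ abs_ge_self])
      qed measurable
    qed measurable
    have "2 * pi * ip h \<phi> = ip (\<lambda>k. m k * G k) (fourier \<phi>)"
      by (rule Parseval[OF h \<phi>', symmetric])
    also have "\<dots> = ip G K" unfolding ip_def K_def by (simp add: mult_ac)
    also have "\<dots> = 2 * pi * ip g (inv_fourier K)"
      by (rule Parseval[OF g FT_inv_fourier[OF Ki K2]])
    finally show ?thesis unfolding K_def by simp
  qed
  have "L2 (mult_L2 m g) \<and> (\<forall>\<phi>. test_fun \<phi> \<longrightarrow>
      (LINT x|lborel. mult_L2 m g x * cnj (\<phi> x)) =
      (LINT x|lborel. g x * cnj (inv_fourier (\<lambda>k. cnj (m k) * fourier \<phi> k) x)))"
    unfolding mult_L2_def
    by (rule someI[of _ h]) (use eq h in \<open>auto simp: ip_def FT_L2\<close>)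
  then have m1: "L2 (mult_L2 m g)"
    and m2: "\<And>\<phi>. test_fun \<phi> \<Longrightarrow> ip (mult_L2 m g) \<phi> = ip g (inv_fourier (\<lambda>k. cnj (m k) * fourier \<phi> k))"
    by (auto simp: ip_def)
  have "AE x in lborel. h x - mult_L2 m g x = 0"
  proof (rule gam_separates)
    show "L2 (\<lambda>x. h x - mult_L2 m g x)" by (intro L2_diff FT_L2(1)[OF h] m1)
    show "ip (\<lambda>x. h x - mult_L2 m g x) (gam s 0) = 0" for s
      using eq[OF test_fun_gam] m2[OF test_fun_gam] FT_L2(1)[OF h] m1
      by (simp add: ip_diff_left L2_gam)
  qed
  then show ?thesis
    by (intro FT_cong_AE[OF h]) (use m1 FT_L2(2)[OF h] in auto)
qed

lemma L2_scale: "c \<noteq> 0 \<Longrightarrow> L2 g \<Longrightarrow> L2 (\<lambda>x. g (c * x))"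
  unfolding L2_def using lborel_integrable_real_affine[of "\<lambda>x. (cmod (g x))\<^sup>2" c 0] by auto

lemma ip_scale: "c > 0 \<Longrightarrow> ip f g = c * ip (\<lambda>x. f (c * x)) (\<lambda>x. g (c * x))"
  unfolding ip_def using lborel_integral_real_affine[of c "\<lambda>x. f x * cnj (g x)" 0]
  by (simp add: scaleR_conv_of_real)

text \<open>A dilated packet is in general no longer of the form \<open>gam\<close>, so the duality
  defining \<open>FT\<close> does not apply to it directly. Its transform is computed by
  substitution and the full \<open>Parseval\<close> is used instead.\<close>

lemma FT_scale:
  assumes e: "e > 0" and g: "FT g G"
  shows "FT (\<lambda>x. g (x / e)) (\<lambda>k. e * G (e * k))"
proof -
  have L: "L2 (\<lambda>x. g (x / e))" "L2 (\<lambda>k. e * G (e * k))"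
    using L2_scale[of "1/e" g] L2_cmult[OF L2_scale[of e G]] e FT_L2[OF g] by auto
  have "ip (\<lambda>k. e * G (e * k)) (gamh s y) = 2 * pi * ip (\<lambda>x. g (x / e)) (gam s y)" for s y
  proof -
    define \<gamma> where "\<gamma> x = gam s y (e * x)" for x
    have \<gamma>: "integrable lborel \<gamma>" "L2 \<gamma>"
      using lborel_integrable_real_affine[OF integrable_gam[of s y], of e 0] L2_scale[OF _ L2_gam] e
      by (auto simp: \<gamma>_def[abs_def])
    have F: "fourier \<gamma> k = (1/e) * gamh s y (k / e)" for k
    proof -
      have "gamh s y (k / e) = (LINT x|lborel. gam s y x * exp (- (\<i> * complex_of_real (k / e) * complex_of_real x)))"
        unfolding fourier_gam[symmetric] fourier_def ..
      also have "\<dots> = e * (LINT x|lborel. gam s y (e * x) * exp (- (\<i> * complex_of_real (k / e) * complex_of_real (e * x))))"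
        using e by (subst lborel_integral_real_affine[of e _ 0]) (auto simp: scaleR_conv_of_real)
      also have "(LINT x|lborel. gam s y (e * x) * exp (- (\<i> * complex_of_real (k / e) * complex_of_real (e * x)))) = fourier \<gamma> k"
        unfolding fourier_def \<gamma>_def using e by (intro Bochner_Integration.integral_cong) (auto simp: mult.assoc)
      finally show ?thesis using e by simp
    qed
    have P: "ip G (fourier \<gamma>) = 2 * pi * ip g \<gamma>" by (rule Parseval[OF g FT_fourier[OF \<gamma>]])
    have "ip (\<lambda>k. e * G (e * k)) (gamh s y) = e * ip (\<lambda>k. G (e * k)) (\<lambda>k. gamh s y ((e * k) / e))"
      using e by (simp add: ip_cmult_left)
    also have "\<dots> = ip G (\<lambda>k. gamh s y (k / e))"
      by (rule ip_scale[OF e, symmetric])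
    also have "\<dots> = e * ip G (fourier \<gamma>)"
      unfolding F ip_cmult_right using e by simp
    also have "\<dots> = e * (2 * pi * ip g \<gamma>)" by (simp add: P)
    also have "ip g \<gamma> = (1/e) * ip (\<lambda>x. g (1/e * x)) (\<lambda>x. \<gamma> (1/e * x))"
      using ip_scale[of "1/e" g \<gamma>] e by simp
    also have "(\<lambda>x. \<gamma> (1/e * x)) = gam s y" using e by (simp add: \<gamma>_def fun_eq_iff)
    finally show ?thesis using e by simp
  qed
  then show ?thesis using L by (simp add: FT_def)
qed

section \<open>Multiplication by a profile, seen on the Fourier side\<close>

definition hat :: "(real \<Rightarrow> complex) \<Rightarrow> real \<Rightarrow> complex" where
  "hat g = (SOME G. FT g G)"

definition ihat :: "(real \<Rightarrow> complex) \<Rightarrow> real \<Rightarrow> complex" where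
  "ihat G = (SOME g. FT g G)"

text \<open>Convolution with the transform of \<open>\<theta>\<close>.\<close>
definition cv :: "(real \<Rightarrow> real) \<Rightarrow> (real \<Rightarrow> complex) \<Rightarrow> real \<Rightarrow> complex" where
  "cv \<theta> G = hat (\<lambda>x. complex_of_real (\<theta> x) * ihat G x)"

lemma FT_hat: "L2 g \<Longrightarrow> FT g (hat g)"
  unfolding hat_def using FT_exists_right by (metis someI)

lemma FT_ihat: "L2 G \<Longrightarrow> FT (ihat G) G"
  unfolding ihat_def using FT_exists_left by (metis someI)

definition bdd_meas :: "(real \<Rightarrow> real) \<Rightarrow> bool" where
  "bdd_meas \<theta> \<longleftrightarrow> \<theta> \<in> borel_measurable borel \<and> (\<exists>C. \<forall>x. \<bar>\<theta> x\<bar> \<le> C)"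

lemma L2_bdd_meas: "bdd_meas \<theta> \<Longrightarrow> L2 g \<Longrightarrow> L2 (\<lambda>x. complex_of_real (\<theta> x) * g x)"
  unfolding bdd_meas_def by (auto intro!: L2_bounded_mult)

lemma FT_cv:
  assumes \<theta>: "bdd_meas \<theta>" and g: "FT g G"
  shows "FT (\<lambda>x. complex_of_real (\<theta> x) * g x) (cv \<theta> G)"
proof -
  have i: "FT (ihat G) G" by (rule FT_ihat[OF FT_L2(2)[OF g]])
  have "AE x in lborel. ihat G x = g x" by (rule FT_unique_left[OF i g])
  then have ae: "AE x in lborel. complex_of_real (\<theta> x) * ihat G x = complex_of_real (\<theta> x) * g x" by auto
  have "FT (\<lambda>x. complex_of_real (\<theta> x) * ihat G x) (cv \<theta> G)"
    unfolding cv_def by (intro FT_hat L2_bdd_meas \<theta> FT_L2(1)[OF i])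
  from FT_cong_AE[OF this ae, of "cv \<theta> G"] FT_L2[OF this] L2_bdd_meas[OF \<theta> FT_L2(1)[OF g]]
  show ?thesis by auto
qed

lemma L2_cv: "bdd_meas \<theta> \<Longrightarrow> L2 G \<Longrightarrow> L2 (cv \<theta> G)"
  using FT_cv FT_ihat FT_L2 by blast

text \<open>\<open>Plancherel\<close> is used once in each direction and the factors sqrt (2 pi)
  cancel, so the norm is governed by the supremum of the profile and not by the size of its
  transform.\<close>

lemma cv_bound:
  assumes \<theta>: "bdd_meas \<theta>" and G: "L2 G" and C: "\<And>x. \<bar>\<theta> x\<bar> \<le> C"
  shows "L2norm (cv \<theta> G) \<le> C * L2norm G"
proof -
  note i = FT_ihat[OF G]
  have "L2norm (cv \<theta> G) = sqrt (2 * pi) * L2norm (\<lambda>x. complex_of_real (\<theta> x) * ihat G x)"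
    by (rule Plancherel[OF FT_cv[OF \<theta> i]])
  also have "\<dots> \<le> sqrt (2 * pi) * (C * L2norm (ihat G))"
    using C \<theta> by (intro mult_left_mono L2_bounded_mult(2)[OF FT_L2(1)[OF i]]) (auto simp: bdd_meas_def)
  also have "\<dots> = C * L2norm G" using Plancherel[OF i] by simp
  finally show ?thesis .
qed

text \<open>\<open>hat\<close> and \<open>ihat\<close> select representatives, so linearity survives
  only almost everywhere: both sides are transforms of the same function, and transforms are unique
  up to null sets.\<close>

lemma cv_linear:
  assumes \<theta>: "bdd_meas \<theta>" and "L2 G" "L2 H"
  shows "AE k in lborel. cv \<theta> (\<lambda>k. a * G k + b * H k) k = a * cv \<theta> G k + b * cv \<theta> H k"
proof (rule FT_unique_right)
  note i = FT_ihat[OF \<open>L2 G\<close>] FT_ihat[OF \<open>L2 H\<close>]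
  show "FT (\<lambda>x. complex_of_real (\<theta> x) * (a * ihat G x + b * ihat H x)) (cv \<theta> (\<lambda>k. a * G k + b * H k))"
    by (intro FT_cv \<theta> FT_add FT_cmult i)
  have "FT (\<lambda>x. a * (complex_of_real (\<theta> x) * ihat G x) + b * (complex_of_real (\<theta> x) * ihat H x)) (\<lambda>k. a * cv \<theta> G k + b * cv \<theta> H k)"
    by (intro FT_cv \<theta> FT_add FT_cmult i)
  then show "FT (\<lambda>x. complex_of_real (\<theta> x) * (a * ihat G x + b * ihat H x)) (\<lambda>k. a * cv \<theta> G k + b * cv \<theta> H k)"
    by (simp add: distrib_left mult.left_commute)
qed

lemma bdd_meas_lin: "bdd_meas \<theta> \<Longrightarrow> bdd_meas \<phi> \<Longrightarrow> bdd_meas (\<lambda>x. a * \<theta> x - \<phi> x)"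
proof -
  assume a: "bdd_meas \<theta>" "bdd_meas \<phi>"
  then obtain C D where C: "\<And>x. \<bar>\<theta> x\<bar> \<le> C" and D: "\<And>x. \<bar>\<phi> x\<bar> \<le> D"
    unfolding bdd_meas_def by blast
  have "\<bar>a * \<theta> x - \<phi> x\<bar> \<le> \<bar>a\<bar> * C + D" for x
  proof -
    have "\<bar>a * \<theta> x - \<phi> x\<bar> \<le> \<bar>a\<bar> * \<bar>\<theta> x\<bar> + \<bar>\<phi> x\<bar>"
      using abs_triangle_ineq4[of "a * \<theta> x" "\<phi> x"] by (simp add: abs_mult)
    also have "\<dots> \<le> \<bar>a\<bar> * C + D" by (intro add_mono mult_left_mono C D) auto
    finally show ?thesis .
  qed
  moreover have "(\<lambda>x. a * \<theta> x - \<phi> x) \<in> borel_measurable borel"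
    using a unfolding bdd_meas_def by (intro borel_measurable_diff borel_measurable_times) auto
  ultimately show ?thesis unfolding bdd_meas_def by blast
qed

lemma cv_diff_fun:
  assumes \<theta>: "bdd_meas \<theta>" and \<phi>: "bdd_meas \<phi>" and "L2 G"
  shows "AE k in lborel. cv (\<lambda>x. a * \<theta> x - \<phi> x) G k = a * cv \<theta> G k - cv \<phi> G k"
proof (rule FT_unique_right)
  note i = FT_ihat[OF \<open>L2 G\<close>]
  show "FT (\<lambda>x. complex_of_real (a * \<theta> x - \<phi> x) * ihat G x) (cv (\<lambda>x. a * \<theta> x - \<phi> x) G)"
    by (intro FT_cv bdd_meas_lin \<theta> \<phi> i)
  have "FT (\<lambda>x. a * (complex_of_real (\<theta> x) * ihat G x) - complex_of_real (\<phi> x) * ihat G x) (\<lambda>k. a * cv \<theta> G k - cv \<phi> G k)"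
    by (intro FT_cv FT_diff FT_cmult i \<theta> \<phi>)
  then show "FT (\<lambda>x. complex_of_real (a * \<theta> x - \<phi> x) * ihat G x) (\<lambda>k. a * cv \<theta> G k - cv \<phi> G k)"
    by (simp add: left_diff_distrib mult.assoc)
qed

section \<open>Derivatives of products\<close>

lemma fourier_vector_derivative:
  fixes f f' :: "real \<Rightarrow> complex"
  assumes d: "\<And>x. (f has_vector_derivative f' x) (at x)" and c: "continuous_on UNIV f'"
    and i: "integrable lborel f" and i': "integrable lborel f'"
    and l: "(f \<longlongrightarrow> 0) at_top" "(f \<longlongrightarrow> 0) at_bot"
  shows "fourier f' k = \<i> * k * fourier f k"
proof -
  let ?e = "\<lambda>x. exp (- (\<i> * complex_of_real k * complex_of_real x))"
  let ?F = "\<lambda>x. f x * ?e x" and ?f = "\<lambda>x. f' x * ?e x - \<i> * k * (f x * ?e x)"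
  have I: "integrable lborel ?f"
    using i i' by (intro Bochner_Integration.integrable_diff integrable_mult_right integrable_fourier_kernel)
  have fc: "continuous_on UNIV f"
    using d by (meson continuous_at_imp_continuous_on has_vector_derivative_continuous)
  have "(LBINT x=-\<infinity>..\<infinity>. ?f x) = 0 - 0"
  proof (rule interval_integral_FTC_integrable)
    show "(?F has_vector_derivative ?f x) (at x)" for x
    proof -
      have "(?e has_vector_derivative (- (\<i> * k)) * ?e x) (at x)"
        by (rule has_vector_derivative_real_field)
          (auto intro!: derivative_eq_intros)
      from has_vector_derivative_mult[OF d[of x] this]
      show ?thesis by (simp add: algebra_simps)
    qed
    show "isCont ?f x" for x
      using fc c by (intro continuous_intros) (auto simp: continuous_on_eq_continuous_at)
    show "set_integrable lborel (einterval (- \<infinity>) \<infinity>) ?f"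
      using I by (simp add: set_integrable_def)
    have lim: "(?F \<longlongrightarrow> 0) F" if "(f \<longlongrightarrow> 0) F" for F
      by (rule Lim_null_comparison[OF _ tendsto_norm_zero[OF that]]) (auto simp: norm_mult)
    show "((?F \<circ> real_of_ereal) \<longlongrightarrow> 0) (at_right (- \<infinity>))" "((?F \<circ> real_of_ereal) \<longlongrightarrow> 0) (at_left \<infinity>)"
      unfolding ereal_tendsto_simps using lim l by auto
  qed auto
  then have "(LINT x|lborel. ?f x) = 0"
    by (simp add: interval_lebesgue_integral_def set_lebesgue_integral_def)
  moreover have "(LINT x|lborel. ?f x) = fourier f' k - \<i> * k * fourier f k"
    unfolding fourier_def Bochner_Integration.integral_diff[OF integrable_fourier_kernel[OF i', of k]
      integrable_mult_right[OF integrable_fourier_kernel[OF i, of k], of "\<i> * k"]]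
    by (simp only: integral_mult_right_zero)
  ultimately show ?thesis by simp
qed

lemma abs_le_exp_square: "\<bar>u\<bar> \<le> exp (u\<^sup>2 / 4)" for u :: real
proof -
  have "0 \<le> (\<bar>u\<bar> / 2 - 1)\<^sup>2" by simp
  then have "\<bar>u\<bar> \<le> 1 + u\<^sup>2 / 4" by (simp add: power2_eq_square algebra_simps)
  also have "\<dots> \<le> exp (u\<^sup>2 / 4)" by (rule exp_ge_add_one_self)
  finally show ?thesis .
qed

text \<open>The exponent is divided by 4 and not by 2, as in \<open>gam\<close>, to leave room for
  the factor \<open>x - y\<close> produced by differentiating a Gaussian;
  \<open>abs_le_exp_square\<close> absorbs it into the other half of the exponent.\<close>

lemma gauss_dominated:
  fixes f :: "real \<Rightarrow> complex"
  assumes [measurable]: "f \<in> borel_measurable borel" and b: "\<And>x. cmod (f x) \<le> C * exp (- (x - y)\<^sup>2 / 4)"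
  shows "integrable lborel f" "L2 f" "(f \<longlongrightarrow> 0) at_top" "(f \<longlongrightarrow> 0) at_bot"
proof -
  have C: "0 \<le> C" using order_trans[OF norm_ge_zero b[of y]] by simp
  have E: "integrable lborel (\<lambda>x. exp (- (x - y)\<^sup>2 / 4))"
  proof -
    have "(\<lambda>x. exp (- (x - y)\<^sup>2 / 4)) = (\<lambda>x. sqrt (2 * pi * (sqrt 2)\<^sup>2) * normal_density y (sqrt 2) x)"
      by (simp add: normal_density_def fun_eq_iff)
    then show ?thesis by (simp add: integrable_mult_right integrable_normal_density)
  qed
  show "integrable lborel f"
    by (rule Bochner_Integration.integrable_bound[OF integrable_mult_right[OF E, of C]])
      (use b in \<open>auto intro: order_trans[OF _ abs_ge_self]\<close>)
  have "integrable lborel (\<lambda>x. (cmod (f x))\<^sup>2)"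
  proof (rule Bochner_Integration.integrable_bound[OF integrable_mult_right[OF E, of "C\<^sup>2"]])
    have "(cmod (f x))\<^sup>2 \<le> C\<^sup>2 * exp (- (x - y)\<^sup>2 / 4)" for x
    proof -
      have "(cmod (f x))\<^sup>2 \<le> (C * exp (- (x - y)\<^sup>2 / 4))\<^sup>2" by (intro power_mono b) auto
      also have "\<dots> = C\<^sup>2 * (exp (- (x - y)\<^sup>2 / 4) * exp (- (x - y)\<^sup>2 / 4))" by (simp add: power2_eq_square)
      also have "\<dots> \<le> C\<^sup>2 * (exp (- (x - y)\<^sup>2 / 4) * 1)" by (intro mult_left_mono) auto
      finally show ?thesis by simp
    qed
    then show "AE x in lborel. norm ((cmod (f x))\<^sup>2) \<le> norm (C\<^sup>2 * exp (- (x - y)\<^sup>2 / 4))" by auto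
  qed auto
  then show "L2 f" by (auto simp: L2_def)
  have b2: "cmod (f x) \<le> C * \<bar>inverse (- y + x)\<bar>" if "x \<noteq> y" for x
  proof -
    have "exp (- (x - y)\<^sup>2 / 4) = inverse (exp ((x - y)\<^sup>2 / 4))" by (simp add: exp_minus)
    also have "\<dots> \<le> inverse \<bar>x - y\<bar>" using that by (intro le_imp_inverse_le abs_le_exp_square) auto
    finally have "C * exp (- (x - y)\<^sup>2 / 4) \<le> C * \<bar>inverse (- y + x)\<bar>"
      using C by (intro mult_left_mono) (auto simp: abs_inverse)
    with b[of x] show ?thesis by linarith
  qed
  have z: "((\<lambda>x. C * \<bar>inverse (- y + x)\<bar>) \<longlongrightarrow> 0) F" if "((\<lambda>x. inverse (- y + x)) \<longlongrightarrow> 0) F" for F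
    using tendsto_mult_right_zero[OF tendsto_rabs_zero[OF that]] .
  show "(f \<longlongrightarrow> 0) at_top"
  proof (rule Lim_null_comparison)
    show "\<forall>\<^sub>F x in at_top. cmod (f x) \<le> C * \<bar>inverse (- y + x)\<bar>"
      using eventually_gt_at_top[of y] by eventually_elim (rule b2, simp)
    show "((\<lambda>x. C * \<bar>inverse (- y + x)\<bar>) \<longlongrightarrow> 0) at_top"
      by (intro z tendsto_inverse_0_at_top filterlim_tendsto_add_at_top[OF tendsto_const filterlim_ident])
  qed
  show "(f \<longlongrightarrow> 0) at_bot"
  proof (rule Lim_null_comparison)
    show "\<forall>\<^sub>F x in at_bot. cmod (f x) \<le> C * \<bar>inverse (- y + x)\<bar>"
      using eventually_gt_at_bot[of y] by eventually_elim (rule b2, simp)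
    have "filterlim (\<lambda>x. - y + x) at_bot at_bot"
      unfolding filterlim_at_bot
    proof
      fix Z show "\<forall>\<^sub>F x in at_bot. - y + x \<le> Z"
        using eventually_le_at_bot[of "Z + y"] by eventually_elim simp
    qed
    then have "filterlim (\<lambda>x. - y + x) at_infinity at_bot"
      by (rule filterlim_mono[OF _ at_bot_le_at_infinity order_refl])
    then have "((\<lambda>x. inverse (- y + x)) \<longlongrightarrow> 0) at_bot"
      by (rule filterlim_compose[OF tendsto_inverse_0])
    then show "((\<lambda>x. C * \<bar>inverse (- y + x)\<bar>) \<longlongrightarrow> 0) at_bot" by (rule z)
  qed
qed

definition C1b :: "(real \<Rightarrow> real) \<Rightarrow> (real \<Rightarrow> real) \<Rightarrow> bool" where
  "C1b \<theta> \<theta>' \<longleftrightarrow> (\<forall>x. (\<theta> has_real_derivative \<theta>' x) (at x)) \<and> continuous_on UNIV \<theta>'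
    \<and> (\<exists>C. \<forall>x. \<bar>\<theta> x\<bar> \<le> C \<and> \<bar>\<theta>' x\<bar> \<le> C)"

lemma C1b_bdd_meas:
  assumes "C1b \<theta> \<theta>'" shows "bdd_meas \<theta>" "bdd_meas \<theta>'"
proof -
  have "continuous_on UNIV \<theta>"
    using assms by (meson C1b_def DERIV_isCont continuous_at_imp_continuous_on)
  then show "bdd_meas \<theta>" "bdd_meas \<theta>'"
    using assms by (auto simp: C1b_def bdd_meas_def intro: borel_measurable_continuous_onI)
qed

text \<open>Classical integration by parts, made legitimate by Gaussian decay of both the product
  and its derivative. The last conclusion allows the two terms of \<open>f'\<close> to be paired
  separately with an L2 function.\<close>

lemma FT_derivative_gauss:
  fixes \<theta> \<theta>' :: "real \<Rightarrow> real" and y :: real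
  assumes t: "C1b \<theta> \<theta>'"
  defines "f \<equiv> \<lambda>x. complex_of_real (\<theta> x) * gam 0 y x"
    and "f' \<equiv> \<lambda>x. complex_of_real (\<theta>' x) * gam 0 y x + complex_of_real (\<theta> x) * (complex_of_real (- (x - y)) * gam 0 y x)"
  shows "FT f (fourier f)" "FT f' (\<lambda>k. \<i> * k * fourier f k)"
    "L2 (\<lambda>x. complex_of_real (- (x - y)) * gam 0 y x)"
proof -
  obtain C where C: "\<And>x. \<bar>\<theta> x\<bar> \<le> C" "\<And>x. \<bar>\<theta>' x\<bar> \<le> C" using t by (auto simp: C1b_def)
  have C0: "0 \<le> C" using C(1)[of 0] abs_ge_zero[of "\<theta> 0"] by linarith
  have [measurable]: "\<theta> \<in> borel_measurable borel" "\<theta>' \<in> borel_measurable borel"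
    using C1b_bdd_meas[OF t] by (auto simp: bdd_meas_def)
  have split: "exp (- (x - y)\<^sup>2 / 2) = exp (- (x - y)\<^sup>2 / 4) * exp (- (x - y)\<^sup>2 / 4)" for x
    by (simp flip: exp_add)
  have g1: "exp (- (x - y)\<^sup>2 / 2) \<le> exp (- (x - y)\<^sup>2 / 4)" for x by simp
  have g2: "\<bar>x - y\<bar> * exp (- (x - y)\<^sup>2 / 2) \<le> exp (- (x - y)\<^sup>2 / 4)" for x
  proof -
    have "\<bar>x - y\<bar> * exp (- (x - y)\<^sup>2 / 4) \<le> exp ((x - y)\<^sup>2 / 4) * exp (- (x - y)\<^sup>2 / 4)"
      by (intro mult_right_mono abs_le_exp_square) auto
    also have "\<dots> = 1" by (simp flip: exp_add)
    finally show ?thesis unfolding split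
      by (metis mult.assoc mult_right_mono exp_ge_zero mult_1)
  qed
  have fm: "f \<in> borel_measurable borel" "f' \<in> borel_measurable borel"
    "(\<lambda>x. complex_of_real (- (x - y)) * gam 0 y x) \<in> borel_measurable borel"
    unfolding f_def f'_def by measurable
  have b: "cmod (f x) \<le> C * exp (- (x - y)\<^sup>2 / 4)" for x
    unfolding f_def norm_mult norm_gam norm_of_real by (intro mult_mono C g1 C0) auto
  have b3: "cmod (complex_of_real (- (x - y)) * gam 0 y x) \<le> 1 * exp (- (x - y)\<^sup>2 / 4)" for x
    unfolding norm_mult norm_gam norm_of_real using g2[of x] by (simp add: abs_minus_commute)
  have b': "cmod (f' x) \<le> (2 * C) * exp (- (x - y)\<^sup>2 / 4)" for x
  proof -
    have "cmod (f' x) \<le> \<bar>\<theta>' x\<bar> * exp (- (x - y)\<^sup>2 / 2) + \<bar>\<theta> x\<bar> * cmod (complex_of_real (- (x - y)) * gam 0 y x)"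
      unfolding f'_def by (rule order_trans[OF norm_triangle_ineq]) (simp add: norm_mult norm_gam)
    also have "\<dots> \<le> C * exp (- (x - y)\<^sup>2 / 4) + C * (1 * exp (- (x - y)\<^sup>2 / 4))"
      by (intro add_mono mult_mono C g1 b3 C0) auto
    finally show ?thesis by simp
  qed
  note G = gauss_dominated[OF fm(1) b] gauss_dominated(1,2)[OF fm(2) b']
  show "L2 (\<lambda>x. complex_of_real (- (x - y)) * gam 0 y x)"
    by (rule gauss_dominated(2)[OF fm(3) b3])
  show "FT f (fourier f)" by (rule FT_fourier[OF G(1,2)])
  have "fourier f' k = \<i> * k * fourier f k" for k
  proof (rule fourier_vector_derivative)
    show "(f has_vector_derivative f' x) (at x)" for x
    proof -
      have "((\<lambda>x. \<theta> x * exp (- (x - y)\<^sup>2 / 2)) has_real_derivative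
        (\<theta>' x * exp (- (x - y)\<^sup>2 / 2) + \<theta> x * (- (x - y) * exp (- (x - y)\<^sup>2 / 2)))) (at x)"
      proof -
        have e: "((\<lambda>x. exp (- (x - y)\<^sup>2 / 2)) has_real_derivative (- (x - y) * exp (- (x - y)\<^sup>2 / 2))) (at x)"
          by (rule derivative_eq_intros refl | simp)+
        have "(\<theta> has_real_derivative \<theta>' x) (at x)" using t by (simp add: C1b_def)
        from DERIV_mult'[OF this e] show ?thesis by (simp only: add.commute)
      qed
      then have "((\<lambda>x. complex_of_real (\<theta> x * exp (- (x - y)\<^sup>2 / 2))) has_vector_derivative
        complex_of_real (\<theta>' x * exp (- (x - y)\<^sup>2 / 2) + \<theta> x * (- (x - y) * exp (- (x - y)\<^sup>2 / 2)))) (at x)"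
        by (intro has_vector_derivative_of_real) (simp add: has_real_derivative_iff_has_vector_derivative)
      then show ?thesis unfolding f_def f'_def gam_def by simp
    qed
    have "continuous_on UNIV \<theta>"
      using t by (meson C1b_def DERIV_isCont continuous_at_imp_continuous_on)
    then show "continuous_on UNIV f'"
      using t unfolding f'_def gam_def C1b_def by (intro continuous_intros) auto
  qed (use G in auto)
  then have "fourier f' = (\<lambda>k. \<i> * k * fourier f k)" by (rule ext)
  then show "FT f' (\<lambda>k. \<i> * k * fourier f k)" using FT_fourier[OF G(5,6)] by simp
qed

text \<open>Against a Gaussian \<open>\<phi>\<close> the weak derivative of \<open>\<theta> h\<close> is computed by moving \<open>\<theta>\<close> to the test function: \<open>\<theta> \<phi>\<close>
  is smooth enough for a classical integration by parts.\<close>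
theorem cv_product_rule:
  assumes t: "C1b \<theta> \<theta>'" and H: "L2 H" and H1: "L2 (\<lambda>k. \<i> * complex_of_real k * H k)"
  shows "AE k in lborel. \<i> * complex_of_real k * cv \<theta> H k = cv \<theta>' H k + cv \<theta> (\<lambda>k. \<i> * complex_of_real k * H k) k"
proof -
  note bm = C1b_bdd_meas[OF t]
  define h where "h = ihat H"
  define h1 where "h1 = ihat (\<lambda>k. \<i> * complex_of_real k * H k)"
  have h: "FT h H" and h1: "FT h1 (\<lambda>k. \<i> * complex_of_real k * H k)"
    unfolding h_def h1_def by (intro FT_ihat H H1)+
  define U where "U = cv \<theta> H"
  define V where "V k = cv \<theta>' H k + cv \<theta> (\<lambda>k. \<i> * complex_of_real k * H k) k" for k
  have U: "FT (\<lambda>x. complex_of_real (\<theta> x) * h x) U" unfolding U_def by (rule FT_cv[OF bm(1) h])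
  have V1: "FT (\<lambda>x. complex_of_real (\<theta>' x) * h x) (cv \<theta>' H)" by (rule FT_cv[OF bm(2) h])
  have V2: "FT (\<lambda>x. complex_of_real (\<theta> x) * h1 x) (cv \<theta> (\<lambda>k. \<i> * complex_of_real k * H k))" by (rule FT_cv[OF bm(1) h1])
  have V: "FT (\<lambda>x. complex_of_real (\<theta>' x) * h x + complex_of_real (\<theta> x) * h1 x) V"
    unfolding V_def by (rule FT_add[OF V1 V2])
  note [measurable] = L2_measurable[OF FT_L2(2)[OF U]] L2_measurable[OF FT_L2(2)[OF V]]
  \<comment> \<open>With the constant profile, \<open>FT_derivative_gauss\<close> yields the
    transform of the derivative of the Gaussian alone.\<close>
  have one: "C1b (\<lambda>x. 1) (\<lambda>x. 0)" by (auto simp: C1b_def intro: exI[of _ 1])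
  have key: "ip V (gamh 0 y) = ip U (\<lambda>k. - (\<i> * complex_of_real k * gamh 0 y k))" for y
  proof -
    let ?\<phi> = "gam 0 y" and ?\<phi>' = "\<lambda>x. complex_of_real (- (x - y)) * gam 0 y x"
    let ?f = "\<lambda>x. complex_of_real (\<theta> x) * ?\<phi> x"
    note D = FT_derivative_gauss[OF t, of y]
    have \<phi>': "FT ?\<phi>' (\<lambda>k. \<i> * k * gamh 0 y k)"
      using FT_derivative_gauss(2)[OF one, of y] by (simp add: fourier_gam del: of_real_minus)
    have "ip h1 ?f = - ip h (\<lambda>x. complex_of_real (\<theta>' x) * ?\<phi> x + complex_of_real (\<theta> x) * ?\<phi>' x)"
    proof -
      have "2 * pi * ip h1 ?f = ip (\<lambda>k. \<i> * complex_of_real k * H k) (fourier ?f)"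
        by (rule Parseval[OF h1 D(1), symmetric])
      also have "\<dots> = - ip H (\<lambda>k. \<i> * k * fourier ?f k)"
        unfolding ip_def by (simp add: mult_ac)
      also have "\<dots> = - (2 * pi * ip h (\<lambda>x. complex_of_real (\<theta>' x) * ?\<phi> x + complex_of_real (\<theta> x) * ?\<phi>' x))"
        by (simp only: Parseval[OF h D(2)])
      finally have "complex_of_real (2 * pi) * (ip h1 ?f + ip h (\<lambda>x. complex_of_real (\<theta>' x) * ?\<phi> x + complex_of_real (\<theta> x) * ?\<phi>' x)) = 0"
        by (simp only: distrib_left) simp
      then show ?thesis by (simp only: mult_eq_0_iff) (simp add: add_eq_0_iff2 del: of_real_minus)
    qed
    also have "\<dots> = - ip h (\<lambda>x. complex_of_real (\<theta>' x) * ?\<phi> x) - ip h (\<lambda>x. complex_of_real (\<theta> x) * ?\<phi>' x)"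
      by (subst ip_add_right[OF FT_L2(1)[OF h] L2_bdd_meas[OF bm(2) L2_gam] L2_bdd_meas[OF bm(1) D(3)]])
        (simp only: minus_add_distrib diff_conv_add_uminus)
    finally have a: "ip h1 ?f + ip h (\<lambda>x. complex_of_real (\<theta>' x) * ?\<phi> x) = - ip h (\<lambda>x. complex_of_real (\<theta> x) * ?\<phi>' x)"
      by simp
    have mv: "ip (\<lambda>x. complex_of_real (r x) * u x) v = ip u (\<lambda>x. complex_of_real (r x) * v x)" for r u v
      unfolding ip_def by (simp add: mult_ac)
    have "ip V (gamh 0 y) = 2 * pi * ip (\<lambda>x. complex_of_real (\<theta>' x) * h x + complex_of_real (\<theta> x) * h1 x) ?\<phi>"
      by (rule FT_ip[OF V])
    also have "\<dots> = 2 * pi * (ip h (\<lambda>x. complex_of_real (\<theta>' x) * ?\<phi> x) + ip h1 ?f)"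
      by (subst ip_add_left[OF FT_L2(1)[OF V1] FT_L2(1)[OF V2] L2_gam]) (simp only: mv)
    also have "\<dots> = - (2 * pi * ip h (\<lambda>x. complex_of_real (\<theta> x) * ?\<phi>' x))"
      using a by (simp add: add.commute)
    also have "\<dots> = - (2 * pi * ip (\<lambda>x. complex_of_real (\<theta> x) * h x) ?\<phi>')" by (simp only: mv)
    also have "\<dots> = - ip U (\<lambda>k. \<i> * k * gamh 0 y k)" by (simp only: Parseval[OF U \<phi>'])
    also have "\<dots> = ip U (\<lambda>k. - (\<i> * k * gamh 0 y k))" unfolding ip_def by simp
    finally show ?thesis .
  qed
  have L2k: "L2 (\<lambda>k. \<i> * complex_of_real k * gamh 0 y k)" for y
    using FT_L2(2)[OF FT_derivative_gauss(2)[OF one, of y]] by (simp add: fourier_gam)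
  \<comment> \<open>Square integrability of \<open>\<i> k U\<close> is not yet available here, so
    \<open>gam_separates\<close> cannot be applied. Multiplied by a Gaussian the difference is
    integrable, and shifting the centre \<open>y\<close> in \<open>key\<close> runs through all
    values of its Fourier transform.\<close>
  have "AE k in lborel. (\<i> * complex_of_real k * U k - V k) * cnj (gamh 0 0 k) = 0"
  proof (rule fourier_zero_imp_AE)
    have I1: "integrable lborel (\<lambda>k. U k * cnj (- (\<i> * complex_of_real k * gamh 0 y k)))" for y
      by (intro integrable_ip L2_minus FT_L2(2)[OF U] L2k)
    have I2: "integrable lborel (\<lambda>k. V k * cnj (gamh 0 y k))" for y
      by (intro integrable_ip FT_L2(2)[OF V] L2_gamh)
    have I: "integrable lborel (\<lambda>k. (\<i> * complex_of_real k * U k - V k) * cnj (gamh 0 y k))"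
      and Z: "(LINT k|lborel. (\<i> * complex_of_real k * U k - V k) * cnj (gamh 0 y k)) = 0" for y
    proof -
      have e: "(\<lambda>k. (\<i> * complex_of_real k * U k - V k) * cnj (gamh 0 y k)) =
         (\<lambda>k. U k * cnj (- (\<i> * complex_of_real k * gamh 0 y k)) - V k * cnj (gamh 0 y k))"
        by (simp add: fun_eq_iff algebra_simps)
      show "integrable lborel (\<lambda>k. (\<i> * complex_of_real k * U k - V k) * cnj (gamh 0 y k))"
        unfolding e by (intro Bochner_Integration.integrable_diff I1 I2)
      show "(LINT k|lborel. (\<i> * complex_of_real k * U k - V k) * cnj (gamh 0 y k)) = 0"
        unfolding e Bochner_Integration.integral_diff[OF I1 I2]
        using key[of y] by (simp add: ip_def)
    qed
    show "integrable lborel (\<lambda>k. (\<i> * complex_of_real k * U k - V k) * cnj (gamh 0 0 k))" by (rule I)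
    show "fourier (\<lambda>k. (\<i> * complex_of_real k * U k - V k) * cnj (gamh 0 0 k)) s = 0" for s
    proof -
      have "gamh 0 (- s) k = gamh 0 0 k * exp (\<i> * complex_of_real s * complex_of_real k)" for k
        by (simp add: gamh_def gam_def mult_ac)
      then show ?thesis using Z[of "- s"] unfolding fourier_def by (simp add: exp_cnj mult_ac)
    qed
  qed
  then have "AE k in lborel. \<i> * complex_of_real k * U k = V k"
    by eventually_elim (simp add: gamh_def gam_def)
  then show ?thesis unfolding U_def V_def .
qed

section \<open>The operators in rescaled weighted spaces\<close>

text \<open>\<open>u\<close> lives at the unscaled level, in the space with weight \<open>eps * al\<close>; its transform is taken after
  undoing the scaling. The case \<open>eps = 1\<close> covers the limit operator.\<close>
definition FTe :: "real \<Rightarrow> real \<Rightarrow> (real \<Rightarrow> complex) \<Rightarrow> (real \<Rightarrow> complex) \<Rightarrow> bool" where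
  "FTe al eps u U \<longleftrightarrow> FT (\<lambda>x. complex_of_real (exp (al * x)) * I_eps_inv eps u x) U"

definition zt :: "real \<Rightarrow> real \<Rightarrow> complex" where
  "zt al k = complex_of_real k + \<i> * complex_of_real al"

definition bsym :: "(real \<Rightarrow> complex) \<Rightarrow> bool" where
  "bsym m \<longleftrightarrow> m \<in> borel_measurable borel \<and> (\<exists>C. \<forall>k. cmod (m k) \<le> C)"

lemma zt_measurable [measurable]: "zt al \<in> borel_measurable borel"
  unfolding zt_def by measurable

lemma L2_bsym: "bsym m \<Longrightarrow> L2 G \<Longrightarrow> L2 (\<lambda>k. m k * G k)"
  unfolding bsym_def using L2_bounded_mult(1) by blast

lemma bsym_mult: "bsym m \<Longrightarrow> bsym n \<Longrightarrow> bsym (\<lambda>k. m k * n k)"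
proof -
  assume a: "bsym m" "bsym n"
  then obtain C D where C: "\<And>k. cmod (m k) \<le> C" and D: "\<And>k. cmod (n k) \<le> D"
    unfolding bsym_def by blast
  have "0 \<le> C" using order_trans[OF norm_ge_zero C[of 0]] by simp
  then have "cmod (m k * n k) \<le> C * D" for k
    unfolding norm_mult by (intro mult_mono C D) auto
  moreover have "(\<lambda>k. m k * n k) \<in> borel_measurable borel"
    using a unfolding bsym_def by (intro borel_measurable_times) auto
  ultimately show ?thesis unfolding bsym_def by blast
qed

lemma FTe_L2: "FTe al eps u U \<Longrightarrow> L2 U"
  unfolding FTe_def by (rule FT_L2)

lemma FTe_add: "FTe al eps u U \<Longrightarrow> FTe al eps v V \<Longrightarrow> FTe al eps (\<lambda>x. u x + v x) (\<lambda>k. U k + V k)"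
  unfolding FTe_def using FT_add[of _ U _ V] by (fastforce simp: I_eps_inv_def distrib_left)

lemma FTe_diff: "FTe al eps u U \<Longrightarrow> FTe al eps v V \<Longrightarrow> FTe al eps (\<lambda>x. u x - v x) (\<lambda>k. U k - V k)"
  unfolding FTe_def using FT_diff[of _ U _ V] by (fastforce simp: I_eps_inv_def right_diff_distrib)

lemma FTe_cmult: "FTe al eps u U \<Longrightarrow> FTe al eps (\<lambda>x. c * u x) (\<lambda>k. c * U k)"
  unfolding FTe_def using FT_cmult[of _ U c] by (fastforce simp: I_eps_inv_def mult_ac)

lemma FTe_cong_AE:
  assumes "FTe al eps u U" "AE k in lborel. U k = V k" "V \<in> borel_measurable borel"
  shows "FTe al eps u V"
  using assms unfolding FTe_def by (intro FT_cong_AE[OF _ _ assms(2)]) (auto dest: FT_L2 L2_measurable)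

lemma FTe_I_eps:
  assumes "eps > 0" "FT (\<lambda>x. complex_of_real (exp (al * x)) * g x) G"
  shows "FTe al eps (I_eps eps g) G"
proof -
  have "(\<lambda>x. complex_of_real (exp (al * x)) * I_eps_inv eps (I_eps eps g) x)
      = (\<lambda>x. complex_of_real (exp (al * x)) * g x)"
    using assms(1) by (simp add: I_eps_inv_def I_eps_def fun_eq_iff)
  then show ?thesis using assms(2) unfolding FTe_def by simp
qed

lemma FTe_one: "FTe al 1 g G \<longleftrightarrow> FT (\<lambda>x. complex_of_real (exp (al * x)) * g x) G"
  by (simp add: FTe_def I_eps_inv_def)

lemma FTe_multw:
  assumes e: "eps > 0" and u: "FTe al eps u U"
    and m: "(\<lambda>k. M (eps * zt al k)) \<in> borel_measurable borel"
    and bnd: "\<And>k. cmod (M (eps * zt al k)) \<le> C * (1 + \<bar>k\<bar>) ^ n"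
    and L: "L2 (\<lambda>k. M (eps * zt al k) * U k)"
  shows "FTe al eps (multw (eps * al) M u) (\<lambda>k. M (eps * zt al k) * U k)"
proof -
  define f where "f y = complex_of_real (exp ((eps * al) * y)) * u y" for y
  define m1 where "m1 k = M (complex_of_real k + \<i> * complex_of_real (eps * al))" for k
  have m1: "m1 k = M (eps * zt al (k / eps))" for k
    using e by (simp add: m1_def zt_def distrib_left mult_ac)
  have m1e: "m1 (eps * k) = M (eps * zt al k)" for k
    using e by (simp add: m1)
  have C: "0 \<le> C" using order_trans[OF norm_ge_zero bnd[of 0]] by simp
  have "FT (\<lambda>x. complex_of_real (1 / sqrt eps) * f (x / eps)) U"
  proof -
    have "(\<lambda>x. complex_of_real (exp (al * x)) * I_eps_inv eps u x) = (\<lambda>x. complex_of_real (1 / sqrt eps) * f (x / eps))"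
      using e by (simp add: I_eps_inv_def f_def fun_eq_iff mult_ac)
    then show ?thesis using u unfolding FTe_def by simp
  qed
  from FT_cmult[OF FT_scale[of "1/eps", OF _ this], of "complex_of_real (sqrt eps)"] e
  have F1: "FT f (\<lambda>k. complex_of_real (sqrt eps) * (complex_of_real (1 / eps) * U (1 / eps * k)))"
    by (simp add: mult.assoc[symmetric])
  have "FT (mult_L2 m1 f) (\<lambda>k. m1 k * (complex_of_real (sqrt eps) * (complex_of_real (1 / eps) * U (1 / eps * k))))"
  proof (rule FT_mult_L2[OF F1])
    have "(\<lambda>k. (\<lambda>k. M (eps * zt al k)) (k / eps)) \<in> borel_measurable borel"
      by (rule measurable_compose[OF _ m]) simp
    then show "m1 \<in> borel_measurable borel" by (simp add: m1[abs_def])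
    show "cmod (m1 k) \<le> (C * (1 + 1 / eps) ^ n) * (1 + \<bar>k\<bar>) ^ n" for k
    proof -
      have "cmod (m1 k) \<le> C * (1 + \<bar>k / eps\<bar>) ^ n" unfolding m1 by (rule bnd)
      also have "1 + \<bar>k / eps\<bar> \<le> (1 + 1 / eps) * (1 + \<bar>k\<bar>)"
        using e by (simp add: algebra_simps abs_divide)
      then have "C * (1 + \<bar>k / eps\<bar>) ^ n \<le> C * ((1 + 1 / eps) * (1 + \<bar>k\<bar>)) ^ n"
        using C by (intro mult_left_mono power_mono) auto
      finally show ?thesis by (simp add: power_mult_distrib mult.assoc)
    qed
    have "L2 (\<lambda>k. (complex_of_real (sqrt eps) * complex_of_real (1 / eps)) * (M (eps * zt al (1 / eps * k)) * U (1 / eps * k)))"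
      using e by (intro L2_cmult L2_scale[OF _ L]) simp
    then show "L2 (\<lambda>k. m1 k * (complex_of_real (sqrt eps) * (complex_of_real (1 / eps) * U (1 / eps * k))))"
      by (simp add: m1 mult_ac)
  qed
  from FT_cmult[OF FT_scale[OF e this], of "complex_of_real (1 / sqrt eps)"]
  have F2: "FT (\<lambda>x. complex_of_real (1 / sqrt eps) * mult_L2 m1 f (x / eps)) (\<lambda>k. complex_of_real (1 / sqrt eps) * (complex_of_real eps *
      (m1 (eps * k) * (complex_of_real (sqrt eps) * (complex_of_real (1 / eps) * U (1 / eps * (eps * k)))))))" .
  have r: "(\<lambda>k. complex_of_real (1 / sqrt eps) * (complex_of_real eps *
      (m1 (eps * k) * (complex_of_real (sqrt eps) * (complex_of_real (1 / eps) * U (1 / eps * (eps * k)))))))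
      = (\<lambda>k. M (eps * zt al k) * U k)"
    using e by (simp add: m1e fun_eq_iff)
  have l: "(\<lambda>x. complex_of_real (1 / sqrt eps) * mult_L2 m1 f (x / eps)) =
     (\<lambda>x. complex_of_real (exp (al * x)) * I_eps_inv eps (multw (eps * al) M u) x)"
  proof
    fix x
    have "complex_of_real (exp (al * x)) * complex_of_real (exp (- (eps * al) * (x / eps))) = 1"
      using e by (simp flip: of_real_mult exp_add)
    then show "complex_of_real (1 / sqrt eps) * mult_L2 m1 f (x / eps) =
        complex_of_real (exp (al * x)) * I_eps_inv eps (multw (eps * al) M u) x"
      unfolding I_eps_inv_def multw_def m1_def[symmetric] f_def[symmetric]
      by (metis (no_types, lifting) mult.assoc mult.left_commute mult_1)
  qed
  show ?thesis using F2 unfolding FTe_def l r .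
qed

lemma FTe_multw_bsym:
  assumes "eps > 0" "FTe al eps u U" "bsym (\<lambda>k. M (eps * zt al k))"
  shows "FTe al eps (multw (eps * al) M u) (\<lambda>k. M (eps * zt al k) * U k)"
proof -
  obtain C where "\<And>k. cmod (M (eps * zt al k)) \<le> C" using assms(3) unfolding bsym_def by blast
  then show ?thesis
    using assms(3) L2_bsym[OF assms(3) FTe_L2[OF assms(2)]]
    by (intro FTe_multw[OF assms(1,2), where C=C and n=0]) (auto simp: bsym_def)
qed

lemma norm_zt_le: "cmod (zt al k) \<le> \<bar>k\<bar> + \<bar>al\<bar>"
  unfolding zt_def by (rule order_trans[OF norm_triangle_ineq]) (simp add: norm_mult)

lemma FTe_multw_dsym:
  assumes e: "eps > 0" and u: "FTe al eps u U" and L: "L2 (\<lambda>k. \<i> * zt al k * U k)"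
  shows "FTe al eps (multw (eps * al) dsym u) (\<lambda>k. eps * (\<i> * zt al k * U k))"
proof -
  have "FTe al eps (multw (eps * al) dsym u) (\<lambda>k. dsym (eps * zt al k) * U k)"
  proof (rule FTe_multw[OF e u, where C="eps * (1 + \<bar>al\<bar>)" and n=1])
    show "(\<lambda>k. dsym (eps * zt al k)) \<in> borel_measurable borel" unfolding dsym_def by measurable
    show "cmod (dsym (eps * zt al k)) \<le> eps * (1 + \<bar>al\<bar>) * (1 + \<bar>k\<bar>) ^ 1" for k
    proof -
      have "cmod (dsym (eps * zt al k)) = eps * cmod (zt al k)" using e by (simp add: dsym_def norm_mult)
      also have "\<dots> \<le> eps * ((1 + \<bar>al\<bar>) * (1 + \<bar>k\<bar>))"
      proof (rule mult_left_mono)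
        have "0 \<le> \<bar>al\<bar> * \<bar>k\<bar>" by simp
        moreover have "(1 + \<bar>al\<bar>) * (1 + \<bar>k\<bar>) = 1 + \<bar>k\<bar> + \<bar>al\<bar> + \<bar>al\<bar> * \<bar>k\<bar>"
          by (simp add: algebra_simps)
        ultimately show "cmod (zt al k) \<le> (1 + \<bar>al\<bar>) * (1 + \<bar>k\<bar>)"
          using norm_zt_le[of al k] by linarith
      qed (use e in simp)
      finally show ?thesis by simp
    qed
    show "L2 (\<lambda>k. dsym (eps * zt al k) * U k)"
      using L2_cmult[OF L, of eps] by (simp add: dsym_def mult_ac)
  qed
  then show ?thesis by (simp add: dsym_def mult_ac)
qed

lemma FTe_mulop:
  assumes \<theta>: "bdd_meas \<theta>" and u: "FTe al eps u U" and f: "\<And>x. f (x / eps) = c * \<theta> x"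
  shows "FTe al eps (mulop f u) (\<lambda>k. complex_of_real c * cv \<theta> U k)"
proof -
  have "FT (\<lambda>x. complex_of_real c * (complex_of_real (\<theta> x) * (complex_of_real (exp (al * x)) * I_eps_inv eps u x))) (\<lambda>k. complex_of_real c * cv \<theta> U k)"
    using u unfolding FTe_def by (intro FT_cmult FT_cv \<theta>)
  then show ?thesis unfolding FTe_def I_eps_inv_def mulop_def f by (simp add: mult_ac)
qed

text \<open>The weight turns \<partial> into i\<zeta> = ik - al, and the constant al commutes with
  multiplication by the profile. The second conclusion says that multiplication by a C1 profile
  preserves the domain of \<partial>.\<close>

lemma cv_product_zt:
  assumes t: "C1b \<theta> \<theta>'" and H: "L2 H" and H1: "L2 (\<lambda>k. \<i> * zt al k * H k)"
  shows "AE k in lborel. \<i> * zt al k * cv \<theta> H k = cv \<theta>' H k + cv \<theta> (\<lambda>k. \<i> * zt al k * H k) k"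
    and "L2 (\<lambda>k. \<i> * zt al k * cv \<theta> H k)"
proof -
  note bm = C1b_bdd_meas[OF t]
  have e: "\<i> * complex_of_real k * h = \<i> * zt al k * h + complex_of_real al * h" for k h
    by (simp add: zt_def algebra_simps)
  have K: "L2 (\<lambda>k. \<i> * complex_of_real k * H k)"
    unfolding e by (intro L2_add L2_cmult H H1)
  have "AE k in lborel. cv \<theta> (\<lambda>k. 1 * (\<i> * complex_of_real k * H k) + (- complex_of_real al) * H k) k
      = 1 * cv \<theta> (\<lambda>k. \<i> * complex_of_real k * H k) k + (- complex_of_real al) * cv \<theta> H k"
    by (rule cv_linear[OF bm(1) K H])
  moreover have "(\<lambda>k. 1 * (\<i> * complex_of_real k * H k) + (- complex_of_real al) * H k) = (\<lambda>k. \<i> * zt al k * H k)"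
    by (simp add: fun_eq_iff zt_def algebra_simps)
  ultimately have "AE k in lborel. cv \<theta> (\<lambda>k. \<i> * zt al k * H k) k
      = cv \<theta> (\<lambda>k. \<i> * complex_of_real k * H k) k - complex_of_real al * cv \<theta> H k" by simp
  with cv_product_rule[OF t H K]
  show ae: "AE k in lborel. \<i> * zt al k * cv \<theta> H k = cv \<theta>' H k + cv \<theta> (\<lambda>k. \<i> * zt al k * H k) k"
    by eventually_elim (simp add: zt_def algebra_simps)
  have L: "L2 (\<lambda>k. cv \<theta>' H k + cv \<theta> (\<lambda>k. \<i> * zt al k * H k) k)"
    by (intro L2_add L2_cv bm H H1)
  have [measurable]: "cv \<theta> H \<in> borel_measurable borel" using L2_cv[OF bm(1) H] by (rule L2_measurable)
  show "L2 (\<lambda>k. \<i> * zt al k * cv \<theta> H k)"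
    by (rule L2_cong_AE(1)[OF L]) (use ae in \<open>auto elim: eventually_mono\<close>)
qed

lemma cv_cmult:
  assumes "bdd_meas \<theta>" "L2 G"
  shows "AE k in lborel. cv \<theta> (\<lambda>k. a * G k) k = a * cv \<theta> G k"
  using cv_linear[OF assms assms(2), of a 0] by simp

text \<open>The product rule rewrites q' + 2 q \<partial> as 2 \<partial> q - q'. With the
  derivative outermost it can be absorbed by the symbol of B^-1.\<close>

lemma FTe_R_q:
  assumes e: "eps > 0" and t: "C1b \<theta> \<theta>'"
    and q: "\<And>x. q_c a b c (x / eps) = \<mu> * \<theta> x" and q': "\<And>x. deriv (q_c a b c) (x / eps) = \<mu> * eps * \<theta>' x"
    and h: "FTe al eps h H" and H1: "L2 (\<lambda>k. \<i> * zt al k * H k)"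
    and B: "bsym (\<lambda>k. Binv_sym b (eps * zt al k))"
  shows "FTe al eps (R_q a b c (eps * al) h)
    (\<lambda>k. (1/2) * (Binv_sym b (eps * zt al k) * (complex_of_real (\<mu> * eps) * (2 * (\<i> * zt al k * cv \<theta> H k) - cv \<theta>' H k))))"
proof -
  note bm = C1b_bdd_meas[OF t]
  note H = FTe_L2[OF h]
  note P = cv_product_zt[OF t H H1]
  have "FTe al eps (\<lambda>y. mulop (deriv (q_c a b c)) h y + 2 * mulop (q_c a b c) (multw (eps * al) dsym h) y)
     (\<lambda>k. complex_of_real (\<mu> * eps) * cv \<theta>' H k + 2 * (complex_of_real \<mu> * cv \<theta> (\<lambda>k. eps * (\<i> * zt al k * H k)) k))"
    by (intro FTe_add FTe_cmult FTe_mulop FTe_multw_dsym bm q q' h e H1)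
  then have F: "FTe al eps (\<lambda>y. mulop (deriv (q_c a b c)) h y + 2 * mulop (q_c a b c) (multw (eps * al) dsym h) y)
     (\<lambda>k. complex_of_real (\<mu> * eps) * (2 * (\<i> * zt al k * cv \<theta> H k) - cv \<theta>' H k))"
  proof (rule FTe_cong_AE)
    have "AE k in lborel. cv \<theta> (\<lambda>k. eps * (\<i> * zt al k * H k)) k = eps * cv \<theta> (\<lambda>k. \<i> * zt al k * H k) k"
      by (rule cv_cmult[OF bm(1) H1])
    with P(1) show "AE k in lborel. complex_of_real (\<mu> * eps) * cv \<theta>' H k + 2 * (complex_of_real \<mu> * cv \<theta> (\<lambda>k. eps * (\<i> * zt al k * H k)) k)
      = complex_of_real (\<mu> * eps) * (2 * (\<i> * zt al k * cv \<theta> H k) - cv \<theta>' H k)"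
    proof eventually_elim
      case (elim k)
      show ?case unfolding elim(2) elim(1) by (simp add: algebra_simps)
    qed
    show "(\<lambda>k. complex_of_real (\<mu> * eps) * (2 * (\<i> * zt al k * cv \<theta> H k) - cv \<theta>' H k)) \<in> borel_measurable borel"
      by (intro L2_measurable L2_cmult L2_diff P(2) L2_cv bm H)
  qed
  show ?thesis
    unfolding R_q_def by (intro FTe_cmult FTe_multw_bsym[OF e F B])
qed

text \<open>As for \<open>FTe_R_q\<close>, now with r \<partial> + 2 r' = \<partial> r + r'. The
  symbol of S^-1 stays to the right of the profile and is merged with the transform \<open>H\<close>
  into \<open>Hs\<close>.\<close>

lemma FTe_R_r:
  assumes e: "eps > 0" and t: "C1b \<theta> \<theta>'"
    and r: "\<And>x. r_c a b c (x / eps) = - c * \<mu> * \<theta> x" and r': "\<And>x. deriv (r_c a b c) (x / eps) = - c * \<mu> * eps * \<theta>' x"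
    and h: "FTe al eps h H" and H1: "L2 (\<lambda>k. \<i> * zt al k * H k)"
    and B: "bsym (\<lambda>k. Binv_sym b (eps * zt al k))" and S: "bsym (\<lambda>k. Sinv_sym a b (eps * zt al k))"
  defines "Hs \<equiv> \<lambda>k. Sinv_sym a b (eps * zt al k) * H k"
  shows "FTe al eps (R_r a b c (eps * al) h)
    (\<lambda>k. (1/2) * (Binv_sym b (eps * zt al k) * (complex_of_real (- c * \<mu> * eps) * (\<i> * zt al k * cv \<theta> Hs k + cv \<theta>' Hs k))))"
proof -
  note bm = C1b_bdd_meas[OF t]
  have s: "FTe al eps (multw (eps * al) (Sinv_sym a b) h) Hs"
    unfolding Hs_def by (rule FTe_multw_bsym[OF e h S])
  note H = FTe_L2[OF s]
  have H1s: "L2 (\<lambda>k. \<i> * zt al k * Hs k)"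
    using L2_bsym[OF S H1] by (simp add: Hs_def mult_ac)
  note P = cv_product_zt[OF t H H1s]
  let ?s = "multw (eps * al) (Sinv_sym a b) h"
  have "FTe al eps (\<lambda>y. mulop (r_c a b c) (multw (eps * al) dsym ?s) y + 2 * mulop (deriv (r_c a b c)) ?s y)
     (\<lambda>k. complex_of_real (- c * \<mu>) * cv \<theta> (\<lambda>k. eps * (\<i> * zt al k * Hs k)) k + 2 * (complex_of_real (- c * \<mu> * eps) * cv \<theta>' Hs k))"
    by (intro FTe_add FTe_cmult FTe_mulop FTe_multw_dsym bm r r' s e H1s)
  then have F: "FTe al eps (\<lambda>y. mulop (r_c a b c) (multw (eps * al) dsym ?s) y + 2 * mulop (deriv (r_c a b c)) ?s y)
     (\<lambda>k. complex_of_real (- c * \<mu> * eps) * (\<i> * zt al k * cv \<theta> Hs k + cv \<theta>' Hs k))"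
  proof (rule FTe_cong_AE)
    have "AE k in lborel. cv \<theta> (\<lambda>k. eps * (\<i> * zt al k * Hs k)) k = eps * cv \<theta> (\<lambda>k. \<i> * zt al k * Hs k) k"
      by (rule cv_cmult[OF bm(1) H1s])
    with P(1) show "AE k in lborel. complex_of_real (- c * \<mu>) * cv \<theta> (\<lambda>k. eps * (\<i> * zt al k * Hs k)) k + 2 * (complex_of_real (- c * \<mu> * eps) * cv \<theta>' Hs k)
      = complex_of_real (- c * \<mu> * eps) * (\<i> * zt al k * cv \<theta> Hs k + cv \<theta>' Hs k)"
    proof eventually_elim
      case (elim k)
      show ?case unfolding elim(2) elim(1) by (simp add: algebra_simps)
    qed
    show "(\<lambda>k. complex_of_real (- c * \<mu> * eps) * (\<i> * zt al k * cv \<theta> Hs k + cv \<theta>' Hs k)) \<in> borel_measurable borel"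
      by (intro L2_measurable L2_cmult L2_add P(2) L2_cv bm H)
  qed
  show ?thesis
    unfolding R_r_def Let_def by (intro FTe_cmult FTe_multw_bsym[OF e F B])
qed

text \<open>The Fourier side of \<open>R\<^sub>q \<plusminus> R\<^sub>r\<close> applied to a function with transform \<open>H\<close>; \<open>sg\<close> is the sign.\<close>
definition Rsym :: "real \<Rightarrow> real \<Rightarrow> real \<Rightarrow> real \<Rightarrow> real \<Rightarrow> real \<Rightarrow> real \<Rightarrow> (real \<Rightarrow> real) \<Rightarrow> (real \<Rightarrow> real)
    \<Rightarrow> (real \<Rightarrow> complex) \<Rightarrow> real \<Rightarrow> complex" where
  "Rsym a b c eps al \<mu> sg \<theta> \<theta>' H k =
     (let s = (\<lambda>k. Sinv_sym a b (eps * zt al k)) in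
     (1/2) * (Binv_sym b (eps * zt al k) * (complex_of_real (\<mu> * eps) *
       (2 * (\<i> * zt al k * cv \<theta> H k) - cv \<theta>' H k
        - complex_of_real (sg * c) * (\<i> * zt al k * cv \<theta> (\<lambda>k. s k * H k) k + cv \<theta>' (\<lambda>k. s k * H k) k)))))"

text \<open>Boundedness of i\<zeta> times each resolvent symbol places the range of the resolvents
  in the domain of \<partial>. This is asked for the given \<open>eps\<close> and \<open>lam\<close>
  only; the uniform estimates come later and separately.\<close>

lemma FTe_W_op:
  assumes e: "eps > 0" and t: "C1b \<theta> \<theta>'"
    and q: "\<And>x. q_c a b c (x / eps) = \<mu> * \<theta> x" and q': "\<And>x. deriv (q_c a b c) (x / eps) = \<mu> * eps * \<theta>' x"
    and r: "\<And>x. r_c a b c (x / eps) = - c * \<mu> * \<theta> x" and r': "\<And>x. deriv (r_c a b c) (x / eps) = - c * \<mu> * eps * \<theta>' x"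
    and g: "FTe al eps g G"
    and B: "bsym (\<lambda>k. Binv_sym b (eps * zt al k))" and S: "bsym (\<lambda>k. Sinv_sym a b (eps * zt al k))"
    and p: "bsym (\<lambda>k. 1 / (lam - Qp_sym a b c (eps * zt al k)))" "bsym (\<lambda>k. \<i> * zt al k * (1 / (lam - Qp_sym a b c (eps * zt al k))))"
    and m: "bsym (\<lambda>k. 1 / (lam - Qm_sym a b c (eps * zt al k)))" "bsym (\<lambda>k. \<i> * zt al k * (1 / (lam - Qm_sym a b c (eps * zt al k))))"
  shows "FTe al eps (W_op a b c (eps * al) lam g) (\<lambda>k. G k
     + Rsym a b c eps al \<mu> 1 \<theta> \<theta>' (\<lambda>k. 1 / (lam - Qp_sym a b c (eps * zt al k)) * G k) k
     + Rsym a b c eps al \<mu> (-1) \<theta> \<theta>' (\<lambda>k. 1 / (lam - Qm_sym a b c (eps * zt al k)) * G k) k)"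
proof -
  note G = FTe_L2[OF g]
  note hp = FTe_multw_bsym[OF e g, of "\<lambda>z. 1 / (lam - Qp_sym a b c z)", OF p(1)]
  note hm = FTe_multw_bsym[OF e g, of "\<lambda>z. 1 / (lam - Qm_sym a b c z)", OF m(1)]
  have hp1: "L2 (\<lambda>k. \<i> * zt al k * (1 / (lam - Qp_sym a b c (eps * zt al k)) * G k))"
    and hm1: "L2 (\<lambda>k. \<i> * zt al k * (1 / (lam - Qm_sym a b c (eps * zt al k)) * G k))"
    using L2_bsym[OF p(2) G] L2_bsym[OF m(2) G] by (simp_all only: mult.assoc)
  note F = FTe_add[OF FTe_add[OF g FTe_add[OF FTe_R_q[OF e t q q' hp hp1 B] FTe_R_r[OF e t r r' hp hp1 B S]]]
      FTe_diff[OF FTe_R_q[OF e t q q' hm hm1 B] FTe_R_r[OF e t r r' hm hm1 B S]]]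
  show ?thesis
    unfolding W_op_def Let_def
    by (rule back_subst[of "FTe al eps _", OF F])
      (simp add: fun_eq_iff Rsym_def Let_def algebra_simps)
qed

lemma FTe_W0_op:
  assumes t: "C1b (theta0 a b) \<theta>'"
    and g: "FTe al 1 g G"
    and m: "bsym (\<lambda>k. 1 / (Lam - \<i> * zt al k + complex_of_real (b - a) * (\<i> * zt al k) ^ 3))"
       "bsym (\<lambda>k. \<i> * zt al k * (1 / (Lam - \<i> * zt al k + complex_of_real (b - a) * (\<i> * zt al k) ^ 3)))"
  shows "FTe al 1 (W0_op a b al Lam g) (\<lambda>k. G k + 3 * (\<i> * zt al k * cv (theta0 a b)
     (\<lambda>k. 1 / (Lam - \<i> * zt al k + complex_of_real (b - a) * (\<i> * zt al k) ^ 3) * G k) k))"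
proof -
  note G = FTe_L2[OF g]
  let ?M = "\<lambda>z. 1 / (Lam - dsym z + complex_of_real (b - a) * (dsym z) ^ 3)"
  have h: "FTe al 1 (multw al ?M g) (\<lambda>k. 1 / (Lam - \<i> * zt al k + complex_of_real (b - a) * (\<i> * zt al k) ^ 3) * G k)"
    using FTe_multw_bsym[OF zero_less_one g, of ?M] m(1) by (simp add: dsym_def)
  have h1: "L2 (\<lambda>k. \<i> * zt al k * (1 / (Lam - \<i> * zt al k + complex_of_real (b - a) * (\<i> * zt al k) ^ 3) * G k))"
    using L2_bsym[OF m(2) G] by (simp only: mult.assoc)
  have th: "FTe al 1 (mulop (theta0 a b) (multw al ?M g))
     (\<lambda>k. cv (theta0 a b) (\<lambda>k. 1 / (Lam - \<i> * zt al k + complex_of_real (b - a) * (\<i> * zt al k) ^ 3) * G k) k)"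
    using FTe_mulop[OF C1b_bdd_meas(1)[OF t] h, of "theta0 a b" 1] by simp
  have d: "FTe al 1 (multw al dsym (mulop (theta0 a b) (multw al ?M g)))
     (\<lambda>k. \<i> * zt al k * cv (theta0 a b) (\<lambda>k. 1 / (Lam - \<i> * zt al k + complex_of_real (b - a) * (\<i> * zt al k) ^ 3) * G k) k)"
    using FTe_multw_dsym[OF zero_less_one th cv_product_zt(2)[OF t FTe_L2[OF h] h1]] by simp
  show ?thesis unfolding W0_op_def Let_def by (intro FTe_add FTe_cmult g d)
qed

section \<open>Operator bounds from symbol bounds\<close>

text \<open>Membership is bundled with the bound because the integral in \<open>L2norm\<close>
  defaults to 0 when the square is not integrable, so that a bound by itself would say
  nothing.\<close>

definition nb :: "(real \<Rightarrow> complex) \<Rightarrow> real \<Rightarrow> bool" where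
  "nb f a \<longleftrightarrow> L2 f \<and> L2norm f \<le> a"

lemma nb_L2: "nb f a \<Longrightarrow> L2 f" by (simp add: nb_def)

lemma nb_nonneg: "nb f a \<Longrightarrow> 0 \<le> a"
  using L2norm_nonneg[of f] unfolding nb_def by linarith

lemma nb_mono: "nb f a \<Longrightarrow> a \<le> b \<Longrightarrow> nb f b" by (simp add: nb_def)

lemma nb_add: "nb f a \<Longrightarrow> nb g b \<Longrightarrow> nb (\<lambda>k. f k + g k) (a + b)"
  using L2norm_add_le[of f g] by (auto simp: nb_def L2_add)

lemma nb_diff: "nb f a \<Longrightarrow> nb g b \<Longrightarrow> nb (\<lambda>k. f k - g k) (a + b)"
  using L2norm_diff_le[of f g] by (auto simp: nb_def L2_diff)

lemma nb_cmult: "nb f a \<Longrightarrow> cmod c \<le> W \<Longrightarrow> nb (\<lambda>k. c * f k) (W * a)"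
  by (auto simp: nb_def L2_cmult L2norm_cmult intro!: mult_mono intro: order_trans[OF norm_ge_zero])

lemma nb_mult:
  assumes "w \<in> borel_measurable borel" "\<And>k. cmod (w k) \<le> W" "nb f a"
  shows "nb (\<lambda>k. w k * f k) (W * a)"
proof -
  have W: "0 \<le> W" using order_trans[OF norm_ge_zero assms(2)[of 0]] .
  have f: "L2 f" "L2norm f \<le> a" using assms(3) by (auto simp: nb_def)
  show ?thesis
    using L2_bounded_mult[OF f(1) assms(1,2)] mult_left_mono[OF f(2) W] by (auto simp: nb_def)
qed

lemma nb_cv:
  assumes "bdd_meas \<theta>" "\<And>x. \<bar>\<theta> x\<bar> \<le> A" "nb H a"
  shows "nb (cv \<theta> H) (A * a)"
proof -
  have A: "0 \<le> A" using order_trans[OF abs_ge_zero assms(2)[of 0]] .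
  have H: "L2 H" "L2norm H \<le> a" using assms(3) by (auto simp: nb_def)
  show ?thesis
    using L2_cv[OF assms(1) H(1)] cv_bound[OF assms(1) H(1) assms(2)] mult_left_mono[OF H(2) A]
    by (auto simp: nb_def)
qed

lemma nb_cong_AE:
  assumes "nb f a" "AE k in lborel. f k = g k" "g \<in> borel_measurable borel"
  shows "nb g a"
  using L2_cong_AE[OF nb_L2[OF assms(1)] assms(2,3)] assms(1) by (simp add: nb_def)

lemma nb_izcv:
  assumes t: "C1b \<theta> \<theta>'" and A: "\<And>x. \<bar>\<theta> x\<bar> \<le> A" "\<And>x. \<bar>\<theta>' x\<bar> \<le> A'"
    and H: "nb H a" and H1: "nb (\<lambda>k. \<i> * zt al k * H k) a1"
  shows "nb (\<lambda>k. \<i> * zt al k * cv \<theta> H k) (A' * a + A * a1)"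
proof -
  note P = cv_product_zt[OF t nb_L2[OF H] nb_L2[OF H1]]
  have "nb (\<lambda>k. cv \<theta>' H k + cv \<theta> (\<lambda>k. \<i> * zt al k * H k) k) (A' * a + A * a1)"
    by (intro nb_add nb_cv C1b_bdd_meas[OF t] A H H1)
  moreover have "AE k in lborel. cv \<theta>' H k + cv \<theta> (\<lambda>k. \<i> * zt al k * H k) k = \<i> * zt al k * cv \<theta> H k"
    using P(1) by eventually_elim (rule sym)
  ultimately show ?thesis by (rule nb_cong_AE[OF _ _ L2_measurable[OF P(2)]])
qed

text \<open>The operators \<open>R\<^sub>q \<plusminus> R\<^sub>r\<close> carry a factor \<open>\<mu> \<epsilon> = O(\<epsilon>\<^sup>3)\<close>; since \<open>\<epsilon> \<partial> B\<^sup>-\<^sup>1\<close> is bounded, composing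
  with a symbol of size \<open>1/\<epsilon>\<close> leaves \<open>O(\<epsilon>)\<close>.\<close>
lemma nb_plus_part:
  fixes M eps \<kappa> c g :: real
  assumes M: "1 \<le> M" and e: "0 < eps" "eps \<le> 1"
    and t: "C1b \<theta> \<theta>'" and T: "\<And>x. \<bar>\<theta> x\<bar> \<le> M" "\<And>x. \<bar>\<theta>' x\<bar> \<le> M"
    and B: "(\<lambda>k. Binv_sym b (eps * zt al k)) \<in> borel_measurable borel"
       "\<And>k. cmod (Binv_sym b (eps * zt al k)) \<le> M" "\<And>k. eps * cmod (zt al k * Binv_sym b (eps * zt al k)) \<le> M"
    and S: "(\<lambda>k. Sinv_sym a b (eps * zt al k)) \<in> borel_measurable borel" "\<And>k. cmod (Sinv_sym a b (eps * zt al k)) \<le> M"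
    and p: "p \<in> borel_measurable borel" "\<And>k. eps * cmod (p k) \<le> M"
    and k: "\<bar>\<kappa>\<bar> \<le> M" "\<bar>c\<bar> \<le> M" and G: "nb G g"
  shows "nb (Rsym a b c eps al (\<kappa> * eps\<^sup>2) 1 \<theta> \<theta>' (\<lambda>k. p k * G k)) (4 * M ^ 6 * eps * g)"
proof -
  note bm = C1b_bdd_meas[OF t]
  note g0 = nb_nonneg[OF G]
  let ?s = "\<lambda>k. Sinv_sym a b (eps * zt al k)" and ?B = "\<lambda>k. Binv_sym b (eps * zt al k)"
  have pe: "cmod (p k) \<le> M / eps" for k using p(2)[of k] e by (simp add: field_simps)
  have Bz: "cmod (\<i> * zt al k * ?B k) \<le> M / eps" for k using B(3)[of k] e by (simp add: field_simps norm_mult)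
  have [measurable]: "(\<lambda>k. \<i> * zt al k * ?B k) \<in> borel_measurable borel" using B(1) by measurable
  have H: "nb (\<lambda>k. p k * G k) (M / eps * g)" by (rule nb_mult[OF p(1) pe G])
  have sH: "nb (\<lambda>k. ?s k * (p k * G k)) (M * (M / eps * g))" by (rule nb_mult[OF S H])
  have a1: "nb (\<lambda>k. (\<i> * zt al k * ?B k) * cv \<theta> (\<lambda>k. p k * G k) k) (M / eps * (M * (M / eps * g)))"
    by (intro nb_mult Bz nb_cv bm T H) measurable
  have a2: "nb (\<lambda>k. ?B k * cv \<theta>' (\<lambda>k. p k * G k) k) (M * (M * (M / eps * g)))"
    by (intro nb_mult B nb_cv bm T H)
  have a3: "nb (\<lambda>k. (\<i> * zt al k * ?B k) * cv \<theta> (\<lambda>k. ?s k * (p k * G k)) k) (M / eps * (M * (M * (M / eps * g))))"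
    by (intro nb_mult Bz nb_cv bm T sH) measurable
  have a4: "nb (\<lambda>k. ?B k * cv \<theta>' (\<lambda>k. ?s k * (p k * G k)) k) (M * (M * (M * (M / eps * g))))"
    by (intro nb_mult B nb_cv bm T sH)
  let ?bd = "2 * (M / eps * (M * (M / eps * g))) + M * (M * (M / eps * g))
    + M * (M / eps * (M * (M * (M / eps * g))) + M * (M * (M * (M / eps * g))))"
  have "nb (\<lambda>k. complex_of_real (\<kappa> * eps\<^sup>2 * eps / 2) *
      (2 * ((\<i> * zt al k * ?B k) * cv \<theta> (\<lambda>k. p k * G k) k) - ?B k * cv \<theta>' (\<lambda>k. p k * G k) k
       - complex_of_real c * ((\<i> * zt al k * ?B k) * cv \<theta> (\<lambda>k. ?s k * (p k * G k)) k + ?B k * cv \<theta>' (\<lambda>k. ?s k * (p k * G k)) k)))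
     ((M * eps ^ 3 / 2) * ?bd)"
  proof (intro nb_cmult nb_diff nb_add a1 a2 a3 a4)
    show "cmod (complex_of_real (\<kappa> * eps\<^sup>2 * eps / 2)) \<le> M * eps ^ 3 / 2"
      using k(1) e by (simp add: norm_mult abs_mult power2_eq_square power3_eq_cube)
    show "cmod (complex_of_real c) \<le> M" using k(2) by simp
  qed simp
  moreover have "(M * eps ^ 3 / 2) * ?bd \<le> 4 * M ^ 6 * eps * g"
  proof -
    have pw: "M ^ i \<le> M ^ 6" if "i \<le> 6" for i using M that by (rule power_increasing[rotated])
    \<comment> \<open>At most two factors 1/eps, one from the resolvent and one from \<partial>
      B^-1, stand against eps^3. A term carries at most six factors \<open>M\<close>, one for each
      of \<kappa>, c, the profile, S^-1, the resolvent and B^-1.\<close>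
    have "(M * eps ^ 3 / 2) * ?bd = (eps * g / 2) * (2 * M ^ 4 + M ^ 4 * eps + M ^ 6 + M ^ 6 * eps)"
      using e by (simp add: field_simps power2_eq_square power3_eq_cube eval_nat_numeral)
    also have "\<dots> \<le> (eps * g / 2) * (2 * M ^ 6 + M ^ 6 * 1 + M ^ 6 + M ^ 6 * 1)"
      using e g0 M by (intro mult_left_mono add_mono mult_mono pw) auto
    also have "\<dots> \<le> 4 * M ^ 6 * eps * g" using e g0 M by (simp add: mult_ac)
    finally show ?thesis .
  qed
  ultimately show ?thesis
    unfolding Rsym_def[abs_def] Let_def
    by (elim back_subst[of "\<lambda>f. nb f _", OF nb_mono]) (simp_all add: fun_eq_iff field_simps)
qed

text \<open>With \<open>d = 2m + c s m - 3m\<^sub>0\<close> and \<open>\<partial>\<close> for multiplication by \<open>i\<zeta>\<close>, the difference is the sum of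
  \<open>\<kappa> B \<partial> \<theta> d\<close>, \<open>\<kappa> B \<theta>' (c s - 1) m\<close>, \<open>3 B \<partial> (\<kappa> \<theta> - \<theta>\<^sub>0) m\<^sub>0\<close> and \<open>3 (B - 1) \<partial> \<theta>\<^sub>0 m\<^sub>0\<close>.
  In the first term \<open>\<partial>\<close> is commuted past \<open>\<theta>\<close> at low frequency and absorbed by \<open>B\<close>, at the cost of a factor
  \<open>1/eps\<close>, at high frequency; in the last one \<open>B - 1 = O(eps |\<zeta>|)\<close> and two derivatives fall on \<open>\<theta>\<^sub>0 m\<^sub>0\<close>.\<close>
lemma nb_minus_part:
  fixes M eps \<kappa> c g \<delta> :: real
  assumes M: "1 \<le> M" and e: "0 < eps" "eps \<le> 1" and d0: "0 \<le> \<delta>"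
    and t: "C1b \<theta> \<theta>'" and T: "\<And>x. \<bar>\<theta> x\<bar> \<le> M" "\<And>x. \<bar>\<theta>' x\<bar> \<le> M"
    and t0: "C1b \<theta>0 \<theta>0'" and T0: "\<And>x. \<bar>\<theta>0 x\<bar> \<le> M" "\<And>x. \<bar>\<theta>0' x\<bar> \<le> M"
    and t1: "C1b \<theta>0' \<theta>0''" and T1: "\<And>x. \<bar>\<theta>0'' x\<bar> \<le> M"
    and Td: "\<And>x. \<bar>\<kappa> * \<theta> x - \<theta>0 x\<bar> \<le> \<delta>" "\<And>x. \<bar>\<kappa> * \<theta>' x - \<theta>0' x\<bar> \<le> \<delta>"
    and B: "(\<lambda>k. Binv_sym b (eps * zt al k)) \<in> borel_measurable borel"
       "\<And>k. cmod (Binv_sym b (eps * zt al k)) \<le> M" "\<And>k. eps * cmod (zt al k * Binv_sym b (eps * zt al k)) \<le> M"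
       "\<And>k. cmod (Binv_sym b (eps * zt al k) - 1) \<le> M * eps * cmod (zt al k)"
    and S: "(\<lambda>k. Sinv_sym a b (eps * zt al k)) \<in> borel_measurable borel" "\<And>k. cmod (Sinv_sym a b (eps * zt al k)) \<le> M"
    and m: "bsym m" "bsym (\<lambda>k. \<i> * zt al k * m k)"
    and m0: "m0 \<in> borel_measurable borel" "\<And>k. cmod (m0 k) \<le> M" "\<And>k. cmod (zt al k * m0 k) \<le> M" "\<And>k. cmod ((zt al k)\<^sup>2 * m0 k) \<le> M"
    and k: "\<bar>\<kappa>\<bar> \<le> M" and al: "al > 0"
    and dlow: "\<And>k. \<bar>eps * k\<bar> \<le> 1 \<Longrightarrow> cmod (2 * m k + c * Sinv_sym a b (eps * zt al k) * m k - 3 * m0 k) \<le> \<delta>"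
      "\<And>k. \<bar>eps * k\<bar> \<le> 1 \<Longrightarrow> cmod (zt al k * (2 * m k + c * Sinv_sym a b (eps * zt al k) * m k - 3 * m0 k)) \<le> \<delta>"
    and dhigh: "\<And>k. \<bar>eps * k\<bar> > 1 \<Longrightarrow> cmod (2 * m k + c * Sinv_sym a b (eps * zt al k) * m k - 3 * m0 k) \<le> eps * \<delta>"
    and cs: "\<And>k. cmod ((c * Sinv_sym a b (eps * zt al k) - 1) * m k) \<le> \<delta>"
    and G: "nb G g"
  shows "nb (\<lambda>k. Rsym a b c eps al (\<kappa> * eps\<^sup>2) (-1) \<theta> \<theta>' (\<lambda>k. complex_of_real (2 / eps ^ 3) * m k * G k) k
     - 3 * (\<i> * zt al k * cv \<theta>0 (\<lambda>k. m0 k * G k) k)) (12 * M ^ 3 * (eps + \<delta>) * g)"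
proof -
  note bm = C1b_bdd_meas[OF t] C1b_bdd_meas[OF t0] C1b_bdd_meas[OF t1]
  note g0 = nb_nonneg[OF G]
  note G2 = nb_L2[OF G]
  let ?s = "\<lambda>k. Sinv_sym a b (eps * zt al k)" and ?B = "\<lambda>k. Binv_sym b (eps * zt al k)"
  let ?z = "\<lambda>k. \<i> * zt al k"
  define d where "d k = 2 * m k + c * ?s k * m k - 3 * m0 k" for k
  note [measurable] = B(1) S(1) m0(1)
  have [measurable]: "m \<in> borel_measurable borel" using m(1) by (simp add: bsym_def)
  have [measurable]: "d \<in> borel_measurable borel" unfolding d_def by measurable
  have Bz: "cmod (?z k * ?B k) \<le> M / eps" for k using B(3)[of k] e by (simp add: field_simps norm_mult)
  \<comment> \<open>A sharp cut-off suffices, since symbols enter only through measurability and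
    their supremum.\<close>
  define d1 where "d1 k = (if \<bar>eps * k\<bar> \<le> 1 then d k else 0)" for k
  define d2 where "d2 k = (if \<bar>eps * k\<bar> \<le> 1 then 0 else d k)" for k
  have [measurable]: "d1 \<in> borel_measurable borel" "d2 \<in> borel_measurable borel"
    unfolding d1_def d2_def by measurable
  have d12: "d k = d1 k + d2 k" for k by (simp add: d1_def d2_def)
  have b1: "cmod (d1 k) \<le> \<delta>" "cmod (?z k * d1 k) \<le> \<delta>" "cmod (d2 k) \<le> eps * \<delta>" for k
    using dlow[of k] dhigh[of k] d0 e by (auto simp: d1_def d2_def d_def norm_mult)
  have n1: "nb (\<lambda>k. d1 k * G k) (\<delta> * g)" by (rule nb_mult[OF _ b1(1) G]) measurable
  have n1z: "nb (\<lambda>k. ?z k * (d1 k * G k)) (\<delta> * g)"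
    unfolding mult.assoc[symmetric] by (rule nb_mult[OF _ b1(2) G]) measurable
  have n2: "nb (\<lambda>k. d2 k * G k) (eps * \<delta> * g)" by (rule nb_mult[OF _ b1(3) G]) measurable
  have T1a: "nb (\<lambda>k. (\<kappa> * ?B k) * (?z k * cv \<theta> (\<lambda>k. d1 k * G k) k)) (M * M * (M * (\<delta> * g) + M * (\<delta> * g)))"
  proof (rule nb_mult[OF _ _ nb_izcv[OF t T n1 n1z]])
    show "cmod (\<kappa> * ?B k) \<le> M * M" for k unfolding norm_mult using k B(2)[of k] M by (intro mult_mono) auto
  qed measurable
  have T1b: "nb (\<lambda>k. (\<kappa> * (?z k * ?B k)) * cv \<theta> (\<lambda>k. d2 k * G k) k) (M * (M / eps) * (M * (eps * \<delta> * g)))"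
  proof (rule nb_mult[OF _ _ nb_cv[OF bm(1) T(1) n2]])
    show "cmod (\<kappa> * (?z k * ?B k)) \<le> M * (M / eps)" for k
      unfolding norm_mult[of "complex_of_real \<kappa>"] using k Bz[of k] M by (intro mult_mono) auto
  qed measurable
  have T2: "nb (\<lambda>k. (\<kappa> * ?B k) * cv \<theta>' (\<lambda>k. ((c * ?s k - 1) * m k) * G k) k) (M * M * (M * (\<delta> * g)))"
  proof (rule nb_mult[OF _ _ nb_cv[OF bm(2) T(2) nb_mult[OF _ cs G]]])
    show "cmod (\<kappa> * ?B k) \<le> M * M" for k unfolding norm_mult using k B(2)[of k] M by (intro mult_mono) auto
  qed measurable
  have m0z: "cmod (?z k * m0 k) \<le> M" "cmod (?z k * (?z k * m0 k)) \<le> M" for k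
    using m0(3)[of k] m0(4)[of k] by (auto simp: norm_mult power2_eq_square norm_power mult_ac)
  have N0: "nb (\<lambda>k. m0 k * G k) (M * g)" by (rule nb_mult[OF m0(1,2) G])
  have N1: "nb (\<lambda>k. ?z k * (m0 k * G k)) (M * g)"
    unfolding mult.assoc[symmetric] by (rule nb_mult[OF _ m0z(1) G]) measurable
  have N2: "nb (\<lambda>k. ?z k * (?z k * (m0 k * G k))) (M * g)"
    using nb_mult[OF _ m0z(2) G] by (simp add: mult_ac)
  have td: "C1b (\<lambda>x. \<kappa> * \<theta> x - \<theta>0 x) (\<lambda>x. \<kappa> * \<theta>' x - \<theta>0' x)"
    unfolding C1b_def
  proof (intro conjI allI exI)
    show "((\<lambda>x. \<kappa> * \<theta> x - \<theta>0 x) has_real_derivative \<kappa> * \<theta>' x - \<theta>0' x) (at x)" for x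
      using t t0 by (auto simp: C1b_def intro!: DERIV_diff DERIV_cmult)
    show "continuous_on UNIV (\<lambda>x. \<kappa> * \<theta>' x - \<theta>0' x)"
      using t t0 by (auto simp: C1b_def intro!: continuous_intros)
  qed (use Td in auto)
  have T3: "nb (\<lambda>k. (3 * ?B k) * (?z k * cv (\<lambda>x. \<kappa> * \<theta> x - \<theta>0 x) (\<lambda>k. m0 k * G k) k)) (3 * M * (\<delta> * (M * g) + \<delta> * (M * g)))"
  proof (rule nb_mult[OF _ _ nb_izcv[OF td Td N0 N1]])
    show "cmod (3 * ?B k) \<le> 3 * M" for k using B(2)[of k] by (simp add: norm_mult)
  qed measurable
  \<comment> \<open>Two derivatives of a product with \<theta>0: the product rule is applied twice,
    which is where the second derivative of the limit profile and the bound on \<zeta>^2 m0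
    enter.\<close>
  have zz: "nb (\<lambda>k. ?z k * (?z k * cv \<theta>0 (\<lambda>k. m0 k * G k) k)) ((M * (M * g) + M * (M * g)) + (M * (M * g) + M * (M * g)))"
  proof (rule nb_cong_AE)
    show "nb (\<lambda>k. ?z k * cv \<theta>0' (\<lambda>k. m0 k * G k) k + ?z k * cv \<theta>0 (\<lambda>k. ?z k * (m0 k * G k)) k)
      ((M * (M * g) + M * (M * g)) + (M * (M * g) + M * (M * g)))"
      by (intro nb_add nb_izcv[OF t1 T0(2) T1 N0 N1] nb_izcv[OF t0 T0 N1 N2])
    show "AE k in lborel. ?z k * cv \<theta>0' (\<lambda>k. m0 k * G k) k + ?z k * cv \<theta>0 (\<lambda>k. ?z k * (m0 k * G k)) k
        = ?z k * (?z k * cv \<theta>0 (\<lambda>k. m0 k * G k) k)"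
      using cv_product_zt(1)[OF t0 nb_L2[OF N0] nb_L2[OF N1]]
      by eventually_elim (simp only: distrib_left)
    have "cv \<theta>0 (\<lambda>k. m0 k * G k) \<in> borel_measurable borel"
      by (intro L2_measurable L2_cv bm nb_L2[OF N0])
    then show "(\<lambda>k. ?z k * (?z k * cv \<theta>0 (\<lambda>k. m0 k * G k) k)) \<in> borel_measurable borel"
      by measurable
  qed
  \<comment> \<open>The positive weight keeps \<zeta> off the origin, so B - 1 may be divided by
    i\<zeta>; the quotient \<open>w\<close> is a bounded symbol of size
    \<open>M * eps\<close>.\<close>
  have z0: "zt al k \<noteq> 0" for k using al by (auto simp: zt_def complex_eq_iff)
  define w where "w k = (?B k - 1) / ?z k" for k
  have w: "cmod (w k) \<le> M * eps" for k
    using B(4)[of k] z0[of k] by (simp add: w_def norm_divide norm_mult field_simps)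
  have [measurable]: "w \<in> borel_measurable borel" unfolding w_def by measurable
  have "nb (\<lambda>k. (3 * w k) * (?z k * (?z k * cv \<theta>0 (\<lambda>k. m0 k * G k) k))) ((3 * (M * eps)) * ((M * (M * g) + M * (M * g)) + (M * (M * g) + M * (M * g))))"
    by (rule nb_mult[OF _ _ zz]) (use w in \<open>auto simp: norm_mult\<close>)
  moreover have "(3 * w k) * (?z k * (?z k * h)) = (3 * (?B k - 1)) * (?z k * h)" for k h
    using z0[of k] by (simp add: w_def)
  ultimately have T4: "nb (\<lambda>k. (3 * (?B k - 1)) * (?z k * cv \<theta>0 (\<lambda>k. m0 k * G k) k)) ((3 * (M * eps)) * ((M * (M * g) + M * (M * g)) + (M * (M * g) + M * (M * g))))"
    by simp
  let ?pm = "\<lambda>k. complex_of_real (2 / eps ^ 3) * m k * G k"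
  have "L2 (\<lambda>k. m k * G k)" by (rule L2_bsym[OF m(1) G2])
  from L2_cmult[OF this, of "complex_of_real (2 / eps ^ 3)"]
  have pm: "L2 ?pm" by (simp only: mult.assoc)
  have bS: "bsym ?s" using S by (auto simp: bsym_def)
  have spm: "L2 (\<lambda>k. ?s k * ?pm k)" by (rule L2_bsym[OF bS pm])
  have L0: "L2 (\<lambda>k. m0 k * G k)" by (rule nb_L2[OF N0])
  have L1: "L2 (\<lambda>k. d1 k * G k)" by (rule nb_L2[OF n1])
  have L2': "L2 (\<lambda>k. d2 k * G k)" by (rule nb_L2[OF n2])
  \<comment> \<open>This constant undoes the factor 2/eps^3 inside \<open>?pm\<close>. It is also
    what the prefactors eps^2, eps and 1/2 of \<open>Rsym\<close> multiply to, apart from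
    \<kappa>.\<close>
  define e3 where "e3 = complex_of_real (eps ^ 3 / 2)"
  have e3: "e3 * (complex_of_real (2 / eps ^ 3) * x) = x" for x
    using e by (simp add: e3_def)
  have L3: "L2 (\<lambda>k. 2 * e3 * ?pm k + (c * e3) * (?s k * ?pm k))"
    by (intro L2_add L2_cmult pm spm)
  have A1: "AE k in lborel. cv \<theta> (\<lambda>k. 1 * (2 * e3 * ?pm k + (c * e3) * (?s k * ?pm k)) + (-3) * (m0 k * G k)) k
     = 1 * cv \<theta> (\<lambda>k. 2 * e3 * ?pm k + (c * e3) * (?s k * ?pm k)) k + (-3) * cv \<theta> (\<lambda>k. m0 k * G k) k"
    by (rule cv_linear[OF bm(1) L3 L0])
  have A2: "AE k in lborel. cv \<theta> (\<lambda>k. 2 * e3 * ?pm k + (c * e3) * (?s k * ?pm k)) k = 2 * e3 * cv \<theta> ?pm k + (c * e3) * cv \<theta> (\<lambda>k. ?s k * ?pm k) k"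
    by (rule cv_linear[OF bm(1) pm spm])
  have A3: "AE k in lborel. cv \<theta> (\<lambda>k. 1 * (d1 k * G k) + 1 * (d2 k * G k)) k = 1 * cv \<theta> (\<lambda>k. d1 k * G k) k + 1 * cv \<theta> (\<lambda>k. d2 k * G k) k"
    by (rule cv_linear[OF bm(1) L1 L2'])
  \<comment> \<open>Both groupings are the single function \<open>d k * G k\<close>. Passing
    \<open>cv \<theta>\<close> through each of them yields the identity \<open>D\<close>, which
    compares the frequency-split form with the one produced by \<open>Rsym\<close>.\<close>
  have E1: "(\<lambda>k. 1 * (2 * e3 * ?pm k + (c * e3) * (?s k * ?pm k)) + (-3) * (m0 k * G k)) = (\<lambda>k. 1 * (d1 k * G k) + 1 * (d2 k * G k))"
  proof
    fix k
    have "1 * (d1 k * G k) + 1 * (d2 k * G k) = d k * G k" by (simp add: d12 distrib_right)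
    moreover have "2 * e3 * (q * m k * G k) + (c * e3) * (?s k * (q * m k * G k)) = (e3 * q) * (2 * m k + c * ?s k * m k) * G k" for q
      by (simp add: algebra_simps)
    then have "2 * e3 * ?pm k + (c * e3) * (?s k * ?pm k) = (e3 * (complex_of_real (2 / eps ^ 3) * 1)) * (2 * m k + c * ?s k * m k) * G k"
      by (simp only: mult_1_right)
    then have "1 * (2 * e3 * ?pm k + (c * e3) * (?s k * ?pm k)) + (-3) * (m0 k * G k) = d k * G k"
      unfolding e3 d_def by (simp add: algebra_simps)
    ultimately show "1 * (2 * e3 * ?pm k + (c * e3) * (?s k * ?pm k)) + (-3) * (m0 k * G k) = 1 * (d1 k * G k) + 1 * (d2 k * G k)" by simp
  qed
  have A4: "AE k in lborel. cv \<theta>' (\<lambda>k. (c * e3) * (?s k * ?pm k) + (- e3) * ?pm k) k = (c * e3) * cv \<theta>' (\<lambda>k. ?s k * ?pm k) k + (- e3) * cv \<theta>' ?pm k"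
    by (rule cv_linear[OF bm(2) spm pm])
  have E4: "(\<lambda>k. (c * e3) * (?s k * ?pm k) + (- e3) * ?pm k) = (\<lambda>k. ((c * ?s k - 1) * m k) * G k)"
  proof
    fix k
    have "(c * e3) * (?s k * (q * m k * G k)) + (- e3) * (q * m k * G k) = (e3 * q) * ((c * ?s k - 1) * m k) * G k" for q
      by (simp add: algebra_simps)
    then have "(c * e3) * (?s k * ?pm k) + (- e3) * ?pm k = (e3 * (complex_of_real (2 / eps ^ 3) * 1)) * ((c * ?s k - 1) * m k) * G k"
      by (simp only: mult_1_right)
    also have "\<dots> = ((c * ?s k - 1) * m k) * G k" unfolding e3 by simp
    finally show "(c * e3) * (?s k * ?pm k) + (- e3) * ?pm k = ((c * ?s k - 1) * m k) * G k" .
  qed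
  have A5: "AE k in lborel. cv (\<lambda>x. \<kappa> * \<theta> x - \<theta>0 x) (\<lambda>k. m0 k * G k) k = \<kappa> * cv \<theta> (\<lambda>k. m0 k * G k) k - cv \<theta>0 (\<lambda>k. m0 k * G k) k"
    by (rule cv_diff_fun[OF bm(1) bm(3) L0])
  note N = nb_add[OF nb_add[OF nb_add[OF nb_add[OF T1a T1b] T2] T3] T4]
  have nbt: "nb (\<lambda>k. Rsym a b c eps al (\<kappa> * eps\<^sup>2) (-1) \<theta> \<theta>' ?pm k - 3 * (?z k * cv \<theta>0 (\<lambda>k. m0 k * G k) k))
    (M * M * (M * (\<delta> * g) + M * (\<delta> * g)) + M * (M / eps) * (M * (eps * \<delta> * g)) + M * M * (M * (\<delta> * g))
     + 3 * M * (\<delta> * (M * g) + \<delta> * (M * g)) + (3 * (M * eps)) * ((M * (M * g) + M * (M * g)) + (M * (M * g) + M * (M * g))))"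
  proof (rule nb_cong_AE[OF N])
    show "AE k in lborel. (\<kappa> * ?B k) * (?z k * cv \<theta> (\<lambda>k. d1 k * G k) k) + (\<kappa> * (?z k * ?B k)) * cv \<theta> (\<lambda>k. d2 k * G k) k
        + (\<kappa> * ?B k) * cv \<theta>' (\<lambda>k. ((c * ?s k - 1) * m k) * G k) k
        + (3 * ?B k) * (?z k * cv (\<lambda>x. \<kappa> * \<theta> x - \<theta>0 x) (\<lambda>k. m0 k * G k) k)
        + (3 * (?B k - 1)) * (?z k * cv \<theta>0 (\<lambda>k. m0 k * G k) k)
        = Rsym a b c eps al (\<kappa> * eps\<^sup>2) (-1) \<theta> \<theta>' ?pm k - 3 * (?z k * cv \<theta>0 (\<lambda>k. m0 k * G k) k)"
      using A1[unfolded E1] A2 A3 A4[unfolded E4] A5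
    proof eventually_elim
      case (elim k)
      have D: "cv \<theta> (\<lambda>k. d1 k * G k) k + cv \<theta> (\<lambda>k. d2 k * G k) k
        = 2 * e3 * cv \<theta> ?pm k + (c * e3) * cv \<theta> (\<lambda>k. ?s k * ?pm k) k - 3 * cv \<theta> (\<lambda>k. m0 k * G k) k"
        using elim(1,2,3) by simp
      have "(\<kappa> * ?B k) * (?z k * cv \<theta> (\<lambda>k. d1 k * G k) k) + (\<kappa> * (?z k * ?B k)) * cv \<theta> (\<lambda>k. d2 k * G k) k
         = (\<kappa> * ?B k) * ?z k * (cv \<theta> (\<lambda>k. d1 k * G k) k + cv \<theta> (\<lambda>k. d2 k * G k) k)"
        by (simp only: distrib_left mult_ac)
      then have X: "(\<kappa> * ?B k) * (?z k * cv \<theta> (\<lambda>k. d1 k * G k) k) + (\<kappa> * (?z k * ?B k)) * cv \<theta> (\<lambda>k. d2 k * G k) k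
         = (\<kappa> * ?B k) * ?z k * (2 * e3 * cv \<theta> ?pm k + (c * e3) * cv \<theta> (\<lambda>k. ?s k * ?pm k) k - 3 * cv \<theta> (\<lambda>k. m0 k * G k) k)"
        unfolding D .
      have R: "Rsym a b c eps al (\<kappa> * eps\<^sup>2) (-1) \<theta> \<theta>' ?pm k =
          \<kappa> * ?B k * e3 * (2 * (?z k * cv \<theta> ?pm k) - cv \<theta>' ?pm k + c * (?z k * cv \<theta> (\<lambda>k. ?s k * ?pm k) k + cv \<theta>' (\<lambda>k. ?s k * ?pm k) k))"
        unfolding Rsym_def Let_def e3_def by (simp add: power2_eq_square power3_eq_cube mult_ac)
      show ?case
        unfolding X R elim(4) elim(5) by (simp add: algebra_simps)
    qed
    have "L2 (\<lambda>k. ?z k * ?pm k)"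
      using L2_cmult[OF L2_bsym[OF m(2) G2], of "complex_of_real (2 / eps ^ 3)"] by (simp add: mult_ac)
    have "cv \<theta> ?pm \<in> borel_measurable borel" "cv \<theta>' ?pm \<in> borel_measurable borel"
      "cv \<theta> (\<lambda>k. ?s k * ?pm k) \<in> borel_measurable borel" "cv \<theta>' (\<lambda>k. ?s k * ?pm k) \<in> borel_measurable borel"
      "cv \<theta>0 (\<lambda>k. m0 k * G k) \<in> borel_measurable borel"
      by (intro L2_measurable L2_cv bm pm spm L0)+
    then show "(\<lambda>k. Rsym a b c eps al (\<kappa> * eps\<^sup>2) (-1) \<theta> \<theta>' ?pm k - 3 * (?z k * cv \<theta>0 (\<lambda>k. m0 k * G k) k)) \<in> borel_measurable borel"
      unfolding Rsym_def Let_def by measurable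
  qed
  show ?thesis
  proof (rule nb_mono[OF nbt])
    have pw: "M * M \<le> M ^ 3" using M power_increasing[of 2 3 M] by (simp add: power2_eq_square)
    have "M * M * (M * (\<delta> * g) + M * (\<delta> * g)) + M * (M / eps) * (M * (eps * \<delta> * g)) + M * M * (M * (\<delta> * g))
       = 4 * M ^ 3 * (\<delta> * g)" using e by (simp add: power3_eq_cube algebra_simps)
    moreover have "3 * M * (\<delta> * (M * g) + \<delta> * (M * g)) = 6 * ((M * M) * (\<delta> * g))" by (simp add: algebra_simps)
    moreover have "(M * M) * (\<delta> * g) \<le> M ^ 3 * (\<delta> * g)" using pw d0 g0 by (intro mult_right_mono) auto
    moreover have "(3 * (M * eps)) * ((M * (M * g) + M * (M * g)) + (M * (M * g) + M * (M * g))) = 12 * M ^ 3 * (eps * g)"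
      by (simp add: power3_eq_cube algebra_simps)
    moreover have "0 \<le> M ^ 3 * (\<delta> * g)" using M d0 g0 by simp
    moreover have "12 * M ^ 3 * (eps + \<delta>) * g = 12 * M ^ 3 * (eps * g) + 12 * (M ^ 3 * (\<delta> * g))" by (simp add: algebra_simps)
    ultimately show "M * M * (M * (\<delta> * g) + M * (\<delta> * g)) + M * (M / eps) * (M * (eps * \<delta> * g)) + M * M * (M * (\<delta> * g))
     + 3 * M * (\<delta> * (M * g) + \<delta> * (M * g)) + (3 * (M * eps)) * ((M * (M * g) + M * (M * g)) + (M * (M * g) + M * (M * g)))
     \<le> 12 * M ^ 3 * (eps + \<delta>) * g" by linarith
  qed
qed

section \<open>Symbol estimates\<close>

text \<open>Here \<open>al\<close> is the weight before rescaling. The bound \<open>bal\<close>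
  keeps the real part of 1 + b \<xi>^2 above 3/4 on the whole shifted line, so that B^-1 has no pole
  there.\<close>

locale symb =
  fixes a b al :: real
  assumes a: "0 < a" and ab: "a < b" and al: "0 < al" and bal: "b * al\<^sup>2 \<le> 1/4"
begin

definition xi :: "real \<Rightarrow> complex" where "xi w = complex_of_real w + \<i> * complex_of_real al"

definition v :: "real \<Rightarrow> complex" where "v w = 1 + complex_of_real b * (xi w)\<^sup>2"
definition u :: "real \<Rightarrow> complex" where "u w = 1 + complex_of_real a * (xi w)\<^sup>2"

abbreviation "B w \<equiv> Binv_sym b (xi w)"
abbreviation "S w \<equiv> S_sym a b (xi w)"

lemma b: "0 < b" using a ab by simp

lemma bw: "0 \<le> b * w\<^sup>2" using b by simp

lemma v_Re: "Re (v w) = 1 + b * (w\<^sup>2 - al\<^sup>2)" and v_Im: "Im (v w) = 2 * b * w * al"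
  by (simp_all add: v_def xi_def power2_eq_square algebra_simps)

lemma u_Re: "Re (u w) = 1 + a * (w\<^sup>2 - al\<^sup>2)" and u_Im: "Im (u w) = 2 * a * w * al"
  by (simp_all add: u_def xi_def power2_eq_square algebra_simps)

lemma xi_norm: "(cmod (xi w))\<^sup>2 = w\<^sup>2 + al\<^sup>2"
  by (simp add: xi_def cmod_def)

lemma v_Re_ge: "Re (v w) \<ge> 3/4 + b * w\<^sup>2"
  using bal by (simp add: v_Re algebra_simps)

lemma v_norm_ge: "cmod (v w) \<ge> 3/4 + b * w\<^sup>2"
  using v_Re_ge[of w] complex_Re_le_cmod[of "v w"] by linarith

lemma v_nz: "v w \<noteq> 0"
proof
  assume "v w = 0"
  with v_norm_ge[of w] bw[of w] show False by simp
qed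

lemma B_eq: "B w = 1 / v w" by (simp add: Binv_sym_def v_def)

lemma B_norm: "cmod (B w) \<le> 2"
proof -
  have "1/2 \<le> cmod (v w)" using v_norm_ge[of w] bw[of w] by linarith
  moreover then have "0 < cmod (v w)" by linarith
  ultimately show ?thesis unfolding B_eq by (simp add: norm_divide field_simps)
qed

lemma B_xi2: "b * (cmod (xi w))\<^sup>2 * cmod (B w) \<le> 1"
proof -
  have "b * (cmod (xi w))\<^sup>2 \<le> cmod (v w)"
    using v_norm_ge[of w] bal by (simp add: xi_norm algebra_simps)
  then show ?thesis using v_nz[of w] unfolding B_eq by (simp add: norm_divide field_simps)
qed

lemma B_minus_1: "B w - 1 = - (complex_of_real b * (xi w)\<^sup>2 * B w)"
proof -
  have e: "complex_of_real b * (xi w)\<^sup>2 = v w - 1" by (simp add: v_def)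
  show ?thesis unfolding B_eq e using v_nz[of w] by (simp add: field_simps)
qed

lemma B1_quad: "cmod (B w - 1) \<le> 2 * b * (cmod (xi w))\<^sup>2"
proof -
  have "cmod (B w - 1) = b * (cmod (xi w))\<^sup>2 * cmod (B w)"
    using b by (simp add: B_minus_1 norm_mult norm_power)
  also have "\<dots> \<le> b * (cmod (xi w))\<^sup>2 * 2" using b by (intro mult_left_mono B_norm) auto
  finally show ?thesis by simp
qed

lemma xi_B: "cmod (xi w) * cmod (B w) \<le> 2 / sqrt b"
proof -
  have "(sqrt b * (cmod (xi w) * cmod (B w)))\<^sup>2 = (b * (cmod (xi w))\<^sup>2 * cmod (B w)) * cmod (B w)"
    using b by (simp add: power_mult_distrib power2_eq_square)
  also have "\<dots> \<le> 1 * 2" by (intro mult_mono B_xi2 B_norm) auto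
  also have "\<dots> \<le> 2\<^sup>2" by simp
  finally have "sqrt b * (cmod (xi w) * cmod (B w)) \<le> 2" by (rule power2_le_imp_le) simp
  then show ?thesis using b by (simp add: field_simps)
qed

lemma B1_lin: "cmod (B w - 1) \<le> 2 * sqrt b * cmod (xi w)"
proof -
  have "cmod (B w - 1) = b * cmod (xi w) * (cmod (xi w) * cmod (B w))"
    using b by (simp add: B_minus_1 norm_mult norm_power power2_eq_square)
  also have "\<dots> \<le> b * cmod (xi w) * (2 / sqrt b)" using b by (intro mult_left_mono xi_B) auto
  also have "\<dots> = 2 * (b / sqrt b) * cmod (xi w)" by simp
  also have "b / sqrt b = sqrt b" using b by (simp add: real_div_sqrt)
  finally show ?thesis .
qed

lemma S2: "(S w)\<^sup>2 = u w / v w"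
  by (simp add: S_sym_def u_def v_def)

text \<open>Partial fractions: S^2 is a convex combination of 1 and the symbol of B^-1. Hence Re B >
  0 already keeps S^2 in the right half-plane, away from the branch cut, and 1 - S^2 is a multiple
  of 1 - B.\<close>

lemma S2_B: "(S w)\<^sup>2 = complex_of_real (a / b) + complex_of_real (1 - a / b) * B w"
  using v_nz[of w] b unfolding S2 B_eq
  by (simp add: divide_simps) (simp add: u_def v_def algebra_simps)

lemma tau: "0 < a / b" "a / b < 1" using a ab by auto

lemma B_Re: "Re (B w) = Re (v w) / (cmod (v w))\<^sup>2" and B_Im: "Im (B w) = - Im (v w) / (cmod (v w))\<^sup>2"
  unfolding B_eq by (simp_all add: Re_divide Im_divide cmod_power2)

lemma B_Re_pos: "0 < Re (B w)"
proof -
  have "Re (v w) > 0" using v_Re_ge[of w] bw[of w] by linarith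
  then show ?thesis using v_nz[of w] unfolding B_Re by (intro divide_pos_pos) auto
qed

lemma S2_Re: "Re ((S w)\<^sup>2) = a / b + (1 - a / b) * Re (B w)" and S2_Im: "Im ((S w)\<^sup>2) = (1 - a / b) * Im (B w)"
  unfolding S2_B by (simp_all del: of_real_divide of_real_diff)

lemma S2_Re_ge: "Re ((S w)\<^sup>2) \<ge> a / b"
  using tau B_Re_pos[of w] unfolding S2_Re by simp

lemma S_Re_sq: "(Re (S w))\<^sup>2 = Re ((S w)\<^sup>2) + (Im (S w))\<^sup>2"
  by (simp add: power2_eq_square)

lemma S_Re_ge: "Re (S w) \<ge> sqrt (a / b)"
proof -
  have "Re (S w) \<ge> 0" unfolding S_sym_def using csqrt_principal by (metis less_eq_real_def)
  moreover have "a / b \<le> (Re (S w))\<^sup>2"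
    using S2_Re_ge[of w] zero_le_power2[of "Im (S w)"] unfolding S_Re_sq by linarith
  ultimately show ?thesis by (intro real_le_lsqrt)
qed

lemma S_Re_pos: "Re (S w) > 0"
proof -
  have "0 < sqrt (a / b)" using tau(1) by (subst real_sqrt_gt_0_iff)
  then show ?thesis using S_Re_ge[of w] by linarith
qed

lemma S_norm_ge: "cmod (S w) \<ge> sqrt (a / b)"
  using S_Re_ge[of w] complex_Re_le_cmod[of "S w"] by linarith

lemma S_nz: "S w \<noteq> 0" using S_Re_pos[of w] by auto

lemma Sinv_norm: "cmod (Sinv_sym a b (xi w)) \<le> sqrt (b / a)"
proof -
  have "1 / cmod (S w) \<le> 1 / sqrt (a / b)"
    using S_norm_ge[of w] tau by (intro divide_left_mono mult_pos_pos) (auto simp: S_nz)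
  then show ?thesis by (simp add: Sinv_sym_def norm_divide real_sqrt_divide)
qed

lemma S1_ge: "1 \<le> cmod (1 + S w)"
  using complex_Re_le_cmod[of "1 + S w"] S_Re_pos[of w] by simp

lemma S1_nz: "1 + S w \<noteq> 0" using S1_ge[of w] by auto

lemma one_minus_S: "1 - S w = complex_of_real (1 - a / b) * (1 - B w) / (1 + S w)"
proof -
  have "(1 - S w) * (1 + S w) = 1 - (S w)\<^sup>2" by (simp add: power2_eq_square algebra_simps)
  also have "\<dots> = complex_of_real (1 - a / b) * (1 - B w)" unfolding S2_B by (simp add: algebra_simps)
  finally show ?thesis using S1_nz[of w] by (simp add: field_simps)
qed

lemma one_minus_S_norm: "cmod (1 - S w) \<le> cmod (B w - 1)"
proof -
  have "cmod (1 - S w) = (1 - a / b) * cmod (B w - 1) / cmod (1 + S w)"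
    unfolding one_minus_S norm_divide norm_mult norm_of_real norm_minus_commute[of 1 "B w"] using tau by simp
  also have "\<dots> \<le> 1 * cmod (B w - 1) / 1"
    using tau S1_ge[of w] by (intro frac_le mult_right_mono) auto
  finally show ?thesis by simp
qed

lemma Sinv_minus_1: "cmod (Sinv_sym a b (xi w) - 1) \<le> sqrt (b / a) * (2 * b * (cmod (xi w))\<^sup>2)"
proof -
  have "Sinv_sym a b (xi w) - 1 = Sinv_sym a b (xi w) * (1 - S w)"
    using S_nz[of w] by (simp add: Sinv_sym_def field_simps)
  then have "cmod (Sinv_sym a b (xi w) - 1) = cmod (Sinv_sym a b (xi w)) * cmod (1 - S w)" by (simp add: norm_mult)
  also have "\<dots> \<le> sqrt (b / a) * (2 * b * (cmod (xi w))\<^sup>2)"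
    using a b by (intro mult_mono Sinv_norm order_trans[OF one_minus_S_norm B1_quad]) auto
  finally show ?thesis .
qed

text \<open>Twice Re S Im S is the imaginary part of S^2, which is rational in w. The sign of w Im S
  follows from Re S > 0, without evaluating the square root.\<close>

lemma S_ReIm: "Re (S w) * (w * Im (S w)) = - ((1 - a / b) * (b * w\<^sup>2 * al) / (cmod (v w))\<^sup>2)"
proof -
  have "2 * (Re (S w) * Im (S w)) = Im ((S w)\<^sup>2)" by (simp add: power2_eq_square)
  also have "\<dots> = - ((1 - a / b) * (2 * b * w * al) / (cmod (v w))\<^sup>2)" unfolding S2_Im B_Im v_Im by simp
  also have "(1 - a / b) * (2 * b * w * al) / (cmod (v w))\<^sup>2 = 2 * ((1 - a / b) * (b * w * al) / (cmod (v w))\<^sup>2)"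
    by simp
  finally have "Re (S w) * Im (S w) = - ((1 - a / b) * (b * w * al) / (cmod (v w))\<^sup>2)" by linarith
  then have "w * (Re (S w) * Im (S w)) = w * - ((1 - a / b) * (b * w * al) / (cmod (v w))\<^sup>2)" by simp
  then show ?thesis by (simp add: power2_eq_square mult_ac)
qed

lemma wImS_le: "w * Im (S w) \<le> 0"
proof -
  have "Re (S w) * (w * Im (S w)) \<le> 0" unfolding S_ReIm using tau b al by simp
  then show ?thesis using S_Re_pos[of w] by (simp add: mult_le_0_iff)
qed

lemma Im_xiS: "Im (xi w * S w) = w * Im (S w) + al * Re (S w)"
  by (simp add: xi_def)

text \<open>Multiplied by Re S > 0 the quantity becomes explicit apart from (Re S)^2, which is at
  least Re (S^2). The terms b w^2 then cancel and leave 1 - b al^2 > 0. This sign is why S cannot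
  lower the real part of \<lambda> - Q+.\<close>

lemma Im_xiS_ge: "Im (xi w * S w) \<ge> 0"
proof -
  have "0 \<le> al * (a / b + (1 - a / b) * ((1 - b * al\<^sup>2) / (cmod (v w))\<^sup>2))"
    using tau al bal a b by (intro mult_nonneg_nonneg add_nonneg_nonneg divide_nonneg_nonneg) auto
  also have "\<dots> = al * (a / b + (1 - a / b) * ((Re (v w) - b * w\<^sup>2) / (cmod (v w))\<^sup>2))"
    by (simp add: v_Re algebra_simps)
  also have "\<dots> = al * Re ((S w)\<^sup>2) - (1 - a / b) * (b * w\<^sup>2 * al) / (cmod (v w))\<^sup>2"
    unfolding S2_Re B_Re by (simp add: diff_divide_distrib algebra_simps)
  also have "\<dots> \<le> al * (Re (S w))\<^sup>2 - (1 - a / b) * (b * w\<^sup>2 * al) / (cmod (v w))\<^sup>2"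
    unfolding S_Re_sq using al by simp
  also have "\<dots> = Re (S w) * Im (xi w * S w)"
    unfolding Im_xiS distrib_left S_ReIm by (simp add: power2_eq_square mult_ac)
  finally show ?thesis using S_Re_pos[of w] by (simp add: zero_le_mult_iff)
qed

text \<open>\<open>Re S \<le> |S|\<close> and \<open>2 |S| \<le> 1 + |S|\<^sup>2\<close>, \<open>2 |S|\<^sup>2 \<le> 1 + |S|\<^sup>4\<close> reduce the claim to the polynomial \<open>|v|\<^sup>2 - |u|\<^sup>2\<close>.\<close>
lemma one_minus_ReS:
  "1 - Re (S w) \<ge> (b - a) * w\<^sup>2 / (8 * (1 + b * w\<^sup>2)) - (b - a) * al\<^sup>2 / (2 * (1 - b * al\<^sup>2)\<^sup>2)"
proof -
  define V where "V = (cmod (v w))\<^sup>2"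
  define U where "U = (cmod (u w))\<^sup>2"
  have V0: "V > 0" unfolding V_def using v_nz[of w] by simp
  have VU: "V - U = 2 * (b - a) * (w\<^sup>2 - al\<^sup>2) + (b\<^sup>2 - a\<^sup>2) * (w\<^sup>2 + al\<^sup>2)\<^sup>2"
    unfolding V_def U_def cmod_power2 v_Re v_Im u_Re u_Im by (simp add: power2_eq_square algebra_simps)
  note bw = bw[of w]
  have Vle: "V \<le> 2 * (1 + b * w\<^sup>2)\<^sup>2"
  proof -
    have "cmod (v w) \<le> 1 + b * (cmod (xi w))\<^sup>2"
      unfolding v_def using b by (intro order_trans[OF norm_triangle_ineq]) (simp add: norm_mult norm_power)
    also have "\<dots> \<le> (5/4) * (1 + b * w\<^sup>2)" using bal bw by (simp add: xi_norm algebra_simps)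
    finally have "V \<le> ((5/4) * (1 + b * w\<^sup>2))\<^sup>2" unfolding V_def by (intro power_mono) auto
    also have "\<dots> = (25/16) * (1 + b * w\<^sup>2)\<^sup>2" proof -
      have "((5/4) * X)\<^sup>2 = (25/16) * X\<^sup>2" for X :: real by (simp add: power2_eq_square)
      then show ?thesis .
    qed
    also have "\<dots> \<le> 2 * (1 + b * w\<^sup>2)\<^sup>2" by (intro mult_right_mono) auto
    finally show ?thesis .
  qed
  have Vge: "(1 - b * al\<^sup>2)\<^sup>2 \<le> V"
  proof -
    have "1 - b * al\<^sup>2 \<le> cmod (v w)"
      using complex_Re_le_cmod[of "v w"] bw unfolding v_Re by (simp add: algebra_simps)
    then show ?thesis unfolding V_def using bal by (intro power_mono) auto
  qed
  have s1: "1 - Re (S w) \<ge> (1 - (cmod (S w))\<^sup>2) / 2"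
  proof -
    have "0 \<le> (cmod (S w) - 1)\<^sup>2" by simp
    then have "cmod (S w) \<le> (1 + (cmod (S w))\<^sup>2) / 2" by (simp add: power2_eq_square algebra_simps)
    then show ?thesis using complex_Re_le_cmod[of "S w"] by (simp add: field_simps)
  qed
  have s2: "(cmod (S w))\<^sup>2 \<le> (1 + U / V) / 2"
  proof -
    have e: "(cmod (S w))\<^sup>2 = cmod (u w) / cmod (v w)"
      by (simp add: S2 norm_divide flip: norm_power)
    have "0 \<le> (cmod (u w) / cmod (v w) - 1)\<^sup>2" by simp
    moreover have "U / V = (cmod (u w) / cmod (v w))\<^sup>2" unfolding U_def V_def by (simp add: power_divide)
    ultimately show ?thesis unfolding e by (simp add: power2_eq_square algebra_simps)
  qed
  have "1 - Re (S w) \<ge> (1 - U / V) / 4" using s1 s2 by (simp add: field_simps)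
  also have "(1 - U / V) / 4 = (V - U) / (4 * V)" using V0 by (simp add: field_simps)
  also have "\<dots> \<ge> ((b - a) * (2 * w\<^sup>2 + (a + b) * (w\<^sup>2)\<^sup>2) - 2 * (b - a) * al\<^sup>2) / (4 * V)"
  proof (rule divide_right_mono)
    have "(w\<^sup>2)\<^sup>2 \<le> (w\<^sup>2 + al\<^sup>2)\<^sup>2" by (intro power_mono) auto
    then have "(b\<^sup>2 - a\<^sup>2) * (w\<^sup>2)\<^sup>2 \<le> (b\<^sup>2 - a\<^sup>2) * (w\<^sup>2 + al\<^sup>2)\<^sup>2"
      using a ab by (intro mult_left_mono) (auto simp: power2_eq_square intro: mult_mono)
    moreover have "(b - a) * ((a + b) * (w\<^sup>2)\<^sup>2) = (b\<^sup>2 - a\<^sup>2) * (w\<^sup>2)\<^sup>2" by (simp add: power2_eq_square algebra_simps)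
    ultimately show "(b - a) * (2 * w\<^sup>2 + (a + b) * (w\<^sup>2)\<^sup>2) - 2 * (b - a) * al\<^sup>2 \<le> V - U"
      unfolding VU by (simp add: algebra_simps)
  qed (use V0 in simp)
  also (xtrans) have "((b - a) * (2 * w\<^sup>2 + (a + b) * (w\<^sup>2)\<^sup>2) - 2 * (b - a) * al\<^sup>2) / (4 * V)
      = (b - a) * (2 * w\<^sup>2 + (a + b) * (w\<^sup>2)\<^sup>2) / (4 * V) - (b - a) * al\<^sup>2 / (2 * V)"
    unfolding diff_divide_distrib using V0 by (simp add: field_simps)
  finally have main: "1 - Re (S w) \<ge> (b - a) * (2 * w\<^sup>2 + (a + b) * (w\<^sup>2)\<^sup>2) / (4 * V) - (b - a) * al\<^sup>2 / (2 * V)" .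
  have p1: "(b - a) * w\<^sup>2 / (8 * (1 + b * w\<^sup>2)) \<le> (b - a) * (2 * w\<^sup>2 + (a + b) * (w\<^sup>2)\<^sup>2) / (4 * V)"
  proof -
    have "(b - a) * w\<^sup>2 / (8 * (1 + b * w\<^sup>2)) = (b - a) * (w\<^sup>2 * (1 + b * w\<^sup>2)) / (4 * (2 * (1 + b * w\<^sup>2)\<^sup>2))"
      using bw by (simp add: power2_eq_square)
    also have "\<dots> \<le> (b - a) * (w\<^sup>2 * (1 + b * w\<^sup>2)) / (4 * V)"
      using V0 Vle ab bw by (intro divide_left_mono mult_left_mono mult_pos_pos mult_nonneg_nonneg) (auto intro: add_pos_nonneg)
    also have "\<dots> \<le> (b - a) * (2 * w\<^sup>2 + (a + b) * (w\<^sup>2)\<^sup>2) / (4 * V)"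
    proof (intro divide_right_mono mult_left_mono)
      have "0 \<le> a * (w\<^sup>2)\<^sup>2" using a by simp
      then show "w\<^sup>2 * (1 + b * w\<^sup>2) \<le> 2 * w\<^sup>2 + (a + b) * (w\<^sup>2)\<^sup>2" using zero_le_power2[of w]
        by (simp only: power2_eq_square[of "w\<^sup>2"] algebra_simps)
    qed (use V0 ab in auto)
    finally show ?thesis .
  qed
  \<comment> \<open>This negative term has to keep the sharp leading constant (b - a) al^2 / 2,
    because it is measured against the gap 1 - (b - a) ah^2 later on. The positive term in
    \<open>p1\<close> may lose a constant factor.\<close>
  have p2: "(b - a) * al\<^sup>2 / (2 * V) \<le> (b - a) * al\<^sup>2 / (2 * (1 - b * al\<^sup>2)\<^sup>2)"
    using Vge V0 ab bal by (intro divide_left_mono mult_left_mono mult_pos_pos) auto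
  show ?thesis using main p1 p2 by linarith
qed

section \<open>Lower bounds for the denominators and their expansion\<close>

lemma Re_Qp: "Re (lam - Qp_sym a b c (xi w)) \<ge> Re lam + al * c"
  using Im_xiS_ge[of w] unfolding Qp_sym_def mult.assoc by (simp add: xi_def algebra_simps)

lemma Re_Qm: "Re (lam - Qm_sym a b c (xi w)) \<ge> Re lam + al * (c - Re (S w))"
  using wImS_le[of w] Im_xiS[of w] unfolding Qm_sym_def mult.assoc by (simp add: xi_def algebra_simps)

lemma norm_Qp: "cmod (Qp_sym a b c (xi w)) \<ge> cmod (xi w) * c" if "c > 0"
proof -
  have "Qp_sym a b c (xi w) = \<i> * (xi w * (complex_of_real c + S w))" by (simp add: Qp_sym_def algebra_simps)
  then have "cmod (Qp_sym a b c (xi w)) = cmod (xi w) * cmod (complex_of_real c + S w)" by (simp add: norm_mult)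
  moreover have "c \<le> cmod (complex_of_real c + S w)"
    using complex_Re_le_cmod[of "complex_of_real c + S w"] S_Re_pos[of w] by simp
  ultimately show ?thesis by (simp add: mult_left_mono)
qed

lemma norm_Qm: "cmod (Qm_sym a b c (xi w)) \<ge> cmod (xi w) * (c - Re (S w))"
proof -
  have "Qm_sym a b c (xi w) = \<i> * (xi w * (complex_of_real c - S w))" by (simp add: Qm_sym_def algebra_simps)
  then have "cmod (Qm_sym a b c (xi w)) = cmod (xi w) * cmod (complex_of_real c - S w)" by (simp add: norm_mult)
  moreover have "c - Re (S w) \<le> cmod (complex_of_real c - S w)"
    using complex_Re_le_cmod[of "complex_of_real c - S w"] by simp
  ultimately show ?thesis by (simp add: mult_left_mono)
qed

text \<open>The identity 1 - S = (b - a) \<xi>^2 B / (1 + S) is exact. The quotient B / (1 + S)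
  differs from 1/2 by an amount controlled by 2 |B - 1| + |1 - S|, hence by 3 |B - 1|, which is
  quadratic in \<xi>.\<close>

lemma KdV_expansion:
  "cmod (1 - S w - complex_of_real ((b - a) / 2) * (xi w)\<^sup>2) \<le> (b - a) * (cmod (xi w))\<^sup>2 * (3 * b * (cmod (xi w))\<^sup>2)"
proof -
  have "1 - S w = complex_of_real (1 - a / b) * (complex_of_real b * (xi w)\<^sup>2 * B w) / (1 + S w)"
  proof -
    have e: "1 - B w = complex_of_real b * (xi w)\<^sup>2 * B w"
      using arg_cong[OF B_minus_1[of w], of uminus] by simp
    show ?thesis unfolding one_minus_S unfolding e ..
  qed
  also have "\<dots> = complex_of_real (b - a) * (xi w)\<^sup>2 * (B w / (1 + S w))"
  proof -
    have "complex_of_real (1 - a / b) * complex_of_real b = complex_of_real (b - a)"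
      using b by (simp add: field_simps flip: of_real_mult)
    then show ?thesis by (simp add: mult.assoc[symmetric])
  qed
  finally have E: "1 - S w = complex_of_real (b - a) * (xi w)\<^sup>2 * (B w / (1 + S w))" .
  have "1 - S w - complex_of_real ((b - a) / 2) * (xi w)\<^sup>2
      = complex_of_real (b - a) * (xi w)\<^sup>2 * (B w / (1 + S w) - 1/2)"
    unfolding E by (simp add: right_diff_distrib del: of_real_diff)
  also have "B w / (1 + S w) - 1/2 = (2 * (B w - 1) + (1 - S w)) / (2 * (1 + S w))"
  proof -
    have "\<beta> / x - 1/2 = (2 * \<beta> - x) / (2 * x)" if "x \<noteq> 0" for \<beta> x :: complex
      using that by (simp add: field_simps)
    from this[OF S1_nz[of w], of "B w"] show ?thesis by (simp add: algebra_simps)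
  qed
  finally have "cmod (1 - S w - complex_of_real ((b - a) / 2) * (xi w)\<^sup>2)
      = (b - a) * (cmod (xi w))\<^sup>2 * (cmod (2 * (B w - 1) + (1 - S w)) / (2 * cmod (1 + S w)))"
    using ab by (simp only: norm_mult norm_divide norm_power norm_of_real norm_numeral)
  also have "\<dots> \<le> (b - a) * (cmod (xi w))\<^sup>2 * ((3 * (2 * b * (cmod (xi w))\<^sup>2)) / (2 * 1))"
  proof (intro mult_left_mono frac_le)
    have "cmod (2 * (B w - 1) + (1 - S w)) \<le> 2 * cmod (B w - 1) + cmod (1 - S w)"
      by (rule order_trans[OF norm_triangle_ineq]) (simp only: norm_mult norm_numeral order_refl)
    also have "\<dots> \<le> 3 * cmod (B w - 1)" using one_minus_S_norm[of w] by simp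
    also have "\<dots> \<le> 3 * (2 * b * (cmod (xi w))\<^sup>2)" by (intro mult_left_mono B1_quad) simp
    finally show "cmod (2 * (B w - 1) + (1 - S w)) \<le> 3 * (2 * b * (cmod (xi w))\<^sup>2)" .
  qed (use S1_ge[of w] ab b in auto)
  finally show ?thesis by simp
qed

lemma S_measurable: "(\<lambda>w. S w) \<in> borel_measurable borel"
proof (rule borel_measurable_continuous_onI)
  have "continuous_on UNIV (\<lambda>w. csqrt ((S w)\<^sup>2))"
  proof (rule continuous_on_csqrt[THEN continuous_on_compose2])
    show "continuous_on UNIV (\<lambda>w. (S w)\<^sup>2)"
      unfolding S2 unfolding u_def v_def unfolding xi_def
      using v_nz by (intro continuous_intros) (auto simp: v_def xi_def)
    show "range (\<lambda>w. (S w)\<^sup>2) \<subseteq> - \<real>\<^sub>\<le>\<^sub>0"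
    proof (intro image_subsetI ComplI)
      fix w assume "(S w)\<^sup>2 \<in> \<real>\<^sub>\<le>\<^sub>0"
      then have "Re ((S w)\<^sup>2) \<le> 0" by (simp only: complex_nonpos_Reals_iff)
      with S2_Re_ge[of w] tau(1) show False by linarith
    qed
  qed
  then show "continuous_on UNIV (\<lambda>w. S w)" unfolding S_sym_def by simp
qed

end

section \<open>The solitary wave profile\<close>

lemma sech_sq: "(sech y)\<^sup>2 = 1 - (tanh y)\<^sup>2"
proof -
  have "(cosh y)\<^sup>2 - (sinh y)\<^sup>2 = 1" by (simp add: cosh_square_eq)
  then show ?thesis
    by (simp add: sech_def tanh_def power_divide divide_simps)
qed

lemma tanh_sq_le: "(tanh y)\<^sup>2 \<le> 1" for y :: real
  using tanh_real_bounds[of y] by (auto simp: abs_square_le_1 abs_le_iff)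

lemma abs_tanh_le: "\<bar>tanh y\<bar> \<le> 1" for y :: real
  using tanh_real_bounds[of y] by auto

text \<open>sech^2 expressed through tanh, so that all derivatives in x are polynomials in one
  bounded function.\<close>

definition prof :: "real \<Rightarrow> real \<Rightarrow> real" where
  "prof \<beta> x = 1 - (tanh (\<beta> * x / 2))\<^sup>2"

definition prof' :: "real \<Rightarrow> real \<Rightarrow> real" where
  "prof' \<beta> x = - \<beta> * tanh (\<beta> * x / 2) * prof \<beta> x"

definition prof'' :: "real \<Rightarrow> real \<Rightarrow> real" where
  "prof'' \<beta> x = - \<beta>\<^sup>2 * prof \<beta> x * (prof \<beta> x / 2 - (tanh (\<beta> * x / 2))\<^sup>2)"

lemma prof_range: "0 \<le> prof \<beta> x" "prof \<beta> x \<le> 1"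
  using tanh_sq_le by (auto simp: prof_def)

lemma prof_deriv: "(prof \<beta> has_real_derivative prof' \<beta> x) (at x)"
proof -
  have "((\<lambda>x. 1 - (tanh (\<beta> * x / 2))\<^sup>2) has_real_derivative prof' \<beta> x) (at x)"
    by (auto intro!: derivative_eq_intros simp: prof'_def prof_def)
  then show ?thesis by (simp add: prof_def[abs_def])
qed

lemma prof'_deriv: "(prof' \<beta> has_real_derivative prof'' \<beta> x) (at x)"
proof -
  have "((\<lambda>x. - \<beta> * tanh (\<beta> * x / 2) * prof \<beta> x) has_real_derivative
     (- \<beta> * ((1 - (tanh (\<beta> * x / 2))\<^sup>2) * (\<beta> / 2))) * prof \<beta> x + (- \<beta> * tanh (\<beta> * x / 2)) * prof' \<beta> x) (at x)"
    by (rule derivative_eq_intros prof_deriv refl | simp)+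
  moreover have "(- \<beta> * ((1 - (tanh (\<beta> * x / 2))\<^sup>2) * (\<beta> / 2))) * prof \<beta> x + (- \<beta> * tanh (\<beta> * x / 2)) * prof' \<beta> x = prof'' \<beta> x"
    unfolding prof'_def prof''_def by (simp add: prof_def power2_eq_square field_simps)
  ultimately show ?thesis by (simp add: prof'_def[abs_def])
qed

lemma prof'_bound: "0 \<le> \<beta> \<Longrightarrow> \<bar>prof' \<beta> x\<bar> \<le> \<beta>"
proof -
  assume "0 \<le> \<beta>"
  then have "\<bar>prof' \<beta> x\<bar> \<le> \<beta> * 1 * 1"
    unfolding prof'_def abs_mult using prof_range[of \<beta> x] by (intro mult_mono abs_tanh_le) auto
  then show ?thesis by simp
qed

lemma prof''_bound: "\<bar>prof'' \<beta> x\<bar> \<le> \<beta>\<^sup>2"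
proof -
  have "\<bar>prof \<beta> x / 2 - (tanh (\<beta> * x / 2))\<^sup>2\<bar> \<le> 1"
    using prof_range[of \<beta> x] tanh_sq_le[of "\<beta> * x / 2"] zero_le_power2[of "tanh (\<beta> * x / 2)"] by linarith
  then have "\<bar>prof'' \<beta> x\<bar> \<le> \<beta>\<^sup>2 * 1 * 1"
    unfolding prof''_def abs_mult using prof_range[of \<beta> x] by (intro mult_mono) auto
  then show ?thesis by simp
qed

lemma C1b_prof:
  assumes "0 \<le> \<beta>" shows "C1b (prof \<beta>) (prof' \<beta>)" "C1b (prof' \<beta>) (prof'' \<beta>)"
proof -
  have c: "continuous_on UNIV (prof' \<beta>)"
    using prof'_deriv by (intro continuous_at_imp_continuous_on ballI DERIV_isCont) auto
  have c0: "continuous_on UNIV (prof \<beta>)"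
    using prof_deriv by (intro continuous_at_imp_continuous_on ballI DERIV_isCont) auto
  have c1: "continuous_on UNIV (prof'' \<beta>)"
    unfolding prof''_def using c0 by (intro continuous_intros) auto
  have "\<bar>prof \<beta> x\<bar> \<le> 1 + \<beta> + \<beta>\<^sup>2" "\<bar>prof' \<beta> x\<bar> \<le> 1 + \<beta> + \<beta>\<^sup>2" "\<bar>prof'' \<beta> x\<bar> \<le> 1 + \<beta> + \<beta>\<^sup>2" for x
    using prof_range[of \<beta> x] prof'_bound[OF assms, of x] prof''_bound[of \<beta> x] assms zero_le_power2[of \<beta>] by linarith+
  then show "C1b (prof \<beta>) (prof' \<beta>)" "C1b (prof' \<beta>) (prof'' \<beta>)"
    unfolding C1b_def using prof_deriv prof'_deriv c c1 by blast+
qed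

text \<open>Differentiating the profile with respect to its width brings down a factor x. The decay
  of sech^2 absorbs it, already by cosh u \<ge> exp |u| / 2 \<ge> (1 + |u|) / 2.\<close>

lemma abs_mult_sech_sq: "\<bar>u\<bar> * (1 - (tanh u)\<^sup>2) \<le> 1" for u :: real
proof -
  have "\<bar>u\<bar> \<le> (cosh u)\<^sup>2"
  proof -
    have "(1 + \<bar>u\<bar>) / 2 \<le> exp \<bar>u\<bar> / 2" by (rule divide_right_mono[OF exp_ge_add_one_self]) simp
    also have "\<dots> \<le> cosh \<bar>u\<bar>" by (simp add: cosh_def)
    also have "\<dots> = cosh u" by (simp add: abs_if)
    finally have "((1 + \<bar>u\<bar>) / 2)\<^sup>2 \<le> (cosh u)\<^sup>2" by (intro power_mono) auto
    moreover have "\<bar>u\<bar> \<le> ((1 + \<bar>u\<bar>) / 2)\<^sup>2"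
      using zero_le_power2[of "1 - \<bar>u\<bar>"] by (simp add: power2_eq_square field_simps)
    ultimately show ?thesis by linarith
  qed
  moreover have "1 - (tanh u)\<^sup>2 = 1 / (cosh u)\<^sup>2"
    unfolding sech_sq[symmetric] by (simp add: sech_def power_divide)
  ultimately show ?thesis by (simp add: divide_le_eq)
qed

text \<open>The derivatives in \<open>\<beta>\<close> are bounded uniformly in \<open>x\<close>.\<close>
lemma prof_diff:
  assumes "0 < \<beta>0" "\<beta>0 / 2 \<le> \<beta>"
  shows "\<bar>prof \<beta> x - prof \<beta>0 x\<bar> \<le> 4 / \<beta>0 * \<bar>\<beta> - \<beta>0\<bar>" "\<bar>prof' \<beta> x - prof' \<beta>0 x\<bar> \<le> 3 * \<bar>\<beta> - \<beta>0\<bar>"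
proof -
  \<comment> \<open>The bound 2/r in \<open>k\<close> degenerates for flat profiles, so the whole
    segment between the two widths is kept above half of \<beta>0.\<close>
  have seg: "\<beta>0 / 2 \<le> r" if "r \<in> closed_segment \<beta>0 \<beta>" for r
    using that assms by (auto simp: closed_segment_eq_real_ivl split: if_splits)
  have k: "\<bar>x\<bar> * prof r x \<le> 2 / r" if "r > 0" for r
    using abs_mult_sech_sq[of "r * x / 2"] that by (simp add: prof_def abs_mult field_simps)
  have "norm (prof \<beta> x - prof \<beta>0 x) \<le> 4 / \<beta>0 * norm (\<beta> - \<beta>0)"
  proof (rule field_differentiable_bound[OF convex_closed_segment[of \<beta>0 \<beta>]])
    fix r assume r: "r \<in> closed_segment \<beta>0 \<beta>"
    then have r0: "r \<ge> \<beta>0 / 2" "r > 0" using seg[OF r] assms by auto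
    have "((\<lambda>\<beta>. prof \<beta> x) has_real_derivative (- x * tanh (r * x / 2) * prof r x)) (at r)"
      unfolding prof_def by (auto intro!: derivative_eq_intros)
    then show "((\<lambda>\<beta>. prof \<beta> x) has_real_derivative (- x * tanh (r * x / 2) * prof r x)) (at r within closed_segment \<beta>0 \<beta>)"
      by (rule has_field_derivative_at_within)
    have "\<bar>- x * tanh (r * x / 2) * prof r x\<bar> = \<bar>tanh (r * x / 2)\<bar> * (\<bar>x\<bar> * prof r x)"
      using prof_range[of r x] by (simp add: abs_mult)
    also have "\<dots> \<le> 1 * (2 / r)" using prof_range[of r x] r0 by (intro mult_mono abs_tanh_le k) auto
    also have "\<dots> \<le> 4 / \<beta>0" using r0 assms by (simp add: field_simps)
    finally show "norm (- x * tanh (r * x / 2) * prof r x) \<le> 4 / \<beta>0" by simp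
  qed auto
  then show "\<bar>prof \<beta> x - prof \<beta>0 x\<bar> \<le> 4 / \<beta>0 * \<bar>\<beta> - \<beta>0\<bar>" by simp
  have "norm (prof' \<beta> x - prof' \<beta>0 x) \<le> 3 * norm (\<beta> - \<beta>0)"
  proof (rule field_differentiable_bound[OF convex_closed_segment[of \<beta>0 \<beta>]])
    fix r assume r: "r \<in> closed_segment \<beta>0 \<beta>"
    then have r0: "r > 0" using seg[OF r] assms by auto
    let ?t = "tanh (r * x / 2)"
    let ?D = "- (?t * prof r x) - r * (x * prof r x * (prof r x / 2 - ?t\<^sup>2))"
    have "((\<lambda>\<beta>. prof' \<beta> x) has_real_derivative ?D) (at r)"
      unfolding prof'_def prof_def
      by (auto intro!: derivative_eq_intros) (simp add: power2_eq_square field_simps)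
    then show "((\<lambda>\<beta>. prof' \<beta> x) has_real_derivative ?D) (at r within closed_segment \<beta>0 \<beta>)"
      by (rule has_field_derivative_at_within)
    have "\<bar>prof r x / 2 - ?t\<^sup>2\<bar> \<le> 1"
      using prof_range[of r x] tanh_sq_le[of "r * x / 2"] zero_le_power2[of ?t] by linarith
    then have "\<bar>r * (x * prof r x * (prof r x / 2 - ?t\<^sup>2))\<bar> \<le> r * (2 / r * 1)"
      unfolding abs_mult using prof_range[of r x] r0 k[OF r0] by (intro mult_mono) auto
    moreover have "\<bar>?t * prof r x\<bar> \<le> 1 * 1"
      unfolding abs_mult using prof_range[of r x] by (intro mult_mono abs_tanh_le) auto
    ultimately show "norm ?D \<le> 3" using r0 by simp
  qed auto
  then show "\<bar>prof' \<beta> x - prof' \<beta>0 x\<bar> \<le> 3 * \<bar>\<beta> - \<beta>0\<bar>" by simp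
qed

lemma theta0_prof: "theta0 a b = prof (1 / sqrt (b - a))"
  by (simp add: theta0_def prof_def sech_sq fun_eq_iff)

lemma q_c_prof: "q_c a b c x = (c\<^sup>2 - 1) / c * prof (alpha_c a b c) x"
  by (simp add: q_c_def prof_def sech_sq)

lemma deriv_q_c: "deriv (q_c a b c) x = (c\<^sup>2 - 1) / c * prof' (alpha_c a b c) x"
  unfolding q_c_prof[abs_def] by (intro DERIV_imp_deriv DERIV_cmult prof_deriv)

lemma deriv_r_c: "deriv (r_c a b c) x = - c * ((c\<^sup>2 - 1) / c * prof' (alpha_c a b c) x)"
  unfolding r_c_def[abs_def] q_c_prof by (intro DERIV_imp_deriv DERIV_cmult prof_deriv)

lemma prof_scale:
  assumes "eps > 0"
  shows "prof \<alpha> (x / eps) = prof (\<alpha> / eps) x" "prof' \<alpha> (x / eps) = eps * prof' (\<alpha> / eps) x"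
  using assms by (simp_all add: prof_def prof'_def)

section \<open>Symbol estimates in the KdV scaling\<close>

text \<open>\<open>beps\<close> is the condition of \<open>symb\<close> for the weight eps * ah.
  \<open>geps\<close> ensures that replacing 1/(1 - y)^2 by 1 in the phase velocity bound, with y =
  b (eps * ah)^2, costs at most a quarter of the gap 1 - (b - a) ah^2.\<close>

locale scal =
  fixes a b ah eps :: real
  assumes sa: "0 < a" and sab: "a < b" and sah: "0 < ah" and sbh: "(b - a) * ah\<^sup>2 < 1"
    and eps: "0 < eps" "eps \<le> 1"
    and beps: "b * (eps * ah)\<^sup>2 \<le> 1/4"
    and geps: "4 * b * (b - a) * ah ^ 4 * eps\<^sup>2 \<le> (1 - (b - a) * ah\<^sup>2) / 4"
begin

sublocale symb a b "eps * ah"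
  using sa sab sah eps beps by unfold_locales auto

definition bhat :: real where "bhat = ah * (1 - (b - a) * ah\<^sup>2)"
definition c :: real where "c = 1 + eps\<^sup>2 / 2"
definition lam :: "complex \<Rightarrow> complex" where "lam L = complex_of_real (eps ^ 3 / 2) * L"
text \<open>A common constant for the denominators of both resolvents: the first entry comes from
  the spectral gap at k = 0, the second from dispersion. It does not involve \<open>eps\<close>, and
  neither do the constants built from it.\<close>

definition c2 :: real where "c2 = min (bhat / 4) (ah * (b - a) / (4 * max 1 b))"
definition Z :: real where "Z = 1 + ah\<^sup>2"
definition Cs :: real where "Cs = sqrt (b / a)"
definition rr :: "real \<Rightarrow> real" where "rr k = sqrt (1 + k\<^sup>2)"
definition mm :: "complex \<Rightarrow> real \<Rightarrow> complex" where
  "mm L k = complex_of_real (eps ^ 3 / 2) * (1 / (lam L - Qm_sym a b c (eps * zt ah k)))"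
definition m0 :: "complex \<Rightarrow> real \<Rightarrow> complex" where
  "m0 L k = 1 / (L - \<i> * zt ah k + complex_of_real (b - a) * (\<i> * zt ah k) ^ 3)"

lemma xi_zt: "eps * zt ah k = xi (eps * k)"
  unfolding zt_def xi_def by (simp add: distrib_left mult_ac)

lemma norm_xi: "cmod (xi (eps * k)) = eps * cmod (zt ah k)"
  using eps by (simp add: xi_zt[symmetric] norm_mult)

lemma bhat_pos: "0 < bhat" using sah sbh by (simp add: bhat_def)

lemma c2_pos: "0 < c2" using bhat_pos sah ab by (auto simp: c2_def intro!: divide_pos_pos mult_pos_pos)

lemma c_bounds: "1 < c" "c \<le> 3/2"
  using eps power_le_one[of eps 2] by (auto simp: c_def)

lemma rr_sq: "(rr k)\<^sup>2 = 1 + k\<^sup>2" by (simp add: rr_def add_nonneg_nonneg)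

lemma rr_ge: "1 \<le> rr k" by (simp add: rr_def)

lemma Z_ge: "1 \<le> Z" by (simp add: Z_def)

lemma zt_rr: "cmod (zt ah k) \<le> Z * rr k"
proof (rule power2_le_imp_le)
  have "(cmod (zt ah k))\<^sup>2 = k\<^sup>2 + ah\<^sup>2" by (simp add: zt_def cmod_def)
  also have "\<dots> \<le> Z * (1 + k\<^sup>2)" by (simp add: Z_def algebra_simps)
  also have "\<dots> \<le> Z\<^sup>2 * (1 + k\<^sup>2)" using Z_ge by (intro mult_right_mono) (auto simp: power2_eq_square)
  finally show "(cmod (zt ah k))\<^sup>2 \<le> (Z * rr k)\<^sup>2" by (simp add: power_mult_distrib rr_sq)
qed (use Z_ge rr_ge[of k] in auto)

lemma Cs_nonneg: "0 \<le> Cs" using a b by (simp add: Cs_def)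

text \<open>In units of eps^3 / 2 the gap is \<open>bhat\<close>. The correction to the weight term
  costs a quarter of it by \<open>geps\<close>, and the half-plane for \<Lambda> costs a half, so a
  quarter remains besides the dispersive term. The second claim, a positive multiple of eps^2,
  serves only to bound i\<zeta> times the resolvent for fixed \<open>eps\<close>.\<close>

lemma phase_velocity_gap:
  assumes "Re L \<ge> - bhat / 2"
  shows "Re L / 2 * eps ^ 3 + (eps * ah) * (c - Re (S w)) \<ge> eps ^ 3 / 2 * (bhat / 4 + 2 * ah / eps\<^sup>2 * ((b - a) * w\<^sup>2 / (8 * (1 + b * w\<^sup>2))))"
    and "c - Re (S w) \<ge> eps\<^sup>2 * bhat / (4 * ah)"
proof -
  define y where "y = b * (eps * ah)\<^sup>2"
  have y: "0 \<le> y" "y \<le> 1/4" using beps b by (auto simp: y_def)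
  have iy: "1 / (1 - y)\<^sup>2 \<le> 1 + 4 * y"
  proof -
    have "1 \<le> (1 + 4 * y) * (1 - y)\<^sup>2"
    proof -
      have "(1 + 4 * y) * (1 - y)\<^sup>2 = 1 + y * (2 - 7 * y + 4 * y\<^sup>2)" by (simp add: power2_eq_square algebra_simps)
      moreover have "0 \<le> y * (2 - 7 * y + 4 * y\<^sup>2)" using y by (intro mult_nonneg_nonneg) (auto intro: add_nonneg_nonneg)
      ultimately show ?thesis by simp
    qed
    then show ?thesis using y by (simp add: divide_le_eq)
  qed
  define X where "X = (b - a) * w\<^sup>2 / (8 * (1 + b * w\<^sup>2))"
  have X0: "0 \<le> X" unfolding X_def using ab bw[of w] by (intro divide_nonneg_nonneg mult_nonneg_nonneg) auto
  have "(b - a) * (eps * ah)\<^sup>2 / (2 * (1 - y)\<^sup>2) = (b - a) * (eps * ah)\<^sup>2 / 2 * (1 / (1 - y)\<^sup>2)" by simp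
  also have "\<dots> \<le> (b - a) * (eps * ah)\<^sup>2 / 2 * (1 + 4 * y)"
    using ab iy by (intro mult_left_mono) auto
  also have "\<dots> = eps\<^sup>2 / 2 * ((b - a) * ah\<^sup>2 + 4 * b * (b - a) * ah ^ 4 * eps\<^sup>2)"
    by (simp add: y_def power2_eq_square eval_nat_numeral field_simps)
  also have "\<dots> \<le> eps\<^sup>2 / 2 * ((b - a) * ah\<^sup>2 + (1 - (b - a) * ah\<^sup>2) / 4)"
    by (intro mult_left_mono add_left_mono geps) auto
  finally have t: "(b - a) * (eps * ah)\<^sup>2 / (2 * (1 - y)\<^sup>2) \<le> eps\<^sup>2 / 2 * ((b - a) * ah\<^sup>2 + (1 - (b - a) * ah\<^sup>2) / 4)" .
  have bh: "bhat / ah = 1 - (b - a) * ah\<^sup>2" using sah by (simp add: bhat_def)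
  have "eps\<^sup>2 / 2 - eps\<^sup>2 / 2 * ((b - a) * ah\<^sup>2 + (1 - (b - a) * ah\<^sup>2) / 4) = eps\<^sup>2 / 2 * (3 / 4 * (bhat / ah))"
    unfolding bh by (simp add: field_simps)
  with t one_minus_ReS[of w] have main: "c - Re (S w) \<ge> eps\<^sup>2 / 2 * (3 / 4 * (bhat / ah)) + X"
    unfolding c_def X_def y_def by linarith
  have q: "0 < eps\<^sup>2 / 2 * (bhat / ah)" using eps sah bhat_pos by simp
  have e34: "eps\<^sup>2 / 2 * (3 / 4 * (bhat / ah)) = 3 / 4 * (eps\<^sup>2 / 2 * (bhat / ah))" by simp
  have "eps\<^sup>2 * bhat / (4 * ah) = 1 / 2 * (eps\<^sup>2 / 2 * (bhat / ah))" by simp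
  then show "c - Re (S w) \<ge> eps\<^sup>2 * bhat / (4 * ah)" using main X0 q unfolding e34 by linarith
  have "(eps * ah) * (eps\<^sup>2 / 2 * (3 / 4 * (bhat / ah)) + X) \<le> (eps * ah) * (c - Re (S w))"
    using main eps sah by (intro mult_left_mono) auto
  moreover have "(eps * ah) * (eps\<^sup>2 / 2 * (3 / 4 * (bhat / ah)) + X) = eps ^ 3 / 2 * (3 / 4 * bhat + 2 * ah / eps\<^sup>2 * X)"
    using eps sah by (simp add: field_simps power2_eq_square eval_nat_numeral)
  moreover have "Re L / 2 * eps ^ 3 \<ge> eps ^ 3 / 2 * (- bhat / 2)"
    using mult_left_mono[OF assms, of "eps ^ 3 / 2"] eps by (simp add: mult_ac)
  moreover have "eps ^ 3 / 2 * (3 / 4 * bhat + 2 * ah / eps\<^sup>2 * X) + eps ^ 3 / 2 * (- bhat / 2) = eps ^ 3 / 2 * (bhat / 4 + 2 * ah / eps\<^sup>2 * X)"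
    by (simp add: algebra_simps)
  ultimately show "Re L / 2 * eps ^ 3 + (eps * ah) * (c - Re (S w)) \<ge> eps ^ 3 / 2 * (bhat / 4 + 2 * ah / eps\<^sup>2 * X)" by linarith
qed

lemma c2_le: "c2 \<le> bhat / 4" by (simp add: c2_def)

lemma Re_Qm_ge:
  assumes L: "Re L \<ge> - bhat / 2"
  shows "Re (lam L - Qm_sym a b c (eps * zt ah k)) \<ge> eps ^ 3 / 2 * (c2 * (1 + k\<^sup>2) / (1 + eps\<^sup>2 * k\<^sup>2))"
proof -
  let ?w = "eps * k"
  have "Re (lam L - Qm_sym a b c (eps * zt ah k)) \<ge> Re (lam L) + eps * ah * (c - Re (S ?w))"
    unfolding xi_zt by (rule Re_Qm)
  moreover have "Re (lam L) = Re L / 2 * eps ^ 3" by (simp add: lam_def)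
  ultimately have 1: "Re (lam L - Qm_sym a b c (eps * zt ah k)) \<ge> eps ^ 3 / 2 * (bhat / 4 + 2 * ah / eps\<^sup>2 * ((b - a) * ?w\<^sup>2 / (8 * (1 + b * ?w\<^sup>2))))"
    using phase_velocity_gap(1)[OF L, of ?w] by linarith
  have p: "0 < 1 + eps\<^sup>2 * k\<^sup>2" "0 < 1 + b * (eps\<^sup>2 * k\<^sup>2)" using b by (auto intro: add_pos_nonneg)
  have "2 * ah / eps\<^sup>2 * ((b - a) * ?w\<^sup>2 / (8 * (1 + b * ?w\<^sup>2))) = ah * (b - a) / 4 * (k\<^sup>2 / (1 + b * (eps\<^sup>2 * k\<^sup>2)))"
    using eps p by (simp add: power_mult_distrib divide_simps)
  also have "\<dots> \<ge> ah * (b - a) / 4 * (k\<^sup>2 / (max 1 b * (1 + eps\<^sup>2 * k\<^sup>2)))"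
  proof (intro mult_left_mono divide_left_mono mult_pos_pos)
    have "1 + b * (eps\<^sup>2 * k\<^sup>2) \<le> max 1 b * 1 + max 1 b * (eps\<^sup>2 * k\<^sup>2)"
      by (intro add_mono mult_right_mono) auto
    then show "1 + b * (eps\<^sup>2 * k\<^sup>2) \<le> max 1 b * (1 + eps\<^sup>2 * k\<^sup>2)" by (simp only: distrib_left)
  qed (use p sah ab in auto)
  also (xtrans) have "ah * (b - a) / 4 * (k\<^sup>2 / (max 1 b * (1 + eps\<^sup>2 * k\<^sup>2))) = (ah * (b - a) / (4 * max 1 b)) * (k\<^sup>2 / (1 + eps\<^sup>2 * k\<^sup>2))"
    by simp
  also (xtrans) have "\<dots> \<ge> c2 * (k\<^sup>2 / (1 + eps\<^sup>2 * k\<^sup>2))"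
    using p by (intro mult_right_mono) (auto simp: c2_def)
  finally have "bhat / 4 + 2 * ah / eps\<^sup>2 * ((b - a) * ?w\<^sup>2 / (8 * (1 + b * ?w\<^sup>2))) \<ge> c2 + c2 * (k\<^sup>2 / (1 + eps\<^sup>2 * k\<^sup>2))"
    using c2_le by linarith
  moreover have "c2 + c2 * (k\<^sup>2 / (1 + eps\<^sup>2 * k\<^sup>2)) \<ge> c2 * (1 + k\<^sup>2) / (1 + eps\<^sup>2 * k\<^sup>2)"
  proof -
    have "c2 + c2 * (k\<^sup>2 / (1 + eps\<^sup>2 * k\<^sup>2)) = c2 * (1 + eps\<^sup>2 * k\<^sup>2 + k\<^sup>2) / (1 + eps\<^sup>2 * k\<^sup>2)"
      using p by (simp add: field_simps)
    then show ?thesis using p c2_pos by (simp add: divide_right_mono)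
  qed
  ultimately have "eps ^ 3 / 2 * (c2 * (1 + k\<^sup>2) / (1 + eps\<^sup>2 * k\<^sup>2)) \<le> eps ^ 3 / 2 * (bhat / 4 + 2 * ah / eps\<^sup>2 * ((b - a) * ?w\<^sup>2 / (8 * (1 + b * ?w\<^sup>2))))"
    using eps by (intro mult_left_mono) auto
  then show ?thesis using 1 by linarith
qed

lemma norm_inverse_le_Re:
  fixes z :: complex
  assumes "Re z \<ge> r" "r > 0" shows "cmod (1 / z) \<le> 1 / r"
proof -
  have "r \<le> cmod z" using assms complex_Re_le_cmod[of z] by linarith
  then show ?thesis using assms by (simp add: norm_divide frac_le)
qed

text \<open>The bound decays like 1/k^2 only up to |k| of order 1/eps and saturates at eps^2 /
  \<open>c2\<close> beyond, since the dispersion of Q- is weaker than cubic there.\<close>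

lemma mm_norm:
  assumes L: "Re L \<ge> - bhat / 2"
  shows "cmod (mm L k) \<le> (1 / c2) * ((1 + eps\<^sup>2 * k\<^sup>2) / (1 + k\<^sup>2))"
proof -
  have p: "0 < 1 + eps\<^sup>2 * k\<^sup>2" "0 < 1 + k\<^sup>2" by (auto intro: add_pos_nonneg)
  have e3: "0 < eps ^ 3 / 2" using eps by simp
  have "cmod (1 / (lam L - Qm_sym a b c (eps * zt ah k))) \<le> 1 / (eps ^ 3 / 2 * (c2 * (1 + k\<^sup>2) / (1 + eps\<^sup>2 * k\<^sup>2)))"
    using p c2_pos e3 by (intro norm_inverse_le_Re Re_Qm_ge L mult_pos_pos divide_pos_pos) auto
  then have "eps ^ 3 / 2 * cmod (1 / (lam L - Qm_sym a b c (eps * zt ah k))) \<le> eps ^ 3 / 2 * (1 / (eps ^ 3 / 2 * (c2 * (1 + k\<^sup>2) / (1 + eps\<^sup>2 * k\<^sup>2))))"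
    using e3 by (intro mult_left_mono) auto
  also have "\<dots> = (1 / c2) * ((1 + eps\<^sup>2 * k\<^sup>2) / (1 + k\<^sup>2))"
  proof -
    have "E * (1 / (E * (C * n / d))) = (1 / C) * (d / n)" if "0 < E" "0 < C" "0 < n" "0 < d" for E C n d :: real
      using that by simp
    from this[OF e3 c2_pos p(2,1)] show ?thesis .
  qed
  finally show ?thesis
    unfolding mm_def norm_mult[of "complex_of_real (eps ^ 3 / 2)"] norm_of_real abs_of_pos[OF e3] .
qed

lemma m0_Re:
  assumes L: "Re L \<ge> - bhat / 2"
  shows "Re (L - \<i> * zt ah k + complex_of_real (b - a) * (\<i> * zt ah k) ^ 3) \<ge> c2 * (1 + k\<^sup>2)"
proof -
  \<comment> \<open>With i\<zeta> = ik - ah the terms free of k add up to ah - (b - a) ah^3. Thus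
    \<open>bhat\<close> is the decay rate of the linear flow of \<partial> - (b - a) \<partial>^3 in
    the weighted space.\<close>
  have "Re (L - \<i> * zt ah k + complex_of_real (b - a) * (\<i> * zt ah k) ^ 3) = Re L + bhat + 3 * (b - a) * ah * k\<^sup>2"
    unfolding bhat_def by (simp add: zt_def power3_eq_cube power2_eq_square algebra_simps)
  moreover have "c2 \<le> bhat / 4" by (simp add: c2_def)
  moreover have "c2 * k\<^sup>2 \<le> 3 * (b - a) * ah * k\<^sup>2"
  proof (rule mult_right_mono)
    have "c2 \<le> ah * (b - a) / (4 * max 1 b)" by (simp add: c2_def)
    also have "\<dots> \<le> ah * (b - a) / 1" using sah ab by (intro divide_left_mono) auto
    also have "\<dots> \<le> 3 * (b - a) * ah" using sah ab by simp
    finally show "c2 \<le> 3 * (b - a) * ah" .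
  qed simp
  ultimately show ?thesis using L bhat_pos by (simp add: distrib_left)
qed

lemma m0_norm:
  assumes L: "Re L \<ge> - bhat / 2"
  shows "cmod (m0 L k) \<le> (1 / c2) / (1 + k\<^sup>2)"
proof -
  have "cmod (m0 L k) \<le> 1 / (c2 * (1 + k\<^sup>2))"
    unfolding m0_def using c2_pos by (intro norm_inverse_le_Re m0_Re L mult_pos_pos) (auto intro: add_pos_nonneg)
  then show ?thesis by simp
qed

text \<open>The decay of \<open>m0\<close> like 1/(1 + k^2) pays for exactly two powers of \<zeta>,
  the number that the comparison of B^-1 with the identity spends.\<close>

lemma m0_zt:
  assumes L: "Re L \<ge> - bhat / 2"
  shows "cmod (m0 L k) \<le> Z\<^sup>2 / c2" "cmod (zt ah k * m0 L k) \<le> Z\<^sup>2 / c2" "cmod ((zt ah k)\<^sup>2 * m0 L k) \<le> Z\<^sup>2 / c2"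
proof -
  have p: "0 < 1 + k\<^sup>2" by (auto intro: add_pos_nonneg)
  have key: "t * cmod (m0 L k) \<le> Z\<^sup>2 / c2" if "t \<le> Z\<^sup>2 * (1 + k\<^sup>2)" "0 \<le> t" for t
  proof -
    have "t * cmod (m0 L k) \<le> (Z\<^sup>2 * (1 + k\<^sup>2)) * ((1 / c2) / (1 + k\<^sup>2))"
      using that p by (intro mult_mono m0_norm L) auto
    also have "\<dots> = Z\<^sup>2 / c2" using p by simp
    finally show ?thesis .
  qed
  have Z2: "1 \<le> Z\<^sup>2" using Z_ge by simp
  have r1: "rr k \<le> (rr k)\<^sup>2" using rr_ge[of k] by (simp add: power2_eq_square)
  show "cmod (m0 L k) \<le> Z\<^sup>2 / c2"
    using key[of 1] mult_mono[OF Z2, of 1 "1 + k\<^sup>2"] by simp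
  have "cmod (zt ah k) \<le> Z\<^sup>2 * (1 + k\<^sup>2)"
    using Z_ge rr_ge[of k] r1 unfolding rr_sq[symmetric]
    by (intro order_trans[OF zt_rr] mult_mono) (auto simp: power2_eq_square)
  from key[OF this] show "cmod (zt ah k * m0 L k) \<le> Z\<^sup>2 / c2" by (simp add: norm_mult)
  have "(cmod (zt ah k))\<^sup>2 \<le> (Z * rr k)\<^sup>2" by (intro power_mono zt_rr) auto
  then have "(cmod (zt ah k))\<^sup>2 \<le> Z\<^sup>2 * (1 + k\<^sup>2)" by (simp add: power_mult_distrib rr_sq)
  from key[OF this] show "cmod ((zt ah k)\<^sup>2 * m0 L k) \<le> Z\<^sup>2 / c2" by (simp add: norm_mult norm_power)
qed

text \<open>\<open>K1\<close> governs the difference of the two resolvent symbols, \<open>K2\<close>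
  the symbol c S^-1 - 1, \<open>K3\<close> their combination at low frequency, \<open>K4\<close> the
  high frequencies, and \<open>K5\<close> all of them. None depends on \<open>eps\<close> or
  \<Lambda>.\<close>

definition K1 :: real where "K1 = 12 * b * (b - a) * Z ^ 5 / c2\<^sup>2"
definition K2 :: real where "K2 = 3 * b * Cs * Z\<^sup>2 + 1"
definition K3 :: real where "K3 = 4 * K2 / c2 + 3 * (K1 + 3 / c2)"
definition K4 :: real where "K4 = (7 + 3 * Cs) / c2"
definition K5 :: real where "K5 = Z * K3 + K4"

lemma K_nonneg: "0 \<le> K1" "0 \<le> K2" "0 \<le> K3" "0 \<le> K4" "K3 \<le> Z * K3"
proof -
  show 1: "0 \<le> K1" "0 \<le> K2" "0 \<le> K4"
    using b ab c2_pos Z_ge Cs_nonneg by (auto simp: K1_def K2_def K4_def intro!: add_nonneg_nonneg)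
  show 3: "0 \<le> K3" using 1 c2_pos by (auto simp: K3_def)
  show "K3 \<le> Z * K3" using 3 Z_ge mult_right_mono[of 1 Z K3] by simp
qed

text \<open>The resolvent identity: the difference of the reciprocals is their product times
  \<open>D0 - D\<close>. In \<open>D0 - D\<close> the parameter \<Lambda> cancels together with all
  terms up to third order, leaving 2/eps^2 times i\<zeta> times the quartic remainder of
  \<open>KdV_expansion\<close>. Hence the estimate is uniform in \<Lambda>.\<close>

lemma mm_minus_m0:
  assumes L: "Re L \<ge> - bhat / 2"
  shows "cmod (mm L k - m0 L k) \<le> cmod (mm L k) * cmod (m0 L k) * (6 * b * (b - a) * eps\<^sup>2 * cmod (zt ah k) ^ 5)"
proof -
  define z where "z = zt ah k"
  define D where "D = complex_of_real (2 / eps ^ 3) * (lam L - Qm_sym a b c (eps * z))"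
  define D0 where "D0 = L - \<i> * z + complex_of_real (b - a) * (\<i> * z) ^ 3"
  define E where "E = 1 - S (eps * k) - complex_of_real ((b - a) / 2) * (xi (eps * k))\<^sup>2"
  have e0: "complex_of_real eps \<noteq> 0" using eps by simp
  have "Re (lam L - Qm_sym a b c (eps * z)) > 0"
  proof -
    have "0 < eps ^ 3 / 2 * (c2 * (1 + k\<^sup>2) / (1 + eps\<^sup>2 * k\<^sup>2))"
      using eps c2_pos by (intro mult_pos_pos divide_pos_pos) (auto intro: add_pos_nonneg)
    then show ?thesis using Re_Qm_ge[OF L, of k] unfolding z_def by linarith
  qed
  then have "lam L - Qm_sym a b c (eps * z) \<noteq> 0" by auto
  then have Dn: "D \<noteq> 0" using e0 by (simp add: D_def)
  have "Re D0 > 0"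
  proof -
    have "0 < c2 * (1 + k\<^sup>2)" using c2_pos by (intro mult_pos_pos) (auto intro: add_pos_nonneg)
    then show ?thesis using m0_Re[OF L, of k] unfolding D0_def z_def by linarith
  qed
  then have D0n: "D0 \<noteq> 0" by auto
  have mD: "mm L k = 1 / D" unfolding mm_def D_def z_def using e0 by simp
  have m0D: "m0 L k = 1 / D0" unfolding m0_def D0_def z_def ..
  have S: "S (eps * k) = 1 - complex_of_real ((b - a) / 2) * (complex_of_real eps * z)\<^sup>2 - E"
    unfolding E_def z_def xi_zt by simp
  have Q: "Qm_sym a b c (eps * z) = \<i> * (eps * z) * (complex_of_real (eps\<^sup>2 / 2) + complex_of_real ((b - a) / 2) * (complex_of_real eps * z)\<^sup>2 + E)"
  proof -
    have "S_sym a b (eps * z) = 1 - complex_of_real ((b - a) / 2) * (complex_of_real eps * z)\<^sup>2 - E"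
      using S unfolding z_def xi_zt .
    then have "complex_of_real c - S_sym a b (eps * z)
        = complex_of_real (eps\<^sup>2 / 2) + complex_of_real ((b - a) / 2) * (complex_of_real eps * z)\<^sup>2 + E"
      by (simp add: c_def)
    moreover have "Qm_sym a b c (eps * z) = \<i> * (eps * z) * (complex_of_real c - S_sym a b (eps * z))"
      unfolding Qm_sym_def by (simp only: right_diff_distrib)
    ultimately show ?thesis by simp
  qed
  have "D0 - D = complex_of_real (2 / eps\<^sup>2) * (\<i> * z * E)"
  proof -
    have eD: "D = L - complex_of_real (2 / eps ^ 3) * Qm_sym a b c (eps * z)"
      unfolding D_def lam_def using e0 by (simp add: right_diff_distrib)
    have eX: "complex_of_real (2 / eps ^ 3) * Qm_sym a b c (eps * z) = \<i> * z + complex_of_real (b - a) * \<i> * z ^ 3 + complex_of_real (2 / eps\<^sup>2) * (\<i> * z * E)"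
      unfolding Q using e0 by (simp add: divide_simps) (simp add: power2_eq_square power3_eq_cube algebra_simps)
    have "\<i> ^ 3 = - \<i>" by (simp add: power3_eq_cube)
    then have cube: "(\<i> * z) ^ 3 = - \<i> * z ^ 3" by (simp only: power_mult_distrib)
    show ?thesis unfolding D0_def eD eX cube by (simp add: algebra_simps)
  qed
  moreover have "mm L k - m0 L k = mm L k * m0 L k * (D0 - D)"
    unfolding mD m0D using Dn D0n by (simp add: field_simps)
  ultimately have "cmod (mm L k - m0 L k) = cmod (mm L k) * cmod (m0 L k) * (2 / eps\<^sup>2 * (cmod z * cmod E))"
    by (simp add: norm_mult norm_divide norm_power)
  also have "\<dots> \<le> cmod (mm L k) * cmod (m0 L k) * (2 / eps\<^sup>2 * (cmod z * ((b - a) * (eps * cmod z)\<^sup>2 * (3 * b * (eps * cmod z)\<^sup>2))))"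
    using KdV_expansion[of "eps * k"] unfolding E_def norm_xi z_def[symmetric] by (intro mult_left_mono) auto
  also have "2 / eps\<^sup>2 * (cmod z * ((b - a) * (eps * cmod z)\<^sup>2 * (3 * b * (eps * cmod z)\<^sup>2))) = 6 * b * (b - a) * eps\<^sup>2 * cmod z ^ 5"
    using eps by (simp add: divide_simps) (simp add: power2_eq_square eval_nat_numeral algebra_simps)
  finally show ?thesis unfolding z_def .
qed

section \<open>Low and high frequencies\<close>

lemma eps_le_sqrt: "eps \<le> sqrt eps"
proof -
  have "eps\<^sup>2 \<le> eps" using eps by (simp add: power2_eq_square mult_left_le)
  then show ?thesis by (rule real_le_rsqrt)
qed

text \<open>The expansion error \<open>O(eps\<^sup>2 rr\<^sup>2)\<close> is used for \<open>rr\<^sup>2 \<le> 1/eps\<close>, and the decay \<open>O(1/rr)\<close> of both symbols otherwise.\<close>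
lemma low_frequency:
  assumes L: "Re L \<ge> - bhat / 2" and k: "\<bar>eps * k\<bar> \<le> 1"
  shows "cmod (mm L k) * (rr k)\<^sup>2 \<le> 2 / c2" "cmod (mm L k - m0 L k) * rr k \<le> (K1 + 3 / c2) * sqrt eps"
    "cmod ((c * Sinv_sym a b (eps * zt ah k) - 1) * mm L k) * rr k \<le> 4 * K2 / c2 * sqrt eps"
proof -
  define r where "r = rr k"
  have r: "1 \<le> r" "r\<^sup>2 = 1 + k\<^sup>2" unfolding r_def by (rule rr_ge, rule rr_sq)
  have "(eps * k)\<^sup>2 \<le> 1" using k by (simp only: abs_square_le_1)
  then have ek: "eps\<^sup>2 * k\<^sup>2 \<le> 1" by (simp only: power_mult_distrib)
  have mm0: "cmod (mm L k) \<le> (2 / c2) / r\<^sup>2"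
  proof -
    have "(1 / c2) * ((1 + eps\<^sup>2 * k\<^sup>2) / (1 + k\<^sup>2)) \<le> (1 / c2) * (2 / (1 + k\<^sup>2))"
      using ek c2_pos by (intro mult_left_mono divide_right_mono) auto
    then show ?thesis using mm_norm[OF L, of k] unfolding r by simp
  qed
  then show "cmod (mm L k) * (rr k)\<^sup>2 \<le> 2 / c2" using r(1) unfolding r_def[symmetric] by (subst (asm) pos_le_divide_eq) auto
  have m00: "cmod (m0 L k) \<le> (1 / c2) / r\<^sup>2" using m0_norm[OF L, of k] unfolding r .
  have zr: "cmod (zt ah k) \<le> Z * r" unfolding r_def by (rule zt_rr)
  have d1: "cmod (mm L k - m0 L k) * r \<le> K1 * eps\<^sup>2 * r\<^sup>2"
  proof -
    have "cmod (mm L k - m0 L k) \<le> ((2 / c2) / r\<^sup>2) * ((1 / c2) / r\<^sup>2) * (6 * b * (b - a) * eps\<^sup>2 * (Z * r) ^ 5)"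
      using b ab Z_ge r(1) c2_pos by (intro order_trans[OF mm_minus_m0[OF L]] mult_mono mult_left_mono power_mono mm0 m00 zr mult_nonneg_nonneg) auto
    also have "\<dots> = K1 * eps\<^sup>2 * r"
      using r(1) c2_pos by (simp add: K1_def power_mult_distrib divide_simps) (simp add: power2_eq_square eval_nat_numeral)
    finally have "cmod (mm L k - m0 L k) * r \<le> (K1 * eps\<^sup>2 * r) * r" using r(1) by (intro mult_right_mono) auto
    then show ?thesis by (simp add: power2_eq_square mult_ac)
  qed
  have d2: "cmod (mm L k - m0 L k) * r \<le> (3 / c2) / r"
  proof -
    have "cmod (mm L k - m0 L k) \<le> (2 / c2) / r\<^sup>2 + (1 / c2) / r\<^sup>2"
      using norm_triangle_ineq4[of "mm L k" "m0 L k"] mm0 m00 by linarith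
    also have "\<dots> = (3 / c2) / r\<^sup>2" by (simp add: add_divide_distrib[symmetric])
    finally have "cmod (mm L k - m0 L k) * r \<le> (3 / c2) / r\<^sup>2 * r" using r(1) by (intro mult_right_mono) auto
    then show ?thesis using r(1) by (simp add: power2_eq_square)
  qed
  show "cmod (mm L k - m0 L k) * rr k \<le> (K1 + 3 / c2) * sqrt eps"
  proof (cases "r\<^sup>2 \<le> 1 / eps")
    case True
    have "K1 * eps\<^sup>2 * r\<^sup>2 \<le> K1 * eps\<^sup>2 * (1 / eps)" using True K_nonneg by (intro mult_left_mono) auto
    also have "\<dots> = K1 * eps" using eps by (simp add: power2_eq_square)
    also have "\<dots> \<le> K1 * sqrt eps" using eps_le_sqrt K_nonneg by (intro mult_left_mono) auto
    also have "\<dots> \<le> (K1 + 3 / c2) * sqrt eps" using c2_pos eps by (intro mult_right_mono) auto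
    finally show ?thesis using d1 unfolding r_def by linarith
  next
    case False
    then have "1 / eps \<le> r\<^sup>2" by simp
    then have "sqrt (1 / eps) \<le> r" using r(1) by (intro real_le_lsqrt) auto
    then have "1 / r \<le> sqrt eps" using eps r(1) by (simp add: real_sqrt_divide field_simps)
    then have "(3 / c2) * (1 / r) \<le> (3 / c2) * sqrt eps" using c2_pos by (intro mult_left_mono) auto
    also have "\<dots> \<le> (K1 + 3 / c2) * sqrt eps" using K_nonneg eps by (intro mult_right_mono) auto
    finally show ?thesis using d2 unfolding r_def by simp
  qed
  have csb: "cmod (c * Sinv_sym a b (eps * zt ah k) - 1) \<le> K2 * eps\<^sup>2 * r\<^sup>2"
  proof -
    have "c * Sinv_sym a b (eps * zt ah k) - 1 = c * (Sinv_sym a b (eps * zt ah k) - 1) + complex_of_real (eps\<^sup>2 / 2)"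
      by (simp add: c_def algebra_simps)
    then have "cmod (c * Sinv_sym a b (eps * zt ah k) - 1) \<le> cmod (c * (Sinv_sym a b (eps * zt ah k) - 1)) + cmod (complex_of_real (eps\<^sup>2 / 2))"
      by (metis norm_triangle_ineq)
    also have "\<dots> = c * cmod (Sinv_sym a b (eps * zt ah k) - 1) + eps\<^sup>2 / 2" using c_bounds by (simp only: norm_mult norm_of_real) simp
    also have "\<dots> \<le> (3/2) * (Cs * (2 * b * (eps * (Z * r))\<^sup>2)) + eps\<^sup>2 / 2"
    proof (intro add_right_mono mult_mono)
      have "cmod (Sinv_sym a b (eps * zt ah k) - 1) \<le> Cs * (2 * b * (eps * cmod (zt ah k))\<^sup>2)"
        unfolding xi_zt Cs_def norm_xi[symmetric] by (rule Sinv_minus_1)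
      also have "\<dots> \<le> Cs * (2 * b * (eps * (Z * r))\<^sup>2)"
        using b eps Cs_nonneg by (intro mult_left_mono power_mono zr) auto
      finally show "cmod (Sinv_sym a b (eps * zt ah k) - 1) \<le> Cs * (2 * b * (eps * (Z * r))\<^sup>2)" .
    qed (use c_bounds in auto)
    also have "\<dots> \<le> (3/2) * (Cs * (2 * b * (eps * (Z * r))\<^sup>2)) + eps\<^sup>2 * r\<^sup>2"
    proof -
      have "1 \<le> r\<^sup>2" using r by simp
      then have "eps\<^sup>2 * 1 \<le> eps\<^sup>2 * r\<^sup>2" by (intro mult_left_mono) auto
      then show ?thesis using zero_le_power2[of eps] by linarith
    qed
    also have "\<dots> = K2 * eps\<^sup>2 * r\<^sup>2" by (simp add: K2_def power_mult_distrib algebra_simps)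
    finally show ?thesis .
  qed
  \<comment> \<open>Here the cut-off at |eps k| = 1 alone is enough: it turns the bound eps^2 r into
    at most 2 eps.\<close>
  have "r \<le> 2 / eps"
  proof -
    have "r\<^sup>2 \<le> (1 + \<bar>k\<bar>)\<^sup>2" unfolding r by (simp add: power2_eq_square algebra_simps)
    then have "r \<le> 1 + \<bar>k\<bar>" by (rule power2_le_imp_le) simp
    moreover have "\<bar>k\<bar> \<le> 1 / eps" using k eps by (simp add: abs_mult field_simps)
    moreover have "1 \<le> 1 / eps" using eps by simp
    ultimately show ?thesis by simp
  qed
  have "cmod ((c * Sinv_sym a b (eps * zt ah k) - 1) * mm L k) * r \<le> (K2 * eps\<^sup>2 * r\<^sup>2) * ((2 / c2) / r\<^sup>2) * r"
    unfolding norm_mult using r(1) K_nonneg c2_pos by (intro mult_right_mono mult_mono csb mm0) auto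
  also have "\<dots> = (2 * K2 / c2) * eps\<^sup>2 * r" using r(1) by (simp add: field_simps)
  also have "\<dots> \<le> (2 * K2 / c2) * eps\<^sup>2 * (2 / eps)" using \<open>r \<le> 2 / eps\<close> K_nonneg c2_pos by (intro mult_left_mono) auto
  also have "\<dots> = (4 * K2 / c2) * eps" using eps by (simp add: power2_eq_square)
  also have "\<dots> \<le> (4 * K2 / c2) * sqrt eps" using eps_le_sqrt K_nonneg c2_pos by (intro mult_left_mono) auto
  finally show "cmod ((c * Sinv_sym a b (eps * zt ah k) - 1) * mm L k) * rr k \<le> 4 * K2 / c2 * sqrt eps"
    unfolding r_def .
qed

lemma high_frequency:
  assumes L: "Re L \<ge> - bhat / 2" and k: "\<bar>eps * k\<bar> > 1"
  shows "cmod (mm L k) \<le> 2 / c2 * eps\<^sup>2" "cmod (m0 L k) \<le> 1 / c2 * eps\<^sup>2"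
proof -
  have "\<not> (eps * k)\<^sup>2 \<le> 1" using k by (simp only: abs_square_le_1 not_le)
  then have ek: "1 < eps\<^sup>2 * k\<^sup>2" by (simp only: power_mult_distrib not_le)
  then have "k \<noteq> 0" by auto
  then have k0: "0 < k\<^sup>2" by simp
  have "(1 + eps\<^sup>2 * k\<^sup>2) / (1 + k\<^sup>2) \<le> (2 * (eps\<^sup>2 * k\<^sup>2)) / k\<^sup>2"
    using ek k0 by (intro frac_le) auto
  also have "\<dots> = 2 * eps\<^sup>2" using k0 by simp
  finally have "(1 / c2) * ((1 + eps\<^sup>2 * k\<^sup>2) / (1 + k\<^sup>2)) \<le> (1 / c2) * (2 * eps\<^sup>2)"
    using c2_pos by (intro mult_left_mono) auto
  then show "cmod (mm L k) \<le> 2 / c2 * eps\<^sup>2" using mm_norm[OF L, of k] by simp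
  have "1 / (1 + k\<^sup>2) \<le> (eps\<^sup>2 * k\<^sup>2) / k\<^sup>2" using ek k0 by (intro frac_le) auto
  then have "(1 / c2) * (1 / (1 + k\<^sup>2)) \<le> (1 / c2) * eps\<^sup>2" using c2_pos k0 by (intro mult_left_mono) auto
  then show "cmod (m0 L k) \<le> 1 / c2 * eps\<^sup>2" using m0_norm[OF L, of k] by simp
qed

lemma s_norm: "cmod (Sinv_sym a b (eps * zt ah k)) \<le> Cs"
  unfolding xi_zt Cs_def by (rule Sinv_norm)

text \<open>The symbol splits as (c S^-1 - 1) m + 3 (m - m0), and both parts are small even after
  multiplication by \<open>rr\<close>. That spare factor pays for the one power of \<zeta> in the
  second claim.\<close>

lemma d_low:
  assumes L: "Re L \<ge> - bhat / 2" and k: "\<bar>eps * k\<bar> \<le> 1"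
  shows "cmod (2 * mm L k + c * Sinv_sym a b (eps * zt ah k) * mm L k - 3 * m0 L k) \<le> K5 * sqrt eps"
    "cmod (zt ah k * (2 * mm L k + c * Sinv_sym a b (eps * zt ah k) * mm L k - 3 * m0 L k)) \<le> K5 * sqrt eps"
proof -
  let ?d = "2 * mm L k + c * Sinv_sym a b (eps * zt ah k) * mm L k - 3 * m0 L k"
  have "?d = (c * Sinv_sym a b (eps * zt ah k) - 1) * mm L k + 3 * (mm L k - m0 L k)" by (simp add: algebra_simps)
  then have "cmod ?d \<le> cmod ((c * Sinv_sym a b (eps * zt ah k) - 1) * mm L k) + 3 * cmod (mm L k - m0 L k)"
    by (metis norm_triangle_ineq norm_mult norm_numeral)
  then have "cmod ?d * rr k \<le> (cmod ((c * Sinv_sym a b (eps * zt ah k) - 1) * mm L k) + 3 * cmod (mm L k - m0 L k)) * rr k"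
    using rr_ge[of k] by (intro mult_right_mono) auto
  also have "\<dots> = cmod ((c * Sinv_sym a b (eps * zt ah k) - 1) * mm L k) * rr k + 3 * (cmod (mm L k - m0 L k) * rr k)"
    by (simp add: distrib_right)
  also have "\<dots> \<le> 4 * K2 / c2 * sqrt eps + 3 * ((K1 + 3 / c2) * sqrt eps)"
    by (intro add_mono mult_left_mono low_frequency L k) auto
  also have "\<dots> = K3 * sqrt eps" by (simp add: K3_def distrib_right)
  finally have dr: "cmod ?d * rr k \<le> K3 * sqrt eps" .
  have K5: "K3 * sqrt eps \<le> K5 * sqrt eps" "Z * K3 * sqrt eps \<le> K5 * sqrt eps"
    using K_nonneg eps by (auto simp: K5_def intro!: mult_right_mono)
  have "cmod ?d * 1 \<le> cmod ?d * rr k" using rr_ge[of k] by (intro mult_left_mono) auto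
  then show "cmod ?d \<le> K5 * sqrt eps" using dr K5 by linarith
  have "cmod (zt ah k * ?d) \<le> (Z * rr k) * cmod ?d" unfolding norm_mult by (intro mult_right_mono zt_rr) auto
  also have "\<dots> = Z * (cmod ?d * rr k)" by simp
  also have "\<dots> \<le> Z * (K3 * sqrt eps)" using Z_ge dr by (intro mult_left_mono) auto
  finally show "cmod (zt ah k * ?d) \<le> K5 * sqrt eps" using K5 by simp
qed

text \<open>No cancellation is used: every term is of order eps^2. One factor \<open>eps\<close> is
  kept apart in the first claim, to be spent on the bound 1/eps for \<partial> B^-1.\<close>

lemma d_high:
  assumes L: "Re L \<ge> - bhat / 2" and k: "\<bar>eps * k\<bar> > 1"
  shows "cmod (2 * mm L k + c * Sinv_sym a b (eps * zt ah k) * mm L k - 3 * m0 L k) \<le> eps * (K5 * sqrt eps)"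
    "cmod ((c * Sinv_sym a b (eps * zt ah k) - 1) * mm L k) \<le> K5 * sqrt eps"
proof -
  have csn: "cmod (c * Sinv_sym a b (eps * zt ah k)) \<le> 3/2 * Cs"
    unfolding norm_mult using c_bounds s_norm[of k] by (intro mult_mono) auto
  have K5: "K4 * eps \<le> K5 * sqrt eps"
    using K_nonneg eps_le_sqrt Z_ge eps by (intro mult_mono) (auto simp: K5_def)
  have "cmod (2 * mm L k + c * Sinv_sym a b (eps * zt ah k) * mm L k - 3 * m0 L k)
     \<le> cmod (2 * mm L k) + cmod (c * Sinv_sym a b (eps * zt ah k) * mm L k) + cmod (3 * m0 L k)"
    by (rule order_trans[OF norm_triangle_ineq4 add_right_mono[OF norm_triangle_ineq]])
  also have "\<dots> = 2 * cmod (mm L k) + cmod (c * Sinv_sym a b (eps * zt ah k)) * cmod (mm L k) + 3 * cmod (m0 L k)"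
    by (simp only: norm_mult norm_numeral)
  also have "\<dots> \<le> 2 * (2 / c2 * eps\<^sup>2) + 3/2 * Cs * (2 / c2 * eps\<^sup>2) + 3 * (1 / c2 * eps\<^sup>2)"
    using Cs_nonneg by (intro add_mono mult_left_mono mult_mono csn high_frequency L k) auto
  also have "\<dots> = eps * (K4 * eps)" using c2_pos by (simp add: K4_def field_simps power2_eq_square)
  also have "\<dots> \<le> eps * (K5 * sqrt eps)" using eps K5 by (intro mult_left_mono) auto
  finally show "cmod (2 * mm L k + c * Sinv_sym a b (eps * zt ah k) * mm L k - 3 * m0 L k) \<le> eps * (K5 * sqrt eps)" .
  have "cmod (c * Sinv_sym a b (eps * zt ah k) - 1) \<le> 3/2 * Cs + 1"
    using csn norm_triangle_ineq4[of "c * Sinv_sym a b (eps * zt ah k)" 1] by simp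
  then have "cmod ((c * Sinv_sym a b (eps * zt ah k) - 1) * mm L k) \<le> (3/2 * Cs + 1) * (2 / c2 * eps\<^sup>2)"
    unfolding norm_mult using Cs_nonneg by (intro mult_mono high_frequency L k) auto
  also have "\<dots> = (3 * Cs + 2) / c2 * eps\<^sup>2" using c2_pos by (simp add: field_simps)
  also have "\<dots> \<le> K4 * eps"
    unfolding K4_def using c2_pos Cs_nonneg eps
    by (intro mult_mono divide_right_mono) (auto simp: power2_eq_square mult_left_le)
  finally show "cmod ((c * Sinv_sym a b (eps * zt ah k) - 1) * mm L k) \<le> K5 * sqrt eps" using K5 by linarith
qed

lemma cs_small:
  assumes L: "Re L \<ge> - bhat / 2"
  shows "cmod ((c * Sinv_sym a b (eps * zt ah k) - 1) * mm L k) \<le> K5 * sqrt eps"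
proof (cases "\<bar>eps * k\<bar> \<le> 1")
  case True
  have "cmod ((c * Sinv_sym a b (eps * zt ah k) - 1) * mm L k) * 1 \<le> cmod ((c * Sinv_sym a b (eps * zt ah k) - 1) * mm L k) * rr k"
    using rr_ge[of k] by (intro mult_left_mono) auto
  also have "\<dots> \<le> 4 * K2 / c2 * sqrt eps" by (rule low_frequency[OF L True])
  also have "\<dots> \<le> K3 * sqrt eps" using K_nonneg c2_pos eps by (intro mult_right_mono) (auto simp: K3_def)
  also have "\<dots> \<le> K5 * sqrt eps" using K_nonneg eps by (intro mult_right_mono) (auto simp: K5_def)
  finally show ?thesis by simp
qed (use d_high(2)[OF L] in auto)

lemma p_bound:
  assumes L: "Re L \<ge> - bhat / 2"
  shows "Re (lam L - Qp_sym a b c (eps * zt ah k)) \<ge> eps * ah / 2"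
    and "eps * cmod (1 / (lam L - Qp_sym a b c (eps * zt ah k))) \<le> 2 / ah"
proof -
  have bh: "bhat \<le> ah"
  proof -
    have "0 \<le> ah * ((b - a) * ah\<^sup>2)" using sah ab by simp
    then show ?thesis by (simp add: bhat_def right_diff_distrib)
  qed
  have "Re (lam L) = eps ^ 3 / 2 * Re L" by (simp add: lam_def)
  also have "\<dots> \<ge> eps ^ 3 / 2 * (- bhat / 2)" using eps by (intro mult_left_mono L) auto
  also (xtrans) have "eps ^ 3 / 2 * (- bhat / 2) \<ge> - (eps * ah / 2)"
  proof -
    have "eps ^ 3 \<le> eps ^ 1" using eps by (intro power_decreasing) auto
    then have "eps ^ 3 * bhat \<le> eps * ah" using eps bh bhat_pos by (intro mult_mono) auto
    moreover have "0 \<le> eps * ah" using eps sah by simp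
    moreover have "eps ^ 3 / 2 * (- bhat / 2) = - (eps ^ 3 * bhat) / 4" by simp
    ultimately show ?thesis by linarith
  qed
  finally have "Re (lam L) \<ge> - (eps * ah / 2)" .
  moreover have "eps * ah * c \<ge> eps * ah * 1" using c_bounds eps sah by (intro mult_left_mono) auto
  ultimately show 1: "Re (lam L - Qp_sym a b c (eps * zt ah k)) \<ge> eps * ah / 2"
    using Re_Qp[of "lam L" c "eps * k"] unfolding xi_zt by linarith
  have "cmod (1 / (lam L - Qp_sym a b c (eps * zt ah k))) \<le> 1 / (eps * ah / 2)"
    using eps sah by (intro norm_inverse_le_Re 1) auto
  then have "eps * cmod (1 / (lam L - Qp_sym a b c (eps * zt ah k))) \<le> eps * (1 / (eps * ah / 2))"
    using eps by (intro mult_left_mono) auto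
  also have "\<dots> = 2 / ah" using eps by simp
  finally show "eps * cmod (1 / (lam L - Qp_sym a b c (eps * zt ah k))) \<le> 2 / ah" .
qed

section \<open>Measurability and boundedness of the symbols\<close>

lemma S_meas [measurable]: "(\<lambda>k. S_sym a b (eps * zt ah k)) \<in> borel_measurable borel"
proof -
  have "(\<lambda>k. S (eps * k)) \<in> borel_measurable borel"
    by (rule measurable_compose[OF _ S_measurable]) simp
  then show ?thesis unfolding xi_zt .
qed

lemma symbols_measurable [measurable]:
  "(\<lambda>k. Binv_sym b (eps * zt ah k)) \<in> borel_measurable borel"
  "(\<lambda>k. Sinv_sym a b (eps * zt ah k)) \<in> borel_measurable borel"
  "(\<lambda>k. 1 / (lam L - Qp_sym a b c (eps * zt ah k))) \<in> borel_measurable borel"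
  "(\<lambda>k. 1 / (lam L - Qm_sym a b c (eps * zt ah k))) \<in> borel_measurable borel"
  "mm L \<in> borel_measurable borel" "m0 L \<in> borel_measurable borel"
  unfolding Binv_sym_def Sinv_sym_def Qp_sym_def Qm_sym_def mm_def m0_def by measurable

text \<open>From |q| \<le> |l - q| + |l| the quotient |q| / |l - q| is at most 1 + |l| / r, and q
  dominates \<zeta>. The resulting bound depends on \<open>eps\<close> and \<Lambda>, which is
  harmless because only membership in the domain of \<partial> is at stake.\<close>

lemma resolvent_bsym:
  assumes q: "(\<lambda>k. 1 / (l - q k)) \<in> borel_measurable borel"
    and r: "0 < r" "\<And>k. Re (l - q k) \<ge> r" and g: "0 < g" "\<And>k. cmod (q k) \<ge> g * cmod (zt ah k)"
  shows "bsym (\<lambda>k. 1 / (l - q k))" "bsym (\<lambda>k. \<i> * zt ah k * (1 / (l - q k)))"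
proof -
  have i: "cmod (1 / (l - q k)) \<le> 1 / r" for k by (rule norm_inverse_le_Re[OF r(2,1)])
  then show "bsym (\<lambda>k. 1 / (l - q k))" using q unfolding bsym_def by blast
  have "cmod (\<i> * zt ah k * (1 / (l - q k))) \<le> (1 + cmod l / r) / g" for k
  proof -
    have n: "l - q k \<noteq> 0" using r(1) r(2)[of k] by auto
    have "g * cmod (zt ah k) \<le> cmod (q k)" by (rule g)
    also have "\<dots> \<le> cmod (l - q k) + cmod l" using norm_triangle_ineq4[of l "l - q k"] by simp
    finally have "g * cmod (zt ah k) * cmod (1 / (l - q k)) \<le> (cmod (l - q k) + cmod l) * cmod (1 / (l - q k))"
      by (intro mult_right_mono) auto
    also have "\<dots> = 1 + cmod l * cmod (1 / (l - q k))" using n by (simp add: norm_divide field_simps)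
    also have "\<dots> \<le> 1 + cmod l * (1 / r)" by (intro add_left_mono mult_left_mono i) auto
    finally have "g * cmod (zt ah k) * cmod (1 / (l - q k)) \<le> 1 + cmod l / r" by simp
    moreover have "cmod (\<i> * zt ah k * (1 / (l - q k))) = cmod (zt ah k) * cmod (1 / (l - q k))"
      by (simp only: norm_mult norm_ii mult_1_left)
    ultimately show ?thesis using g(1) by (simp only: pos_le_divide_eq mult_ac)
  qed
  then show "bsym (\<lambda>k. \<i> * zt ah k * (1 / (l - q k)))"
    using q unfolding bsym_def by (intro conjI borel_measurable_times) (auto intro: borel_measurable_times zt_measurable)
qed

lemma bsym_all:
  assumes L: "Re L \<ge> - bhat / 2"
  shows "bsym (\<lambda>k. 1 / (lam L - Qp_sym a b c (eps * zt ah k)))" "bsym (\<lambda>k. \<i> * zt ah k * (1 / (lam L - Qp_sym a b c (eps * zt ah k))))"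
    "bsym (\<lambda>k. 1 / (lam L - Qm_sym a b c (eps * zt ah k)))" "bsym (\<lambda>k. \<i> * zt ah k * (1 / (lam L - Qm_sym a b c (eps * zt ah k))))"
proof -
  have "0 < eps * ah / 2" using eps sah by simp
  moreover have "cmod (Qp_sym a b c (eps * zt ah k)) \<ge> (eps * c) * cmod (zt ah k)" for k
    using norm_Qp[of c "eps * k"] c_bounds unfolding xi_zt norm_xi by (simp add: mult_ac)
  moreover have "0 < eps * c" using eps c_bounds by simp
  ultimately show "bsym (\<lambda>k. 1 / (lam L - Qp_sym a b c (eps * zt ah k)))" "bsym (\<lambda>k. \<i> * zt ah k * (1 / (lam L - Qp_sym a b c (eps * zt ah k))))"
    using resolvent_bsym[of "lam L" "\<lambda>k. Qp_sym a b c (eps * zt ah k)"] symbols_measurable(3) p_bound(1)[OF L] by blast+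
  define g where "g = eps * (eps\<^sup>2 * bhat / (4 * ah))"
  have g0: "0 < g" using eps bhat_pos sah by (simp add: g_def)
  have gq: "cmod (Qm_sym a b c (eps * zt ah k)) \<ge> g * cmod (zt ah k)" for k
  proof -
    have "g * cmod (zt ah k) = cmod (xi (eps * k)) * (eps\<^sup>2 * bhat / (4 * ah))" unfolding norm_xi by (simp add: g_def)
    also have "\<dots> \<le> cmod (xi (eps * k)) * (c - Re (S (eps * k)))" by (intro mult_left_mono phase_velocity_gap(2)[OF L]) auto
    also have "\<dots> \<le> cmod (Qm_sym a b c (eps * zt ah k))" unfolding xi_zt by (rule norm_Qm)
    finally show ?thesis .
  qed
  define r where "r = eps ^ 3 / 2 * c2"
  have r0: "0 < r" using eps c2_pos by (simp add: r_def)
  have rq: "Re (lam L - Qm_sym a b c (eps * zt ah k)) \<ge> r" for k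
  proof -
    have "eps\<^sup>2 * k\<^sup>2 \<le> 1 * k\<^sup>2" using eps by (intro mult_right_mono) (auto intro: power_le_one)
    moreover have "0 \<le> eps\<^sup>2 * k\<^sup>2" by simp
    ultimately have "c2 \<le> c2 * (1 + k\<^sup>2) / (1 + eps\<^sup>2 * k\<^sup>2)"
      using c2_pos by (subst pos_le_divide_eq) (auto intro: add_pos_nonneg)
    then have "r \<le> eps ^ 3 / 2 * (c2 * (1 + k\<^sup>2) / (1 + eps\<^sup>2 * k\<^sup>2))"
      unfolding r_def using eps by (intro mult_left_mono) auto
    then show ?thesis using Re_Qm_ge[OF L, of k] by linarith
  qed
  show "bsym (\<lambda>k. 1 / (lam L - Qm_sym a b c (eps * zt ah k)))" "bsym (\<lambda>k. \<i> * zt ah k * (1 / (lam L - Qm_sym a b c (eps * zt ah k))))"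
    using resolvent_bsym[of "lam L" "\<lambda>k. Qm_sym a b c (eps * zt ah k)", OF symbols_measurable(4) r0 rq g0 gq] by auto
qed

lemma m0_bsym:
  assumes L: "Re L \<ge> - bhat / 2"
  shows "bsym (m0 L)" "bsym (\<lambda>k. \<i> * zt ah k * m0 L k)"
proof -
  show "bsym (m0 L)" using m0_zt(1)[OF L] symbols_measurable(6) unfolding bsym_def by blast
  have "cmod (\<i> * zt ah k * m0 L k) \<le> Z\<^sup>2 / c2" for k using m0_zt(2)[OF L, of k] by (simp add: norm_mult)
  moreover have "(\<lambda>k. \<i> * zt ah k * m0 L k) \<in> borel_measurable borel" by measurable
  ultimately show "bsym (\<lambda>k. \<i> * zt ah k * m0 L k)" unfolding bsym_def by blast
qed

lemma B_bounds:
  "cmod (Binv_sym b (eps * zt ah k)) \<le> 2" "eps * cmod (zt ah k * Binv_sym b (eps * zt ah k)) \<le> 2 / sqrt b"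
  "cmod (Binv_sym b (eps * zt ah k) - 1) \<le> 2 * sqrt b * eps * cmod (zt ah k)"
  using B_norm[of "eps * k"] xi_B[of "eps * k"] B1_lin[of "eps * k"] unfolding xi_zt[symmetric]
  using eps by (simp_all add: norm_mult mult_ac)

end

section \<open>Convergence of the bundle\<close>

context scal
begin

text \<open>Together with \<open>\<kappa>\<close> these are the width parameter and, up to eps^2,
  the amplitude of the wave after rescaling; they tend to 1/sqrt (b - a) and to 1.\<close>

definition \<beta> :: real where "\<beta> = alpha_c a b c / eps"
definition \<kappa> :: real where "\<kappa> = (c\<^sup>2 - 1) / c / eps\<^sup>2"

lemma \<kappa>_eps: "(c\<^sup>2 - 1) / c = \<kappa> * eps\<^sup>2"
  using eps by (simp add: \<kappa>_def)

lemma beta_nonneg: "0 \<le> \<beta>"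
proof -
  have "0 \<le> (c\<^sup>2 - 1) / (b * c\<^sup>2 - a)"
  proof (rule divide_nonneg_nonneg)
    have c2: "1 \<le> c\<^sup>2" using c_bounds by (simp add: one_le_power)
    then show "0 \<le> c\<^sup>2 - 1" by simp
    have "b * 1 \<le> b * c\<^sup>2" using b c2 by (intro mult_left_mono) auto
    then show "0 \<le> b * c\<^sup>2 - a" using ab by simp
  qed
  then show ?thesis using eps by (simp add: \<beta>_def alpha_c_def)
qed

lemma wave_profiles:
  "q_c a b c (x / eps) = \<kappa> * eps\<^sup>2 * prof \<beta> x"
  "deriv (q_c a b c) (x / eps) = \<kappa> * eps\<^sup>2 * eps * prof' \<beta> x"
  "r_c a b c (x / eps) = - c * (\<kappa> * eps\<^sup>2) * prof \<beta> x"
  "deriv (r_c a b c) (x / eps) = - c * (\<kappa> * eps\<^sup>2) * eps * prof' \<beta> x"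
  unfolding r_c_def q_c_prof deriv_q_c deriv_r_c prof_scale[OF eps(1)] \<beta>_def[symmetric] \<kappa>_eps by simp_all

text \<open>All sizes are collected in one number \<open>M\<close> and all errors in one
  \<open>\<delta>\<close>, so that both can be chosen before \<open>eps\<close> and
  \<open>L\<close>. As neither bound depends on \<open>L\<close>, the estimate is uniform over the
  half-plane; the constants of Plancherel on the two sides cancel.\<close>

lemma opnorm_bound:
  fixes L :: complex and M \<delta> :: real
  defines "\<beta>0 \<equiv> 1 / sqrt (b - a)"
  assumes L: "Re L \<ge> - bhat / 2"
    and M: "2 \<le> M" "2 / sqrt b \<le> M" "2 * sqrt b \<le> M" "Cs \<le> M" "2 / ah \<le> M" "Z\<^sup>2 / c2 \<le> M"
      "\<beta> \<le> M" "\<beta>0 \<le> M" "\<beta>0\<^sup>2 \<le> M" "\<bar>\<kappa>\<bar> \<le> M"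
    and d: "K5 * sqrt eps \<le> \<delta>" "\<And>x. \<bar>\<kappa> * prof \<beta> x - prof \<beta>0 x\<bar> \<le> \<delta>" "\<And>x. \<bar>\<kappa> * prof' \<beta> x - prof' \<beta>0 x\<bar> \<le> \<delta>"
  shows "opnorm_le ah (\<lambda>g. (\<lambda>x. What a b ah eps L g x - W0_op a b ah L g x)) (4 * M ^ 6 * eps + 12 * M ^ 3 * (eps + \<delta>))"
  unfolding opnorm_le_def
proof (intro allI impI)
  fix g assume "L2w ah g"
  then obtain G where G: "FT (\<lambda>x. complex_of_real (exp (ah * x)) * g x) G"
    unfolding L2w_def using FT_exists_right by blast
  define n where "n = L2norm G"
  have nG: "nb G n" using FT_L2(2)[OF G] by (simp add: nb_def n_def)
  let ?p = "\<lambda>k. 1 / (lam L - Qp_sym a b c (eps * zt ah k))"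
  let ?m = "\<lambda>k. 1 / (lam L - Qm_sym a b c (eps * zt ah k))"
  have d0: "0 \<le> \<delta>" using d(2)[of 0] abs_ge_zero order_trans by blast
  have b0: "0 \<le> \<beta>0" using ab by (simp add: \<beta>0_def)
  have bB: "bsym (\<lambda>k. Binv_sym b (eps * zt ah k))" and bS: "bsym (\<lambda>k. Sinv_sym a b (eps * zt ah k))"
    using symbols_measurable(1,2) B_bounds(1) s_norm unfolding bsym_def by blast+
  note C = C1b_prof[OF beta_nonneg] and C0 = C1b_prof[OF b0]
  have one: "\<bar>prof r x\<bar> \<le> M" for r x using prof_range[of r x] M(1) by simp
  have two: "\<bar>prof' \<beta> x\<bar> \<le> M" "\<bar>prof' \<beta>0 x\<bar> \<le> M" "\<bar>prof'' \<beta>0 x\<bar> \<le> M" for x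
    using prof'_bound[OF beta_nonneg, of x] prof'_bound[OF b0, of x] prof''_bound[of \<beta>0 x] M by linarith+
  have BM: "cmod (Binv_sym b (eps * zt ah k)) \<le> M" "eps * cmod (zt ah k * Binv_sym b (eps * zt ah k)) \<le> M"
    "cmod (Binv_sym b (eps * zt ah k) - 1) \<le> M * eps * cmod (zt ah k)" for k
  proof -
    show "cmod (Binv_sym b (eps * zt ah k)) \<le> M" "eps * cmod (zt ah k * Binv_sym b (eps * zt ah k)) \<le> M"
      using B_bounds(1,2)[of k] M by linarith+
    have "2 * sqrt b * eps * cmod (zt ah k) \<le> M * eps * cmod (zt ah k)"
      using M eps by (intro mult_right_mono) auto
    then show "cmod (Binv_sym b (eps * zt ah k) - 1) \<le> M * eps * cmod (zt ah k)"
      using B_bounds(3)[of k] by linarith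
  qed
  have M1: "1 \<le> M" using M by simp
  have cM: "\<bar>c\<bar> \<le> M" using c_bounds M by simp
  have F1: "FTe ah eps (W_op a b c (eps * ah) (lam L) (I_eps eps g)) (\<lambda>k. G k
     + Rsym a b c eps ah (\<kappa> * eps\<^sup>2) 1 (prof \<beta>) (prof' \<beta>) (\<lambda>k. ?p k * G k) k
     + Rsym a b c eps ah (\<kappa> * eps\<^sup>2) (-1) (prof \<beta>) (prof' \<beta>) (\<lambda>k. ?m k * G k) k)"
    by (rule FTe_W_op[OF eps(1) C(1) wave_profiles FTe_I_eps[OF eps(1) G] bB bS bsym_all[OF L]])
  then have FW: "FT (\<lambda>x. complex_of_real (exp (ah * x)) * What a b ah eps L g x) (\<lambda>k. G k
     + Rsym a b c eps ah (\<kappa> * eps\<^sup>2) 1 (prof \<beta>) (prof' \<beta>) (\<lambda>k. ?p k * G k) k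
     + Rsym a b c eps ah (\<kappa> * eps\<^sup>2) (-1) (prof \<beta>) (prof' \<beta>) (\<lambda>k. ?m k * G k) k)"
    unfolding FTe_def What_def c_def lam_def .
  have th0: "theta0 a b = prof \<beta>0" unfolding \<beta>0_def by (rule theta0_prof)
  have "C1b (theta0 a b) (prof' \<beta>0)" unfolding th0 by (rule C0(1))
  from FTe_W0_op[OF this, of ah g G L] G m0_bsym[OF L]
  have F0: "FT (\<lambda>x. complex_of_real (exp (ah * x)) * W0_op a b ah L g x)
     (\<lambda>k. G k + 3 * (\<i> * zt ah k * cv (prof \<beta>0) (\<lambda>k. m0 L k * G k) k))"
    unfolding FTe_one th0 m0_def[abs_def] by blast
  \<comment> \<open>The identity parts of the two operators cancel. What is left is the plus part,
    small by itself, and the minus part with the limit operator subtracted.\<close>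
  define X where "X k = Rsym a b c eps ah (\<kappa> * eps\<^sup>2) 1 (prof \<beta>) (prof' \<beta>) (\<lambda>k. ?p k * G k) k
     + (Rsym a b c eps ah (\<kappa> * eps\<^sup>2) (-1) (prof \<beta>) (prof' \<beta>) (\<lambda>k. complex_of_real (2 / eps ^ 3) * mm L k * G k) k
     - 3 * (\<i> * zt ah k * cv (prof \<beta>0) (\<lambda>k. m0 L k * G k) k))" for k
  have mmm: "?m k = complex_of_real (2 / eps ^ 3) * mm L k" for k
  proof -
    have "complex_of_real (2 / eps ^ 3) * complex_of_real (eps ^ 3 / 2) = 1"
      using eps by (simp flip: of_real_mult)
    then show ?thesis unfolding mm_def mult.assoc[symmetric] by simp
  qed
  have "FT (\<lambda>x. complex_of_real (exp (ah * x)) * (What a b ah eps L g x - W0_op a b ah L g x)) X"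
  proof -
    have "X = (\<lambda>k. (G k + Rsym a b c eps ah (\<kappa> * eps\<^sup>2) 1 (prof \<beta>) (prof' \<beta>) (\<lambda>k. ?p k * G k) k
       + Rsym a b c eps ah (\<kappa> * eps\<^sup>2) (-1) (prof \<beta>) (prof' \<beta>) (\<lambda>k. ?m k * G k) k)
       - (G k + 3 * (\<i> * zt ah k * cv (prof \<beta>0) (\<lambda>k. m0 L k * G k) k)))"
      unfolding X_def mmm by (simp add: fun_eq_iff)
    then show ?thesis using FT_diff[OF FW F0] by (simp add: right_diff_distrib)
  qed
  note FX = this
  have "nb X (4 * M ^ 6 * eps * n + 12 * M ^ 3 * (eps + \<delta>) * n)"
    unfolding X_def
  proof (rule nb_add)
    have pM: "eps * cmod (?p k) \<le> M" for k using p_bound(2)[OF L, of k] M by linarith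
    have sM: "cmod (Sinv_sym a b (eps * zt ah k)) \<le> M" for k using s_norm[of k] M by linarith
    show "nb (Rsym a b c eps ah (\<kappa> * eps\<^sup>2) 1 (prof \<beta>) (prof' \<beta>) (\<lambda>k. ?p k * G k)) (4 * M ^ 6 * eps * n)"
      by (rule nb_plus_part[OF M1 eps C(1) one two(1) symbols_measurable(1) BM(1,2) symbols_measurable(2) sM symbols_measurable(3) pM M(10) cM nG])
    have mm1: "bsym (mm L)" "bsym (\<lambda>k. \<i> * zt ah k * mm L k)"
    proof -
      have cb: "bsym (\<lambda>k. complex_of_real (eps ^ 3 / 2))" unfolding bsym_def
        by (intro conjI exI[of _ "cmod (complex_of_real (eps ^ 3 / 2))"]) auto
      show "bsym (mm L)" unfolding mm_def[abs_def] by (rule bsym_mult[OF cb bsym_all(3)[OF L]])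
      show "bsym (\<lambda>k. \<i> * zt ah k * mm L k)"
        using bsym_mult[OF cb bsym_all(4)[OF L]] unfolding mm_def by (simp only: mult_ac)
    qed
    have m0M: "cmod (m0 L k) \<le> M" "cmod (zt ah k * m0 L k) \<le> M" "cmod ((zt ah k)\<^sup>2 * m0 L k) \<le> M" for k
      using m0_zt[OF L, of k] M by linarith+
    show "nb (\<lambda>k. Rsym a b c eps ah (\<kappa> * eps\<^sup>2) (-1) (prof \<beta>) (prof' \<beta>) (\<lambda>k. complex_of_real (2 / eps ^ 3) * mm L k * G k) k
     - 3 * (\<i> * zt ah k * cv (prof \<beta>0) (\<lambda>k. m0 L k * G k) k)) (12 * M ^ 3 * (eps + \<delta>) * n)"
    proof (rule nb_minus_part[OF M1 eps d0 C(1) one two(1) C0(1) one two(2) C0(2) two(3) d(2,3) symbols_measurable(1) BM symbols_measurable(2) sM mm1 symbols_measurable(6) m0M M(10) sah _ _ _ _ nG])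
      show "cmod (2 * mm L k + c * Sinv_sym a b (eps * zt ah k) * mm L k - 3 * m0 L k) \<le> \<delta>" if "\<bar>eps * k\<bar> \<le> 1" for k
        using d_low(1)[OF L that] d(1) by linarith
      show "cmod (zt ah k * (2 * mm L k + c * Sinv_sym a b (eps * zt ah k) * mm L k - 3 * m0 L k)) \<le> \<delta>" if "\<bar>eps * k\<bar> \<le> 1" for k
        using d_low(2)[OF L that] d(1) by linarith
      show "cmod (2 * mm L k + c * Sinv_sym a b (eps * zt ah k) * mm L k - 3 * m0 L k) \<le> eps * \<delta>" if "1 < \<bar>eps * k\<bar>" for k
        using d_high(1)[OF L that] mult_left_mono[OF d(1), of eps] eps by linarith
      show "cmod ((c * Sinv_sym a b (eps * zt ah k) - 1) * mm L k) \<le> \<delta>" for k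
        using cs_small[OF L, of k] d(1) by linarith
    qed
  qed
  then have "L2norm X \<le> (4 * M ^ 6 * eps + 12 * M ^ 3 * (eps + \<delta>)) * L2norm G"
    by (simp add: nb_def n_def distrib_right)
  then have "sqrt (2 * pi) * L2wnorm ah (\<lambda>x. What a b ah eps L g x - W0_op a b ah L g x)
     \<le> (4 * M ^ 6 * eps + 12 * M ^ 3 * (eps + \<delta>)) * (sqrt (2 * pi) * L2wnorm ah g)"
    unfolding Plancherel[OF FX] Plancherel[OF G] L2wnorm_def .
  then have "sqrt (2 * pi) * L2wnorm ah (\<lambda>x. What a b ah eps L g x - W0_op a b ah L g x)
     \<le> sqrt (2 * pi) * ((4 * M ^ 6 * eps + 12 * M ^ 3 * (eps + \<delta>)) * L2wnorm ah g)"
    by (simp only: mult.left_commute)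
  then have "L2wnorm ah (\<lambda>x. What a b ah eps L g x - W0_op a b ah L g x)
     \<le> (4 * M ^ 6 * eps + 12 * M ^ 3 * (eps + \<delta>)) * L2wnorm ah g"
    by (rule mult_left_le_imp_le) simp
  then show "L2w ah (\<lambda>x. What a b ah eps L g x - W0_op a b ah L g x) \<and>
     L2wnorm ah (\<lambda>x. What a b ah eps L g x - W0_op a b ah L g x)
     \<le> (4 * M ^ 6 * eps + 12 * M ^ 3 * (eps + \<delta>)) * L2wnorm ah g"
    using FT_L2(1)[OF FX] unfolding L2w_def by blast
qed

end

section \<open>Limits of the rescaled width and amplitude\<close>

lemma beta_tendsto:
  assumes "a < b"
  shows "((\<lambda>e. alpha_c a b (1 + e\<^sup>2 / 2) / e) \<longlongrightarrow> 1 / sqrt (b - a)) (at_right 0)"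
proof -
  have "((\<lambda>e::real. sqrt ((1 + e\<^sup>2 / 4) / (b * (1 + e\<^sup>2 / 2)\<^sup>2 - a))) \<longlongrightarrow> sqrt ((1 + 0\<^sup>2 / 4) / (b * (1 + 0\<^sup>2 / 2)\<^sup>2 - a))) (at_right 0)"
    using assms by (intro tendsto_intros) auto
  moreover have "\<forall>\<^sub>F e in at_right 0. sqrt ((1 + e\<^sup>2 / 4) / (b * (1 + e\<^sup>2 / 2)\<^sup>2 - a)) = alpha_c a b (1 + e\<^sup>2 / 2) / e"
    using eventually_at_right_less[of "0::real"]
  proof eventually_elim
    case (elim e)
    have "(1 + e\<^sup>2 / 2)\<^sup>2 - 1 = e\<^sup>2 * (1 + e\<^sup>2 / 4)" by (simp add: power2_eq_square field_simps)
    then have "alpha_c a b (1 + e\<^sup>2 / 2) = sqrt (e\<^sup>2 * ((1 + e\<^sup>2 / 4) / (b * (1 + e\<^sup>2 / 2)\<^sup>2 - a)))"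
      unfolding alpha_c_def by simp
    also have "\<dots> = e * sqrt ((1 + e\<^sup>2 / 4) / (b * (1 + e\<^sup>2 / 2)\<^sup>2 - a))"
      using elim unfolding real_sqrt_mult by simp
    finally show ?case using elim by simp
  qed
  ultimately show ?thesis
    using assms by (simp add: real_sqrt_divide filterlim_cong)
qed

lemma kappa_tendsto:
  "((\<lambda>e::real. ((1 + e\<^sup>2 / 2)\<^sup>2 - 1) / (1 + e\<^sup>2 / 2) / e\<^sup>2) \<longlongrightarrow> 1) (at_right 0)"
proof -
  have "((\<lambda>e::real. (1 + e\<^sup>2 / 4) / (1 + e\<^sup>2 / 2)) \<longlongrightarrow> (1 + 0\<^sup>2 / 4) / (1 + 0\<^sup>2 / 2)) (at_right 0)"
    by (intro tendsto_intros) auto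
  moreover have "\<forall>\<^sub>F e::real in at_right 0. (1 + e\<^sup>2 / 4) / (1 + e\<^sup>2 / 2) = ((1 + e\<^sup>2 / 2)\<^sup>2 - 1) / (1 + e\<^sup>2 / 2) / e\<^sup>2"
    using eventually_at_right_less[of "0::real"]
  proof eventually_elim
    case (elim e)
    have "(1 + e\<^sup>2 / 2)\<^sup>2 - 1 = e\<^sup>2 * (1 + e\<^sup>2 / 4)" by (simp add: power2_eq_square field_simps)
    then show ?case using elim by simp
  qed
  ultimately show ?thesis by (simp add: filterlim_cong)
qed

theorem theorem7p1:
  fixes a b ahat :: real
  assumes "0 < a" and "a < b"
    and "0 < ahat" and "ahat < 1 / sqrt (b - a)"
  defines "bhat \<equiv> ahat * (1 - (b - a) * ahat\<^sup>2)"
  shows "\<forall>\<eta>>0. \<forall>\<^sub>F eps in at_right 0.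
           \<forall>Lam. Re Lam \<ge> - bhat / 2 \<longrightarrow>
             opnorm_le ahat (\<lambda>g. (\<lambda>x. What a b ahat eps Lam g x - W0_op a b ahat Lam g x)) \<eta>"
proof (intro allI impI)
  fix \<eta> :: real assume \<eta>: "0 < \<eta>"
  define \<beta>0 where "\<beta>0 = 1 / sqrt (b - a)"
  define be where "be e = alpha_c a b (1 + e\<^sup>2 / 2) / e" for e
  define ka where "ka e = ((1 + e\<^sup>2 / 2)\<^sup>2 - 1) / (1 + e\<^sup>2 / 2) / e\<^sup>2" for e :: real
  have \<beta>0: "0 < \<beta>0" using assms by (simp add: \<beta>0_def)
  have ah2: "(b - a) * ahat\<^sup>2 < 1"
  proof -
    have "ahat * sqrt (b - a) < 1" using assms by (simp add: field_simps)
    then have "(ahat * sqrt (b - a))\<^sup>2 < 1" using assms by (simp add: abs_square_less_1)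
    then show ?thesis using assms by (simp add: power_mult_distrib mult.commute)
  qed
  \<comment> \<open>The locale constants used here do not take \<open>eps\<close> as an argument, so
    \<open>M\<close> is fixed before \<open>eps\<close>. The absolute values are there because the
    signs of \<open>Cs\<close> and \<open>c2\<close> are facts of the locale, which is entered only
    once \<open>eps\<close> is small. The term \<open>2 * \<beta>0\<close> makes room for the width
    of the rescaled wave.\<close>
  define M where "M = 2 + 2 / sqrt b + 2 * sqrt b + \<bar>scal.Cs a b\<bar> + 2 / ahat + \<bar>(scal.Z ahat)\<^sup>2 / scal.c2 a b ahat\<bar> + 2 * \<beta>0 + \<beta>0\<^sup>2"
  have b: "0 < b" using assms by simp
  have M0: "0 \<le> 2 / sqrt b" "0 \<le> 2 * sqrt b" "0 \<le> 2 / ahat" "0 \<le> 2 * \<beta>0" "0 \<le> \<beta>0\<^sup>2"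
    using assms b \<beta>0 by auto
  have M: "2 \<le> M" "2 / sqrt b \<le> M" "2 * sqrt b \<le> M" "scal.Cs a b \<le> M" "2 / ahat \<le> M" "(scal.Z ahat)\<^sup>2 / scal.c2 a b ahat \<le> M"
    "2 * \<beta>0 \<le> M" "\<beta>0\<^sup>2 \<le> M"
    using M0 unfolding M_def by linarith+
  \<comment> \<open>With this choice \<open>12 * M ^ 3 * \<delta>\<close> is a third of
    \<open>\<eta>\<close>, while the terms carrying \<open>eps\<close> are kept below one half of
    it.\<close>
  define \<delta> where "\<delta> = \<eta> / (36 * M ^ 3)"
  have Mp: "0 < M" using M by simp
  have \<delta>: "0 < \<delta>" using \<eta> Mp by (simp add: \<delta>_def)
  have tb: "(be \<longlongrightarrow> \<beta>0) (at_right 0)" unfolding be_def[abs_def] \<beta>0_def by (rule beta_tendsto[OF assms(2)])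
  have tk: "(ka \<longlongrightarrow> 1) (at_right 0)" unfolding ka_def[abs_def] by (rule kappa_tendsto)
  have te: "((\<lambda>e. e) \<longlongrightarrow> (0::real)) (at_right 0)" by (rule tendsto_ident_at)
  have "((\<lambda>e. b * (e * ahat)\<^sup>2) \<longlongrightarrow> b * (0 * ahat)\<^sup>2) (at_right 0)" by (intro tendsto_intros te)
  then have e1: "\<forall>\<^sub>F e in at_right 0. b * (e * ahat)\<^sup>2 < 1/4" by (rule order_tendstoD(2)) simp
  have "((\<lambda>e. 4 * b * (b - a) * ahat ^ 4 * e\<^sup>2) \<longlongrightarrow> 4 * b * (b - a) * ahat ^ 4 * 0\<^sup>2) (at_right 0)" by (intro tendsto_intros te)
  then have e2: "\<forall>\<^sub>F e in at_right 0. 4 * b * (b - a) * ahat ^ 4 * e\<^sup>2 < (1 - (b - a) * ahat\<^sup>2) / 4"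
    by (rule order_tendstoD(2)) (use ah2 in simp)
  have "((\<lambda>e. scal.K5 a b ahat * sqrt e) \<longlongrightarrow> scal.K5 a b ahat * sqrt 0) (at_right 0)" by (intro tendsto_intros te)
  then have e3: "\<forall>\<^sub>F e in at_right 0. scal.K5 a b ahat * sqrt e < \<delta>" by (rule order_tendstoD(2)) (use \<delta> in simp)
  have "((\<lambda>e. 4 * M ^ 6 * e + 12 * M ^ 3 * e) \<longlongrightarrow> 4 * M ^ 6 * 0 + 12 * M ^ 3 * 0) (at_right 0)" by (intro tendsto_intros te)
  then have e4: "\<forall>\<^sub>F e in at_right 0. 4 * M ^ 6 * e + 12 * M ^ 3 * e < \<eta> / 2" by (rule order_tendstoD(2)) (use \<eta> in simp)
  \<comment> \<open>One quantity dominates the errors of the profile and of its derivative: 1 and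
    \<open>2 * \<beta>0\<close> bound their suprema and multiply the amplitude error, while
    \<open>4 / \<beta>0\<close> and 3 are the Lipschitz constants in the width from
    \<open>prof_diff\<close>.\<close>
  have "((\<lambda>e. \<bar>ka e - 1\<bar> * (1 + 2 * \<beta>0) + (4 / \<beta>0 + 3) * \<bar>be e - \<beta>0\<bar>) \<longlongrightarrow> \<bar>1 - 1\<bar> * (1 + 2 * \<beta>0) + (4 / \<beta>0 + 3) * \<bar>\<beta>0 - \<beta>0\<bar>) (at_right 0)"
    by (intro tendsto_intros tk tb)
  then have e5: "\<forall>\<^sub>F e in at_right 0. \<bar>ka e - 1\<bar> * (1 + 2 * \<beta>0) + (4 / \<beta>0 + 3) * \<bar>be e - \<beta>0\<bar> < \<delta>"
    by (rule order_tendstoD(2)) (use \<delta> in simp)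
  have e6: "\<forall>\<^sub>F e in at_right 0. \<beta>0 / 2 < be e" by (rule order_tendstoD(1)[OF tb]) (use \<beta>0 in simp)
  have e7: "\<forall>\<^sub>F e in at_right 0. be e < 2 * \<beta>0" by (rule order_tendstoD(2)[OF tb]) (use \<beta>0 in simp)
  have e8: "\<forall>\<^sub>F e in at_right 0. 0 < ka e" "\<forall>\<^sub>F e in at_right 0. ka e < 2"
    using order_tendstoD[OF tk] by auto
  have e9: "\<forall>\<^sub>F e in at_right 0. e < (1::real)" by (rule order_tendstoD(2)[OF te]) simp
  show "\<forall>\<^sub>F eps in at_right 0. \<forall>Lam. Re Lam \<ge> - bhat / 2 \<longrightarrow>
     opnorm_le ahat (\<lambda>g. (\<lambda>x. What a b ahat eps Lam g x - W0_op a b ahat Lam g x)) \<eta>"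
    using e1 e2 e3 e4 e5 e6 e7 e8 e9 eventually_at_right_less[of "0::real"]
  proof eventually_elim
    case (elim e)
    interpret scal a b ahat e
      using assms ah2 elim by unfold_locales auto
    have be: "\<beta> = be e" and ka: "\<kappa> = ka e"
      unfolding \<beta>_def \<kappa>_def be_def ka_def c_def by simp_all
    have bh: "bhat = scal.bhat a b ahat" unfolding assms(5) bhat_def ..
    have m1: "\<bar>ka e * prof (be e) x - prof \<beta>0 x\<bar> \<le> \<delta>" and m2: "\<bar>ka e * prof' (be e) x - prof' \<beta>0 x\<bar> \<le> \<delta>" for x
    proof -
      note pd = prof_diff[OF \<beta>0 less_imp_le[OF elim(6)], of x]
      define A where "A = \<bar>ka e - 1\<bar>"
      define D where "D = \<bar>be e - \<beta>0\<bar>"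
      have k0: "0 \<le> A * (2 * \<beta>0)" "0 \<le> A" "0 \<le> 4 / \<beta>0 * D" "0 \<le> 3 * D"
        using \<beta>0 by (auto simp: A_def D_def)
      have E: "A * (1 + 2 * \<beta>0) + (4 / \<beta>0 + 3) * D = A + A * (2 * \<beta>0) + 4 / \<beta>0 * D + 3 * D"
        by (simp add: algebra_simps)
      note El = elim(5)[folded A_def D_def, unfolded E]
      have split: "\<bar>ka e * s - t\<bar> \<le> A * \<bar>s\<bar> + \<bar>s - t\<bar>" for s t
      proof -
        have "ka e * s - t = (ka e - 1) * s + (s - t)" by (simp add: algebra_simps)
        then show ?thesis unfolding A_def abs_mult[symmetric] by (simp only: abs_triangle_ineq)
      qed
      have "A * \<bar>prof (be e) x\<bar> \<le> A * 1"
        using prof_range[of "be e" x] by (intro mult_left_mono) (auto simp: A_def)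
      then have "A * \<bar>prof (be e) x\<bar> + \<bar>prof (be e) x - prof \<beta>0 x\<bar> \<le> A * 1 + 4 / \<beta>0 * D"
        unfolding D_def by (intro add_mono pd(1))
      then show "\<bar>ka e * prof (be e) x - prof \<beta>0 x\<bar> \<le> \<delta>"
        by (rule order_trans[OF split order_trans]) (use k0 El in linarith)
      have "A * \<bar>prof' (be e) x\<bar> \<le> A * (2 * \<beta>0)"
        using order_trans[OF prof'_bound[of "be e" x], of "2 * \<beta>0"] elim(6,7) \<beta>0 by (intro mult_left_mono) (auto simp: A_def)
      then have "A * \<bar>prof' (be e) x\<bar> + \<bar>prof' (be e) x - prof' \<beta>0 x\<bar> \<le> A * (2 * \<beta>0) + 3 * D"
        unfolding D_def by (intro add_mono pd(2))
      then show "\<bar>ka e * prof' (be e) x - prof' \<beta>0 x\<bar> \<le> \<delta>"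
        by (rule order_trans[OF split order_trans]) (use k0 El in linarith)
    qed
    show ?case
    proof (intro allI impI)
      fix Lam assume "Re Lam \<ge> - bhat / 2"
      then have "opnorm_le ahat (\<lambda>g. (\<lambda>x. What a b ahat e Lam g x - W0_op a b ahat Lam g x)) (4 * M ^ 6 * e + 12 * M ^ 3 * (e + \<delta>))"
        unfolding bh
      proof (rule opnorm_bound)
        show "\<beta> \<le> M" "1 / sqrt (b - a) \<le> M" "(1 / sqrt (b - a))\<^sup>2 \<le> M" "\<bar>\<kappa>\<bar> \<le> M"
          using elim M \<beta>0 unfolding be ka \<beta>0_def[symmetric] by linarith+
        show "\<bar>\<kappa> * prof \<beta> x - prof (1 / sqrt (b - a)) x\<bar> \<le> \<delta>" "\<bar>\<kappa> * prof' \<beta> x - prof' (1 / sqrt (b - a)) x\<bar> \<le> \<delta>" for x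
          using m1[of x] m2[of x] unfolding be ka \<beta>0_def by auto
      qed (use M elim in auto)
      moreover have "4 * M ^ 6 * e + 12 * M ^ 3 * (e + \<delta>) \<le> \<eta>"
      proof -
        have "12 * M ^ 3 * \<delta> = \<eta> / 3" using Mp by (simp add: \<delta>_def)
        then show ?thesis using elim(4) \<eta> by (simp add: distrib_left)
      qed
      moreover have "0 \<le> L2wnorm ahat g" for g by (simp add: L2wnorm_def)
      ultimately show "opnorm_le ahat (\<lambda>g. (\<lambda>x. What a b ahat e Lam g x - W0_op a b ahat Lam g x)) \<eta>"
        unfolding opnorm_le_def by (meson mult_right_mono order_trans)
    qed
  qed
qed

end
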